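(* Let $\Lambda$ be a two-sided sofic subshift, let $E$ be the C*-correspondence of $\Lambda$, and let $G=(G^0,G^1)$ be the underlying unlabeled graph of the follower set graph of $\Lambda$. Then $\mathcal O_E$ is $*$-isomorphic to the graph C*-algebra $C^*(G)$.
   Context: A two-sided subshift on $\{1,\dots,d\}$ is a closed $\Lambda\subseteq\{1,\dots,d\}^{\mathbb Z}$ with $\sigma(\Lambda)=\Lambda$, $\sigma$ being the shift; it is sofic if it is a factor of a subshift of finite type. $\Lambda^*$ is the set of finite words (including the empty word $\emptyset$) occurring in elements of $\Lambda$; all letters $1,\dots,d$ are assumed to be in $\Lambda^*$. The C*-correspondence of $\Lambda$ is that of the monomial ideal generated by the words not in $\Lambda^*$: let $\mathcal F_X$ be the Hilbert space with orthonormal basis $\{e_\mu:\mu\in\Lambda^*\}$, $T_ie_\nu=e_{i\nu}$ if $i\nu\in\Lambda^*$, $T_ie_\nu=0$ otherwise, $T_\mu=T_{\mu_1}\cdots T_{\mu_n}$, $T_\emptyset=I$; let $A=C^*(T_\mu^*T_\mu:\mu\in\Lambda^* )$ and $E=\overline{\mathrm{span}}\{T_ia:a\in A,\ i=1,\dots,d\}$, a C*-correspondence over $A$ with $a\cdot\xi\cdot b=a\xi b$, $\langle\xi,\eta\rangle=\xi^*\eta$, left action $\phi_E$. A representation $(\pi,t)$ of $E$: $\pi$ a $*$-representation of $A$ on $H$, $t:E\to B(H)$ linear, $t(\xi)^*t(\eta)=\pi(\langle\xi,\eta\rangle)$, $\pi(a)t(\xi)=t(\phi_E(a)\xi)$;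 $\psi_t(\Theta_{\xi,\eta})=t(\xi)t(\eta)^*$ on $\mathcal K(E)$. $\mathcal O_E$ is the universal C*-algebra generated by $A$ and $E$ for representations with $\pi(a)=\psi_t(\phi_E(a))$ for $a\in J_E=(\ker\phi_E)^\perp\cap\phi_E^{-1}(\mathcal K(E))$. The follower set of $\mu\in\Lambda^*$ is $F(\mu)=\{w\in\Lambda^*: w\mu\in\Lambda^*\}$. The follower set graph has as vertices the (finitely many) follower sets $F(\mu)$, $\mu\in\Lambda^*$ (including $\mu=\emptyset$), and exactly one edge labeled $i$ from $F(\mu)$ to $F(i\mu)$ whenever $i\mu\in\Lambda^*$. $G$ is obtained by erasing the labels, without identifying different (parallel) edges. For a finite directed graph $G$ with source and range maps $s,r$, $C^*(G)$ is the universal C*-algebra generated by mutually orthogonal projections $P_v$ ($v\in G^0$) and partial isometries $S_e$ ($e\in G^1$) with $S_e^*S_e=P_{s(e)}$ and $P_v=\sum_{r(e)=v}S_eS_e^*$ whenever $r^{-1}(v)\neq\emptyset$. *)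

theory Defs
  imports
    "HOL-Analysis.Analysis"
    "HOL-Library.Infinite_Typeclass"
    "Graph_Theory.Digraph"
begin

section \<open>Hilbert spaces and bounded operators\<close>

class complex_normed_vector = real_normed_vector +
  fixes scaleC :: "complex \<Rightarrow> 'a \<Rightarrow> 'a" (infixr "*\<^sub>C" 75)
  assumes scaleC_add_right: "c *\<^sub>C (x + y) = c *\<^sub>C x + c *\<^sub>C y"
    and scaleC_add_left: "(b + c) *\<^sub>C x = b *\<^sub>C x + c *\<^sub>C x"
    and scaleC_scaleC: "b *\<^sub>C c *\<^sub>C x = (b * c) *\<^sub>C x"
    and scaleC_of_real: "complex_of_real r *\<^sub>C x = r *\<^sub>R x"
    and norm_scaleC: "norm (c *\<^sub>C x) = cmod c * norm x"

subsection \<open>The Hilbert space of square-summable functions\<close>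

typedef 'a ell2 = "{x :: 'a \<Rightarrow> complex. (\<lambda>i. (cmod (x i))\<^sup>2) summable_on UNIV}"
  morphisms coord Abs_ell2
  by (rule exI[of _ "\<lambda>_. 0"]) simp

setup_lifting type_definition_ell2

lemma sq_summable_add:
  fixes x y :: "'a \<Rightarrow> complex"
  assumes "(\<lambda>i. (cmod (x i))\<^sup>2) summable_on UNIV" "(\<lambda>i. (cmod (y i))\<^sup>2) summable_on UNIV"
  shows "(\<lambda>i. (cmod (x i + y i))\<^sup>2) summable_on UNIV"
proof (rule summable_on_comparison_test)
  show "(\<lambda>i. 2 * (cmod (x i))\<^sup>2 + 2 * (cmod (y i))\<^sup>2) summable_on UNIV"
    by (intro summable_on_add summable_on_cmult_right assms)
  fix i
  have "(cmod (x i + y i))\<^sup>2 \<le> (cmod (x i) + cmod (y i))\<^sup>2"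
    by (intro power_mono norm_triangle_ineq) auto
  also have "\<dots> \<le> 2 * (cmod (x i))\<^sup>2 + 2 * (cmod (y i))\<^sup>2"
    using sum_squares_bound[of "cmod (x i)" "cmod (y i)"] by (simp add: power2_sum)
  finally show "(cmod (x i + y i))\<^sup>2 \<le> 2 * (cmod (x i))\<^sup>2 + 2 * (cmod (y i))\<^sup>2" .
qed auto

lemma sq_summable_scale:
  fixes x :: "'a \<Rightarrow> complex"
  assumes "(\<lambda>i. (cmod (x i))\<^sup>2) summable_on UNIV"
  shows "(\<lambda>i. (cmod (c * x i))\<^sup>2) summable_on UNIV"
  unfolding norm_mult power_mult_distrib by (intro summable_on_cmult_right assms)

lemma sq_summable_mult:
  fixes x y :: "'a \<Rightarrow> complex"
  assumes "(\<lambda>i. (cmod (x i))\<^sup>2) summable_on UNIV" "(\<lambda>i. (cmod (y i))\<^sup>2) summable_on UNIV"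
  shows "(\<lambda>i. cnj (x i) * y i) summable_on UNIV"
proof (rule abs_summable_summable, rule summable_on_comparison_test)
  show "(\<lambda>i. (cmod (x i))\<^sup>2 + (cmod (y i))\<^sup>2) summable_on UNIV"
    by (intro summable_on_add assms)
  fix i
  show "norm (cnj (x i) * y i) \<le> (cmod (x i))\<^sup>2 + (cmod (y i))\<^sup>2"
    using sum_squares_bound[of "cmod (x i)" "cmod (y i)"]
      mult_nonneg_nonneg[OF norm_ge_zero[of "x i"] norm_ge_zero[of "y i"]]
    unfolding norm_mult complex_mod_cnj by linarith
qed auto

definition cinner :: "'a ell2 \<Rightarrow> 'a ell2 \<Rightarrow> complex" where
  "cinner x y = (\<Sum>\<^sub>\<infinity>i. cnj (coord x i) * coord y i)"

instantiation ell2 :: (type) real_inner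
begin

lift_definition zero_ell2 :: "'a ell2" is "\<lambda>_. 0" by simp
lift_definition plus_ell2 :: "'a ell2 \<Rightarrow> 'a ell2 \<Rightarrow> 'a ell2" is "\<lambda>x y i. x i + y i"
  by (rule sq_summable_add)
lift_definition uminus_ell2 :: "'a ell2 \<Rightarrow> 'a ell2" is "\<lambda>x i. - x i" by simp
lift_definition minus_ell2 :: "'a ell2 \<Rightarrow> 'a ell2 \<Rightarrow> 'a ell2" is "\<lambda>x y i. x i - y i"
  using sq_summable_add[where y = "\<lambda>i. - _ i"] by simp
lift_definition scaleR_ell2 :: "real \<Rightarrow> 'a ell2 \<Rightarrow> 'a ell2" is "\<lambda>r x i. complex_of_real r * x i"
  by (rule sq_summable_scale)

definition inner_ell2 :: "'a ell2 \<Rightarrow> 'a ell2 \<Rightarrow> real" where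
  "inner_ell2 x y = Re (cinner x y)"
definition norm_ell2 :: "'a ell2 \<Rightarrow> real" where
  "norm_ell2 x = sqrt (inner x x)"
definition sgn_ell2 :: "'a ell2 \<Rightarrow> 'a ell2" where
  "sgn_ell2 x = scaleR (inverse (norm x)) x"
definition dist_ell2 :: "'a ell2 \<Rightarrow> 'a ell2 \<Rightarrow> real" where
  "dist_ell2 x y = norm (x - y)"
definition uniformity_ell2 :: "('a ell2 \<times> 'a ell2) filter" where
  "uniformity_ell2 = (INF e\<in>{0 <..}. principal {(x, y). dist x y < e})"
definition open_ell2 :: "'a ell2 set \<Rightarrow> bool" where
  "open_ell2 U \<longleftrightarrow> (\<forall>x\<in>U. \<forall>\<^sub>F (x', y) in uniformity. x' = x \<longrightarrow> y \<in> U)"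

lemma cinner_summable: "(\<lambda>i. cnj (coord x i) * coord y i) summable_on UNIV"
  using coord[of x] coord[of y] by (intro sq_summable_mult) auto

lemma cinner_commute: "cinner x y = cnj (cinner y x)"
  unfolding cinner_def infsum_cnj[symmetric] by (simp add: mult.commute)

lemma cinner_add_left: "cinner (x + y) z = cinner x z + cinner y z"
  unfolding cinner_def plus_ell2.rep_eq
  by (simp add: distrib_right infsum_add cinner_summable)

lemma cinner_self: "cinner x x = complex_of_real (\<Sum>\<^sub>\<infinity>i. (cmod (coord x i))\<^sup>2)"
proof -
  have "((\<lambda>i. complex_of_real ((cmod (coord x i))\<^sup>2)) has_sum
          complex_of_real (\<Sum>\<^sub>\<infinity>i. (cmod (coord x i))\<^sup>2)) UNIV"
    using coord[of x] by (intro has_sum_of_real has_sum_infsum) simp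
  then show ?thesis
    unfolding cinner_def
    by (simp add: infsumI complex_norm_square[symmetric] mult.commute[of "cnj _"] of_real_power)
qed

instance
proof
  fix x y z :: "'a ell2" and r s :: real
  show "x + y + z = x + (y + z)" by transfer (simp add: add.assoc)
  show "x + y = y + x" by transfer (simp add: add.commute)
  show "0 + x = x" by transfer simp
  show "- x + x = 0" by transfer simp
  show "x - y = x + - y" by transfer simp
  show "r *\<^sub>R (x + y) = r *\<^sub>R x + r *\<^sub>R y" by transfer (simp add: distrib_left)
  show "(r + s) *\<^sub>R x = r *\<^sub>R x + s *\<^sub>R x" by transfer (simp add: distrib_right)
  show "r *\<^sub>R s *\<^sub>R x = (r * s) *\<^sub>R x" by transfer (simp add: mult.assoc)
  show "1 *\<^sub>R x = x" by transfer simp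
  show "sgn x = scaleR (inverse (norm x)) x" by (rule sgn_ell2_def)
  show "dist x y = norm (x - y)" by (rule dist_ell2_def)
  show "norm x = sqrt (inner x x)" by (rule norm_ell2_def)
  show "inner x y = inner y x"
    unfolding inner_ell2_def by (subst cinner_commute) simp
  show "inner (x + y) z = inner x z + inner y z"
    unfolding inner_ell2_def by (simp add: cinner_add_left)
  show "inner (r *\<^sub>R x) y = r * inner x y"
    unfolding inner_ell2_def cinner_def scaleR_ell2.rep_eq
    by (simp add: mult.assoc infsum_cmult_right')
  show "0 \<le> inner x x"
    unfolding inner_ell2_def cinner_self by (simp add: infsum_nonneg)
  show "inner x x = 0 \<longleftrightarrow> x = 0"
  proof
    assume "inner x x = 0"
    then have 0: "(\<Sum>\<^sub>\<infinity>i. (cmod (coord x i))\<^sup>2) = 0"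
      unfolding inner_ell2_def cinner_self by simp
    have "(cmod (coord x i))\<^sup>2 = 0" for i
      using coord[of x] 0 by (intro nonneg_infsum_le_0D[where A = UNIV]) auto
    then show "x = 0"
      by (intro coord_inject[THEN iffD1] ext) (simp add: zero_ell2.rep_eq)
  qed (simp add: inner_ell2_def cinner_def zero_ell2.rep_eq)
qed (rule uniformity_ell2_def open_ell2_def)+

end

lemma norm_ell2_sq: "(norm (x :: 'a ell2))\<^sup>2 = (\<Sum>\<^sub>\<infinity>i. (cmod (coord x i))\<^sup>2)"
  by (simp add: power2_norm_eq_inner inner_ell2_def cinner_self)

instantiation ell2 :: (type) complex_normed_vector
begin

lift_definition scaleC_ell2 :: "complex \<Rightarrow> 'a ell2 \<Rightarrow> 'a ell2" is "\<lambda>c x i. c * x i"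
  by (rule sq_summable_scale)

instance
proof
  fix x y :: "'a ell2" and b c :: complex and r :: real
  show "c *\<^sub>C (x + y) = c *\<^sub>C x + c *\<^sub>C y" by transfer (simp add: distrib_left)
  show "(b + c) *\<^sub>C x = b *\<^sub>C x + c *\<^sub>C x" by transfer (simp add: distrib_right)
  show "b *\<^sub>C c *\<^sub>C x = (b * c) *\<^sub>C x" by transfer (simp add: mult.assoc)
  show "complex_of_real r *\<^sub>C x = r *\<^sub>R x" by transfer simp
  have "(norm (c *\<^sub>C x))\<^sup>2 = (cmod c * norm x)\<^sup>2"
    unfolding norm_ell2_sq power_mult_distrib scaleC_ell2.rep_eq norm_mult
    by (rule infsum_cmult_right')
  then show "norm (c *\<^sub>C x) = cmod c * norm x"
    by (rule power2_eq_imp_eq) auto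
qed

end

lift_definition ket :: "'a \<Rightarrow> 'a ell2" is "\<lambda>i j. if j = i then 1 else 0"
proof -
  fix i :: 'a
  have "(\<lambda>j. (cmod (if j = i then 1 else 0))\<^sup>2) summable_on {i}"
    by simp
  then show "(\<lambda>j. (cmod (if j = i then 1 else 0))\<^sup>2) summable_on UNIV"
    by (rule summable_on_cong_neutral[THEN iffD1, rotated -1]) auto
qed

lemma cinner_ket: "cinner (ket i) x = coord x i"
proof -
  have "cinner (ket i) x = (\<Sum>\<^sub>\<infinity>j\<in>{i}. cnj (coord (ket i) j) * coord x j)"
    unfolding cinner_def by (rule infsum_cong_neutral) (auto simp: ket.rep_eq)
  then show ?thesis by (simp add: ket.rep_eq)
qed

lemma coord_sum: "coord (\<Sum>i\<in>F. f i) j = (\<Sum>i\<in>F. coord (f i) j)"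
  by (induction F rule: infinite_finite_induct) (auto simp: zero_ell2.rep_eq plus_ell2.rep_eq)

lemma ell2_expansion: "((\<lambda>i. coord x i *\<^sub>C ket i) has_sum x) UNIV"
proof -
  define q where "q = (\<lambda>i. (cmod (coord x i))\<^sup>2)"
  have q: "q summable_on UNIV" unfolding q_def using coord[of x] by simp
  have n: "(norm ((\<Sum>i\<in>F. coord x i *\<^sub>C ket i) - x))\<^sup>2 = infsum q UNIV - sum q F"
    if "finite F" for F
  proof -
    have c: "coord ((\<Sum>i\<in>F. coord x i *\<^sub>C ket i) - x) j = (if j \<in> F then 0 else - coord x j)" for j
      using that by (simp add: minus_ell2.rep_eq coord_sum scaleC_ell2.rep_eq ket.rep_eq if_distrib cong: if_cong)
    have "(norm ((\<Sum>i\<in>F. coord x i *\<^sub>C ket i) - x))\<^sup>2 = infsum q (UNIV - F)"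
      unfolding norm_ell2_sq c by (rule infsum_cong_neutral) (auto simp: q_def)
    also have "\<dots> = infsum q UNIV - infsum q F"
      by (rule infsum_Diff) (use q that in auto)
    finally show ?thesis using that by simp
  qed
  have "(sum q \<longlongrightarrow> infsum q UNIV) (finite_subsets_at_top UNIV)"
    using has_sum_infsum[OF q] by (simp add: has_sum_def)
  then have "((\<lambda>F. infsum q UNIV - sum q F) \<longlongrightarrow> 0) (finite_subsets_at_top UNIV)"
    by (auto intro: tendsto_eq_intros)
  then have "((\<lambda>F. (norm ((\<Sum>i\<in>F. coord x i *\<^sub>C ket i) - x))\<^sup>2) \<longlongrightarrow> 0) (finite_subsets_at_top UNIV)"
    by (rule Lim_transform_eventually) (auto simp: n intro!: eventually_finite_subsets_at_top_weakI)
  then have "((\<lambda>F. sqrt ((norm ((\<Sum>i\<in>F. coord x i *\<^sub>C ket i) - x))\<^sup>2)) \<longlongrightarrow> sqrt 0)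
      (finite_subsets_at_top UNIV)"
    by (rule tendsto_real_sqrt)
  then show ?thesis
    unfolding has_sum_def by (simp add: tendsto_norm_zero_iff LIM_zero_iff)
qed

lemma ell2_relabel:
  fixes g :: "'b \<Rightarrow> 'a" and f :: "'a ell2 \<Rightarrow> 'b \<Rightarrow> complex"
  assumes g: "inj_on g D" and f: "\<And>x w. f x w = (if w \<in> D then coord x (g w) else 0)"
  shows "bounded_linear (\<lambda>x. Abs_ell2 (f x))" and "coord (Abs_ell2 (f x)) = f x"
proof -
  have q: "(\<lambda>i. (cmod (coord x i))\<^sup>2) summable_on A" for x :: "'a ell2" and A
    using summable_on_subset_banach[of "\<lambda>i. (cmod (coord x i))\<^sup>2" UNIV A] coord[of x] by simp
  have "(\<lambda>w. (cmod (f x w))\<^sup>2) summable_on UNIV" for x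
  proof -
    have "((\<lambda>i. (cmod (coord x i))\<^sup>2) \<circ> g) summable_on D"
      using q[of x "g ` D"] by (simp add: summable_on_reindex[OF g])
    then show ?thesis
      by (rule summable_on_cong_neutral[THEN iffD1, rotated -1]) (auto simp: f)
  qed
  then have c: "coord (Abs_ell2 (f x)) = f x" for x
    by (simp add: Abs_ell2_inverse)
  then show "coord (Abs_ell2 (f x)) = f x" .
  show "bounded_linear (\<lambda>x. Abs_ell2 (f x))"
  proof (rule bounded_linear_intro[where K = 1])
    fix x y :: "'a ell2" and r :: real
    show "Abs_ell2 (f (x + y)) = Abs_ell2 (f x) + Abs_ell2 (f y)"
      by (rule coord_inject[THEN iffD1]) (auto simp: c plus_ell2.rep_eq f)
    show "Abs_ell2 (f (r *\<^sub>R x)) = r *\<^sub>R Abs_ell2 (f x)"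
      by (rule coord_inject[THEN iffD1]) (auto simp: c scaleR_ell2.rep_eq f)
    have "(norm (Abs_ell2 (f x)))\<^sup>2 = infsum ((\<lambda>i. (cmod (coord x i))\<^sup>2) \<circ> g) D"
      unfolding norm_ell2_sq c by (rule infsum_cong_neutral) (auto simp: f)
    also have "\<dots> = infsum (\<lambda>i. (cmod (coord x i))\<^sup>2) (g ` D)"
      by (rule infsum_reindex[OF g, symmetric])
    also have "\<dots> \<le> (norm x)\<^sup>2"
      unfolding norm_ell2_sq by (rule infsum_mono2) (auto intro: q)
    finally show "norm (Abs_ell2 (f x)) \<le> norm x * 1"
      unfolding mult_1_right by (rule power2_le_imp_le) simp
  qed
qed

subsection \<open>Bounded operators, adjoints, concrete C*-algebras\<close>

instantiation blinfun :: (real_normed_vector, complex_normed_vector) complex_normed_vector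
begin

lift_definition scaleC_blinfun :: "complex \<Rightarrow> ('a \<Rightarrow>\<^sub>L 'b) \<Rightarrow> ('a \<Rightarrow>\<^sub>L 'b)"
  is "\<lambda>c f x. c *\<^sub>C f x"
proof -
  fix c :: complex and f :: "'a \<Rightarrow> 'b"
  assume "bounded_linear f"
  then interpret bounded_linear f .
  obtain K where K: "\<And>x. norm (f x) \<le> norm x * K" using bounded by blast
  show "bounded_linear (\<lambda>x. c *\<^sub>C f x)"
  proof (rule bounded_linear_intro[where K = "cmod c * K"])
    fix x y :: 'a and r :: real
    show "c *\<^sub>C f (x + y) = c *\<^sub>C f x + c *\<^sub>C f y" by (simp add: add scaleC_add_right)
    show "c *\<^sub>C f (r *\<^sub>R x) = r *\<^sub>R c *\<^sub>C f x"
      by (simp add: scaleR scaleC_of_real[symmetric] scaleC_scaleC mult.commute)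
    show "norm (c *\<^sub>C f x) \<le> norm x * (cmod c * K)"
      using mult_left_mono[OF K[of x], of "cmod c"] by (simp add: norm_scaleC mult_ac)
  qed
qed

instance
proof
  fix f g :: "'a \<Rightarrow>\<^sub>L 'b" and b c :: complex and r :: real
  show "c *\<^sub>C (f + g) = c *\<^sub>C f + c *\<^sub>C g" by transfer (simp add: scaleC_add_right)
  show "(b + c) *\<^sub>C f = b *\<^sub>C f + c *\<^sub>C f" by transfer (simp add: scaleC_add_left)
  show "b *\<^sub>C c *\<^sub>C f = (b * c) *\<^sub>C f" by transfer (simp add: scaleC_scaleC)
  show "complex_of_real r *\<^sub>C f = r *\<^sub>R f" by transfer (simp add: scaleC_of_real)
  show "norm (c *\<^sub>C f) = cmod c * norm f"
  proof transfer
    fix c :: complex and f :: "'a \<Rightarrow> 'b"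
    assume "bounded_linear f"
    have "onorm (\<lambda>x. c *\<^sub>C f x) = onorm (\<lambda>x. cmod c *\<^sub>R f x)"
      unfolding onorm_def by (simp add: norm_scaleC)
    also have "\<dots> = cmod c * onorm f"
      using onorm_scaleR[OF \<open>bounded_linear f\<close>, of "cmod c"] by simp
    finally show "onorm (\<lambda>x. c *\<^sub>C f x) = cmod c * onorm f" .
  qed
qed

end

text \<open>The library's bounded linear maps are real-linear; \<open>bounded_ops\<close> is the algebra
  \<open>B(H)\<close> of the complex-linear ones.\<close>

type_synonym 'a op = "'a ell2 \<Rightarrow>\<^sub>L 'a ell2"

definition bounded_ops :: "'a op set" where
  "bounded_ops = {T. \<forall>c x. blinfun_apply T (c *\<^sub>C x) = c *\<^sub>C blinfun_apply T x}"

definition adj :: "'a op \<Rightarrow> 'a op" where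
  "adj T = (THE S. \<forall>x y. cinner (blinfun_apply S x) y = cinner x (blinfun_apply T y))"

lemma scaleR_scaleC_commute: "r *\<^sub>R c *\<^sub>C x = c *\<^sub>C r *\<^sub>R (x :: 'a::complex_normed_vector)"
  by (simp add: scaleC_of_real[symmetric] scaleC_scaleC mult.commute)

lemma scaleC_zero_right: "c *\<^sub>C (0 :: 'a::complex_normed_vector) = 0"
  using scaleC_add_right[of c 0 "0 :: 'a"] by simp

lemma cinner_scaleC_right: "cinner x (c *\<^sub>C y) = c * cinner x y"
  unfolding cinner_def scaleC_ell2.rep_eq mult.left_commute[of _ c] by (rule infsum_cmult_right')

lemma cinner_scaleC_left: "cinner (c *\<^sub>C x) y = cnj c * cinner x y"
  unfolding cinner_def scaleC_ell2.rep_eq complex_cnj_mult mult.assoc by (rule infsum_cmult_right')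

lemma cinner_zero_right [simp]: "cinner x 0 = 0"
  by (simp add: cinner_def zero_ell2.rep_eq)

lemma cinner_add_right: "cinner x (y + z) = cinner x y + cinner x z"
  using cinner_commute cinner_add_left by (metis complex_cnj_add)

lemma cinner_sum_left: "cinner (\<Sum>i\<in>F. f i) y = (\<Sum>i\<in>F. cinner (f i) y)"
proof (induction F rule: infinite_finite_induct)
  case (insert i F)
  then show ?case by (simp add: cinner_add_left)
qed (simp_all add: cinner_def zero_ell2.rep_eq)

lemma cinner_conv_inner: "cinner x y = Complex (inner x y) (inner (\<i> *\<^sub>C x) y)"
  by (simp add: complex_eq_iff inner_ell2_def cinner_scaleC_left)

lemma cinner_eqI: "(\<And>x. cinner x y = cinner x z) \<Longrightarrow> y = z"
  by (metis cinner_ket coord_inject ext)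

lemma adjoint_exists:
  assumes T: "T \<in> bounded_ops"
  shows "\<exists>S. \<forall>x y. cinner (blinfun_apply S x) y = cinner x (blinfun_apply T y)"
proof -
  define z where "z y i = cinner (T (ket i)) y" for y i
  have TC: "T (c *\<^sub>C x) = c *\<^sub>C T x" for c x
    using T by (auto simp: bounded_ops_def)
  have zbound: "(\<Sum>i\<in>F. (cmod (z y i))\<^sup>2) \<le> (norm T * norm y)\<^sup>2" if "finite F" for y F
  proof -
    define s where "s = (\<Sum>i\<in>F. (cmod (z y i))\<^sup>2)"
    define x where "x = (\<Sum>i\<in>F. z y i *\<^sub>C ket i)"
    have cx: "coord x j = (if j \<in> F then z y j else 0)" for j
      using that by (simp add: x_def coord_sum scaleC_ell2.rep_eq ket.rep_eq if_distrib cong: if_cong)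
    have "(norm x)\<^sup>2 = (\<Sum>\<^sub>\<infinity>i\<in>F. (cmod (z y i))\<^sup>2)"
      unfolding norm_ell2_sq cx by (rule infsum_cong_neutral) auto
    then have nx: "(norm x)\<^sup>2 = s" using that by (simp add: s_def)
    have "cinner (T x) y = (\<Sum>i\<in>F. cnj (z y i) * z y i)"
      by (simp add: x_def blinfun.sum_right TC cinner_sum_left cinner_scaleC_left z_def)
    also have "\<dots> = complex_of_real s"
      unfolding s_def of_real_sum complex_norm_square by (simp add: mult.commute)
    finally have "s = inner (T x) y" by (simp add: inner_ell2_def)
    also have "\<dots> \<le> norm (T x) * norm y" by (rule norm_cauchy_schwarz)
    also have "\<dots> \<le> norm T * norm x * norm y"
      by (intro mult_right_mono norm_blinfun) auto
    finally have "norm x * norm x \<le> norm x * (norm T * norm y)"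
      using nx by (simp add: power2_eq_square mult_ac)
    then have "norm x \<le> norm T * norm y"
      by (cases "norm x = 0") (auto simp: mult_le_cancel_left)
    then show ?thesis
      using nx by (metis s_def norm_ge_zero power_mono)
  qed
  have zsum: "(\<lambda>i. (cmod (z y i))\<^sup>2) summable_on UNIV" for y
    by (rule nonneg_bdd_above_summable_on)
       (auto intro!: bdd_aboveI[where M = "(norm T * norm y)\<^sup>2"] zbound)
  define S where "S y = Abs_ell2 (z y)" for y
  have cS: "coord (S y) i = z y i" for y i
    using zsum by (simp add: S_def Abs_ell2_inverse)
  have inner_S: "inner x (S y) = inner (T x) y" for x y
  proof -
    have "((\<lambda>i. inner (coord x i *\<^sub>C ket i) (S y)) has_sum inner x (S y)) UNIV"
      by (rule has_sum_bounded_linear[OF bounded_linear_inner_left ell2_expansion])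
    moreover have "((\<lambda>i. inner (T (coord x i *\<^sub>C ket i)) y) has_sum inner (T x) y) UNIV"
      by (rule has_sum_bounded_linear[OF _ ell2_expansion])
         (intro bounded_linear_inner_left_comp blinfun.bounded_linear_right)
    moreover have "inner (coord x i *\<^sub>C ket i) (S y) = inner (T (coord x i *\<^sub>C ket i)) y" for i
      by (simp add: inner_ell2_def TC cinner_scaleC_left cinner_ket cS z_def)
    ultimately show ?thesis by (simp add: has_sum_unique)
  qed
  have cinner_S: "cinner x (S y) = cinner (T x) y" for x y
    by (simp add: cinner_conv_inner inner_S TC)
  have "bounded_linear S"
  proof (rule bounded_linear_intro[where K = "norm T"])
    fix x y :: "'a ell2" and r :: real
    show "S (x + y) = S x + S y"
      by (rule cinner_eqI) (simp add: cinner_add_right cinner_S)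
    show "S (r *\<^sub>R x) = r *\<^sub>R S x"
      by (rule cinner_eqI) (simp add: scaleC_of_real[symmetric] cinner_scaleC_right cinner_S)
    have "norm (S x) * norm (S x) = inner (T (S x)) x"
      by (metis inner_S power2_norm_eq_inner power2_eq_square)
    also have "\<dots> \<le> norm (T (S x)) * norm x" by (rule norm_cauchy_schwarz)
    also have "\<dots> \<le> norm T * norm (S x) * norm x"
      by (intro mult_right_mono norm_blinfun) auto
    finally have "norm (S x) * norm (S x) \<le> norm (S x) * (norm x * norm T)"
      by (simp add: mult_ac)
    then show "norm (S x) \<le> norm x * norm T"
      by (cases "norm (S x) = 0") (auto simp: mult_le_cancel_left)
  qed
  then have "cinner (Blinfun S x) y = cinner x (T y)" for x y
    by (metis bounded_linear_Blinfun_apply cinner_S cinner_commute)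
  then show ?thesis by blast
qed

lemma adj_works:
  assumes "T \<in> bounded_ops"
  shows "cinner (adj T x) y = cinner x (T y)"
proof -
  have "\<exists>!S. \<forall>x y. cinner (blinfun_apply S x) y = cinner x (blinfun_apply T y)"
  proof (rule ex_ex1I[OF adjoint_exists[OF assms]])
    fix S S' :: "'a op"
    assume "\<forall>x y. cinner (S x) y = cinner x (T y)" "\<forall>x y. cinner (S' x) y = cinner x (T y)"
    then have "S x = S' x" for x
      by (intro cinner_eqI) (metis cinner_commute)
    then show "S = S'" by (intro blinfun_eqI)
  qed
  from theI'[OF this] show ?thesis unfolding adj_def by blast
qed

lemma adj_eqI:
  assumes "\<And>x y. cinner (blinfun_apply S x) y = cinner x (blinfun_apply T y)"
  shows "adj T = S"
  unfolding adj_def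
proof (rule the_equality)
  fix S' :: "'a op"
  assume "\<forall>x y. cinner (S' x) y = cinner x (T y)"
  then have "S' x = S x" for x
    using assms by (intro cinner_eqI) (metis cinner_commute)
  then show "S' = S" by (intro blinfun_eqI)
qed (use assms in blast)

lemma adj_in_bounded_ops:
  assumes "T \<in> bounded_ops"
  shows "adj T \<in> bounded_ops"
proof -
  have "adj T (c *\<^sub>C x) = c *\<^sub>C adj T x" for c x
  proof (rule cinner_eqI)
    fix y
    have "cinner y (adj T (c *\<^sub>C x)) = cnj (cinner (c *\<^sub>C x) (T y))"
      using adj_works[OF assms] by (metis cinner_commute)
    also have "\<dots> = c * cnj (cinner (adj T x) y)"
      by (simp add: cinner_scaleC_left adj_works[OF assms])
    also have "\<dots> = cinner y (c *\<^sub>C adj T x)"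
      by (simp add: cinner_scaleC_right cinner_commute[of y])
    finally show "cinner y (adj T (c *\<^sub>C x)) = cinner y (c *\<^sub>C adj T x)" .
  qed
  then show ?thesis by (simp add: bounded_ops_def)
qed

definition csubspace :: "'a::complex_normed_vector set \<Rightarrow> bool" where
  "csubspace V \<longleftrightarrow> 0 \<in> V \<and> (\<forall>x\<in>V. \<forall>y\<in>V. x + y \<in> V) \<and> (\<forall>c. \<forall>x\<in>V. c *\<^sub>C x \<in> V)"

definition cspan :: "'a::complex_normed_vector set \<Rightarrow> 'a set" where
  "cspan S = csubspace hull S"

text \<open>C*-algebras are represented concretely, as norm-closed *-subalgebras of \<open>B(H)\<close>;
  they need not contain the identity of \<open>B(H)\<close>.\<close>

definition cstar_subalgebra :: "'a op set \<Rightarrow> bool" where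
  "cstar_subalgebra M \<longleftrightarrow>
     M \<subseteq> bounded_ops \<and> csubspace M \<and> closed M \<and>
     (\<forall>S\<in>M. \<forall>T\<in>M. S o\<^sub>L T \<in> M) \<and> (\<forall>T\<in>M. adj T \<in> M)"

definition cstar_gen :: "'a op set \<Rightarrow> 'a op set" where
  "cstar_gen S = cstar_subalgebra hull S"

lemma cstar_subalgebra_bounded_ops: "cstar_subalgebra (bounded_ops :: 'a op set)"
proof -
  have "continuous_on UNIV (\<lambda>T :: 'a op. blinfun_apply T (c *\<^sub>C x) - c *\<^sub>C blinfun_apply T x)" for c x
  proof -
    have "bounded_linear (\<lambda>v :: 'a ell2. c *\<^sub>C v)"
      by (rule bounded_linear_intro[where K = "cmod c"])
         (auto simp: scaleC_add_right scaleR_scaleC_commute norm_scaleC)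
    then show ?thesis
      by (intro continuous_intros bounded_linear.continuous_on[of "\<lambda>v. c *\<^sub>C v"])
  qed
  then have "closed {T :: 'a op. blinfun_apply T (c *\<^sub>C x) - c *\<^sub>C blinfun_apply T x = 0}" for c x
    by (intro closed_Collect_eq continuous_on_const)
  then have "closed (\<Inter>c. \<Inter>x. {T :: 'a op. blinfun_apply T (c *\<^sub>C x) - c *\<^sub>C blinfun_apply T x = 0})"
    by (intro closed_INT ballI)
  moreover have "bounded_ops =
      (\<Inter>c. \<Inter>x. {T :: 'a op. blinfun_apply T (c *\<^sub>C x) - c *\<^sub>C blinfun_apply T x = 0})"
    by (auto simp: bounded_ops_def)
  ultimately have "closed (bounded_ops :: 'a op set)" by simp
  moreover have "csubspace (bounded_ops :: 'a op set)"
    by (auto simp: csubspace_def bounded_ops_def blinfun.add_left scaleC_blinfun.rep_eq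
        scaleC_add_right scaleC_scaleC scaleC_zero_right mult.commute)
  moreover have "S o\<^sub>L T \<in> bounded_ops" if "S \<in> bounded_ops" "T \<in> bounded_ops" for S T :: "'a op"
    using that by (simp add: bounded_ops_def)
  ultimately show ?thesis
    unfolding cstar_subalgebra_def by (auto intro: adj_in_bounded_ops)
qed

lemma cstar_subalgebra_cstar_gen:
  assumes "S \<subseteq> bounded_ops"
  shows "cstar_subalgebra (cstar_gen S)"
proof -
  have Inter: "cstar_subalgebra (\<Inter>\<M>)"
    if ne: "\<M> \<noteq> {}" and M: "\<And>M. M \<in> \<M> \<Longrightarrow> cstar_subalgebra M" for \<M> :: "'a op set set"
  proof -
    have "closed (\<Inter>\<M>)" using M by (intro closed_Inter) (auto simp: cstar_subalgebra_def)
    moreover have "\<Inter>\<M> \<subseteq> bounded_ops" using ne M unfolding cstar_subalgebra_def by blast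
    moreover have "csubspace (\<Inter>\<M>)" using M by (simp add: cstar_subalgebra_def csubspace_def)
    ultimately show ?thesis using M by (simp add: cstar_subalgebra_def)
  qed
  show ?thesis
    unfolding cstar_gen_def hull_def
    by (rule Inter) (use assms cstar_subalgebra_bounded_ops in auto)
qed

definition star_hom :: "'a op set \<Rightarrow> 'b op set \<Rightarrow> ('a op \<Rightarrow> 'b op) \<Rightarrow> bool" where
  "star_hom M N f \<longleftrightarrow>
     f ` M \<subseteq> N \<and>
     (\<forall>S\<in>M. \<forall>T\<in>M. f (S + T) = f S + f T) \<and>
     (\<forall>c. \<forall>T\<in>M. f (c *\<^sub>C T) = c *\<^sub>C f T) \<and>
     (\<forall>S\<in>M. \<forall>T\<in>M. f (S o\<^sub>L T) = f S o\<^sub>L f T) \<and>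
     (\<forall>T\<in>M. f (adj T) = adj (f T))"

definition star_isomorphic :: "'a op set \<Rightarrow> 'b op set \<Rightarrow> bool" where
  "star_isomorphic M N \<longleftrightarrow> (\<exists>f. star_hom M N f \<and> bij_betw f M N)"

subsection \<open>Universal C*-algebras\<close>

text \<open>A representation of a set \<open>gens\<close> of generators subject to relations \<open>R\<close> is a family of
  operators on \<open>\<ell>\<^sup>2('h)\<close> indexed by \<open>gens\<close> and satisfying \<open>R\<close>, where \<open>'h\<close> is an infinite type.
  The universal C*-algebra is the C*-algebra generated by the direct sum of all of them, acting
  on \<open>\<Oplus>\<^sub>\<rho> \<ell>\<^sup>2('h)\<close>.  Since degenerate representations are allowed, smaller Hilbert spaces are
  covered by adding a zero summand, and if \<open>gens\<close> is norm-separable (as is the case below), larger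
  ones give nothing new.  The direct sum consists of bounded operators whenever the relations
  bound the norm of each generator, as those below do.\<close>

definition direct_sum :: "'i set \<Rightarrow> ('i \<Rightarrow> 'h op) \<Rightarrow> ('i \<times> 'h) op" where
  "direct_sum I T = Blinfun (\<lambda>x. Abs_ell2 (\<lambda>(i, h).
     if i \<in> I then coord (T i (Abs_ell2 (\<lambda>h'. coord x (i, h')))) h else 0))"

lemma direct_sum:
  fixes T :: "'i \<Rightarrow> 'h op"
  assumes M: "\<And>i. i \<in> I \<Longrightarrow> norm (T i) \<le> M"
  shows "coord (direct_sum I T x) (i, h) =
    (if i \<in> I then coord (T i (Abs_ell2 (\<lambda>h'. coord x (i, h')))) h else 0)"
proof -
  define s where "s x i = Abs_ell2 (\<lambda>h'. coord x (i, h'))" for x :: "('i \<times> 'h) ell2" and i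
  define f where "f x = (\<lambda>(i, h). if i \<in> I then coord (T i (s x i)) h else 0)" for x
  have sq: "(\<lambda>p. (cmod (coord x p))\<^sup>2) summable_on UNIV \<times> UNIV" for x :: "('i \<times> 'h) ell2"
    using coord[of x] by simp
  have sq_row: "(\<lambda>h. (cmod (coord x (i, h)))\<^sup>2) summable_on UNIV" for x :: "('i \<times> 'h) ell2" and i
    by (rule summable_on_SigmaD1[where A = UNIV]) (use sq[of x] in \<open>simp_all add: case_prod_unfold\<close>)
  then have cs: "coord (s x i) h = coord x (i, h)" for x i h
    by (simp add: s_def Abs_ell2_inverse)
  have s_add: "s (x + y) i = s x i + s y i" for x y i
    by (rule coord_inject[THEN iffD1]) (auto simp: cs plus_ell2.rep_eq)
  have s_scale: "s (r *\<^sub>R x) i = r *\<^sub>R s x i" for r x i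
    by (rule coord_inject[THEN iffD1]) (auto simp: cs scaleR_ell2.rep_eq)
  have ns: "(norm (s x i))\<^sup>2 = (\<Sum>\<^sub>\<infinity>h. (cmod (coord x (i, h)))\<^sup>2)" for x i
    by (simp add: norm_ell2_sq cs)
  have ns_sum: "((\<lambda>i. (norm (s x i))\<^sup>2) has_sum (norm x)\<^sup>2) UNIV" for x
  proof -
    have "((\<lambda>p. (cmod (coord x p))\<^sup>2) has_sum (norm x)\<^sup>2) (UNIV \<times> UNIV)"
      using has_sum_infsum[OF sq[of x]] by (simp add: norm_ell2_sq)
    then show ?thesis
      unfolding ns by (rule has_sum_SigmaD) (rule has_sum_infsum[OF sq_row])
  qed
  have le: "(norm (T i (s x i)))\<^sup>2 \<le> M\<^sup>2 * (norm (s x i))\<^sup>2" if "i \<in> I" for x i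
  proof -
    have "norm (T i (s x i)) \<le> M * norm (s x i)"
      using norm_blinfun[of "T i" "s x i"] mult_right_mono[OF M[OF that], of "norm (s x i)"] by simp
    then show ?thesis by (metis norm_ge_zero power_mono power_mult_distrib)
  qed
  have row: "((\<lambda>h. (cmod (f x (i, h)))\<^sup>2) has_sum (if i \<in> I then (norm (T i (s x i)))\<^sup>2 else 0)) UNIV"
    for x i
    using coord[of "T i (s x i)"] by (auto simp: f_def norm_ell2_sq intro!: has_sum_infsum)
  have rows: "(\<lambda>i. if i \<in> I then (norm (T i (s x i)))\<^sup>2 else 0) summable_on UNIV" for x
  proof (rule summable_on_comparison_test)
    show "(\<lambda>i. M\<^sup>2 * (norm (s x i))\<^sup>2) summable_on UNIV"
      using ns_sum[of x] by (intro summable_on_cmult_right) (auto simp: summable_on_def)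
  qed (auto simp: le)
  have "(\<lambda>p. (cmod (f x p))\<^sup>2) summable_on UNIV \<times> UNIV" for x
    by (rule summable_on_SigmaI[OF row rows]) simp
  then have cf: "coord (Abs_ell2 (f x)) = f x" for x
    by (simp add: Abs_ell2_inverse)
  have nf: "norm (Abs_ell2 (f x)) \<le> norm x * \<bar>M\<bar>" for x
  proof -
    have "((\<lambda>p. (cmod (f x p))\<^sup>2) has_sum (norm (Abs_ell2 (f x)))\<^sup>2) (UNIV \<times> UNIV)"
      using coord[of "Abs_ell2 (f x)"] by (simp add: norm_ell2_sq cf has_sum_infsum)
    then have "((\<lambda>i. if i \<in> I then (norm (T i (s x i)))\<^sup>2 else 0) has_sum
        (norm (Abs_ell2 (f x)))\<^sup>2) UNIV"
      by (rule has_sum_SigmaD[OF _ row])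
    moreover have "((\<lambda>i. M\<^sup>2 * (norm (s x i))\<^sup>2) has_sum M\<^sup>2 * (norm x)\<^sup>2) UNIV"
      by (intro has_sum_cmult_right ns_sum)
    ultimately have "(norm (Abs_ell2 (f x)))\<^sup>2 \<le> M\<^sup>2 * (norm x)\<^sup>2"
      by (rule has_sum_mono) (auto simp: le)
    also have "\<dots> = (norm x * \<bar>M\<bar>)\<^sup>2" by (simp add: power_mult_distrib)
    finally show ?thesis by (rule power2_le_imp_le) auto
  qed
  have "bounded_linear (\<lambda>x. Abs_ell2 (f x))"
  proof (rule bounded_linear_intro[OF _ _ nf])
    fix x y and r :: real
    show "Abs_ell2 (f (x + y)) = Abs_ell2 (f x) + Abs_ell2 (f y)"
      by (rule coord_inject[THEN iffD1])
         (unfold cf plus_ell2.rep_eq, auto simp: f_def s_add blinfun.add_right plus_ell2.rep_eq)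
    show "Abs_ell2 (f (r *\<^sub>R x)) = r *\<^sub>R Abs_ell2 (f x)"
      by (rule coord_inject[THEN iffD1])
         (unfold cf scaleR_ell2.rep_eq,
          auto simp: f_def s_scale blinfun.scaleR_right scaleR_ell2.rep_eq)
  qed
  then have "direct_sum I T x = Abs_ell2 (f x)"
    unfolding direct_sum_def f_def s_def by (subst bounded_linear_Blinfun_apply) auto
  then have "coord (direct_sum I T x) (i, h) = f x (i, h)" by (simp only: cf)
  then show ?thesis by (simp add: f_def s_def)
qed

definition representations ::
    "'g set \<Rightarrow> (('g \<Rightarrow> 'h op) \<Rightarrow> bool) \<Rightarrow> ('g \<Rightarrow> 'h op) set" where
  "representations gens R = {\<rho> \<in> gens \<rightarrow>\<^sub>E bounded_ops. R \<rho>}"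

definition universal_gen ::
    "'g set \<Rightarrow> (('g \<Rightarrow> 'h op) \<Rightarrow> bool) \<Rightarrow> 'g \<Rightarrow> (('g \<Rightarrow> 'h::infinite op) \<times> 'h) op" where
  "universal_gen gens R g = direct_sum (representations gens R) (\<lambda>\<rho>. \<rho> g)"

definition universal_cstar ::
    "'g set \<Rightarrow> (('g \<Rightarrow> 'h op) \<Rightarrow> bool) \<Rightarrow> (('g \<Rightarrow> 'h::infinite op) \<times> 'h) op set" where
  "universal_cstar gens R = cstar_gen (universal_gen gens R ` gens)"

text \<open>The universal property: every representation of the generators extends.\<close>

lemma universal_cstar_extend:
  fixes R :: "('g \<Rightarrow> 'h::infinite op) \<Rightarrow> bool"
  assumes \<rho>: "\<rho> \<in> representations gens R"
    and bounded: "\<And>g. g \<in> gens \<Longrightarrow> \<exists>M. \<forall>\<sigma>\<in>representations gens R. norm (\<sigma> g) \<le> M"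
  shows "\<exists>f. star_hom (universal_cstar gens R) bounded_ops f \<and>
    (\<forall>g\<in>gens. f (universal_gen gens R g) = \<rho> g)"
proof -
  define vf where "vf x = (\<lambda>(\<sigma>, h). if \<sigma> = \<rho> then coord x h else 0)"
    for x :: "'h ell2"
  define wf where "wf y = (\<lambda>h. coord y (\<rho>, h))" for y :: "(('g \<Rightarrow> 'h op) \<times> 'h) ell2"
  define V where "V = Blinfun (\<lambda>x. Abs_ell2 (vf x))"
  define W where "W = Blinfun (\<lambda>y. Abs_ell2 (wf y))"
  have vf: "vf x p = (if p \<in> {\<rho>} \<times> UNIV then coord x (snd p) else 0)" for x p
    by (auto simp: vf_def split: prod.split)
  have wf: "wf y h = (if h \<in> UNIV then coord y (\<rho>, h) else 0)" for y h
    by (simp add: wf_def)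
  have "inj_on snd ({\<rho>} \<times> (UNIV :: 'h set))" by (auto simp: inj_on_def)
  from ell2_relabel[OF this vf]
  have cV: "coord (V x) (\<sigma>, h) = (if \<sigma> = \<rho> then coord x h else 0)" for x \<sigma> h
    by (simp add: V_def bounded_linear_Blinfun_apply vf_def)
  have "inj (Pair \<rho> :: 'h \<Rightarrow> _)" by (simp add: inj_on_def)
  from ell2_relabel[OF this wf]
  have cW: "coord (W y) h = coord y (\<rho>, h)" for y h
    by (simp add: W_def bounded_linear_Blinfun_apply wf_def)
  have WV: "W (V x) = x" for x
    by (intro coord_inject[THEN iffD1] ext) (simp add: cV cW)
  have VC: "V (c *\<^sub>C x) = c *\<^sub>C V x" for c x
    by (intro coord_inject[THEN iffD1] ext) (auto simp: cV scaleC_ell2.rep_eq)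
  have WC: "W (c *\<^sub>C y) = c *\<^sub>C W y" for c y
    by (intro coord_inject[THEN iffD1] ext) (auto simp: cW scaleC_ell2.rep_eq)
  have cinner_V: "cinner (V x) y = cinner x (W y)" for x y
  proof -
    have "cinner (V x) y = (\<Sum>\<^sub>\<infinity>p\<in>Pair \<rho> ` UNIV. cnj (coord (V x) p) * coord y p)"
      unfolding cinner_def by (rule infsum_cong_neutral) (auto simp: cV)
    also have "\<dots> = cinner x (W y)"
      by (subst infsum_reindex) (auto simp: cinner_def o_def cV cW inj_on_def)
    finally show ?thesis .
  qed
  have cinner_W: "cinner (W x) y = cinner x (V y)" for x y
    by (metis cinner_V cinner_commute)
  define M where "M = {T \<in> bounded_ops. (V o\<^sub>L W) o\<^sub>L T = T o\<^sub>L (V o\<^sub>L W)}"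
  have comm: "V (W (T x)) = T (V (W x))" if "T \<in> M" for T x
  proof -
    have "blinfun_apply ((V o\<^sub>L W) o\<^sub>L T) x = blinfun_apply (T o\<^sub>L (V o\<^sub>L W)) x"
      using that by (simp add: M_def)
    then show ?thesis by simp
  qed
  have MI: "T \<in> M" if "T \<in> bounded_ops" "\<And>x. V (W (T x)) = T (V (W x))" for T
    using that by (auto simp: M_def intro: blinfun_eqI)
  have Mb: "T \<in> bounded_ops" if "T \<in> M" for T using that by (simp add: M_def)
  have B: "cstar_subalgebra (bounded_ops :: (('g \<Rightarrow> 'h op) \<times> 'h) op set)"
    by (rule cstar_subalgebra_bounded_ops)
  have "closed M"
  proof -
    have "M = bounded_ops \<inter> {T. (V o\<^sub>L W) o\<^sub>L T = T o\<^sub>L (V o\<^sub>L W)}" by (auto simp: M_def)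
    moreover have "closed {T. (V o\<^sub>L W) o\<^sub>L T = T o\<^sub>L (V o\<^sub>L W)}"
      by (intro closed_Collect_eq continuous_intros)
    ultimately show ?thesis using B by (auto simp: cstar_subalgebra_def)
  qed
  moreover have "csubspace M"
    using B unfolding csubspace_def cstar_subalgebra_def
    by (auto intro!: MI simp: Mb comm blinfun.add_left blinfun.add_right scaleC_blinfun.rep_eq VC WC)
  moreover have "S o\<^sub>L T \<in> M" if "S \<in> M" "T \<in> M" for S T
    using that B Mb by (intro MI) (auto simp: comm cstar_subalgebra_def)
  moreover have "adj T \<in> M" if T: "T \<in> M" for T
  proof (rule MI)
    show "adj T \<in> bounded_ops" using Mb[OF T] by (rule adj_in_bounded_ops)
    fix x
    have "cinner (V (W (adj T x))) y = cinner (adj T (V (W x))) y" for y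
      by (simp add: cinner_V cinner_W adj_works[OF Mb[OF T]] comm[OF T])
    then show "V (W (adj T x)) = adj T (V (W x))"
      by (intro cinner_eqI) (metis cinner_commute)
  qed
  ultimately have M: "cstar_subalgebra M"
    using Mb by (auto simp: cstar_subalgebra_def)
  have gen: "universal_gen gens R g \<in> M" and W_gen: "W (universal_gen gens R g x) = \<rho> g (W x)"
    if g: "g \<in> gens" for g x
  proof -
    let ?I = "representations gens R" and ?T = "universal_gen gens R g"
    let ?s = "\<lambda>x \<sigma>. Abs_ell2 (\<lambda>h'. coord x (\<sigma>, h'))"
    obtain K where K: "\<And>\<sigma>. \<sigma> \<in> ?I \<Longrightarrow> norm (\<sigma> g) \<le> K" using bounded[OF g] by blast
    have T: "coord (?T x) (\<sigma>, h) = (if \<sigma> \<in> ?I then coord (\<sigma> g (?s x \<sigma>)) h else 0)" for x \<sigma> h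
      unfolding universal_gen_def by (rule direct_sum[OF K])
    have s: "coord (?s x \<sigma>) h = coord x (\<sigma>, h)" for x :: "(('g \<Rightarrow> 'h op) \<times> 'h) ell2" and \<sigma> h
    proof -
      have "inj (Pair \<sigma> :: 'h \<Rightarrow> _)" by (simp add: inj_on_def)
      from ell2_relabel(2)[OF this, of "\<lambda>x h. coord x (\<sigma>, h)"] show ?thesis by simp
    qed
    have sC: "?s (c *\<^sub>C x) \<sigma> = c *\<^sub>C ?s x \<sigma>"
      for c \<sigma> and x :: "(('g \<Rightarrow> 'h op) \<times> 'h) ell2"
    proof (intro coord_inject[THEN iffD1] ext)
      show "coord (?s (c *\<^sub>C x) \<sigma>) h = coord (c *\<^sub>C ?s x \<sigma>) h" for h
        using s[of "c *\<^sub>C x" \<sigma> h] s[of x \<sigma> h] by (simp add: scaleC_ell2.rep_eq)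
    qed
    have sW: "?s x \<rho> = W x" for x
      by (intro coord_inject[THEN iffD1] ext) (simp add: s cW)
    have sV: "?s (V x) \<sigma> = (if \<sigma> = \<rho> then x else 0)" for x \<sigma>
      by (intro coord_inject[THEN iffD1] ext) (subst s, simp add: cV zero_ell2.rep_eq)
    show WT: "W (?T x) = \<rho> g (W x)" for x
      by (intro coord_inject[THEN iffD1] ext) (simp add: cW T \<rho> sW)
    have TV: "?T (V x) = V (\<rho> g x)" for x
    proof (intro coord_inject[THEN iffD1] ext)
      show "coord (?T (V x)) p = coord (V (\<rho> g x)) p" for p
        by (cases p, simp only: T, simp only: sV) (simp add: cV \<rho> zero_ell2.rep_eq)
    qed
    have "\<sigma> g \<in> bounded_ops" if "\<sigma> \<in> ?I" for \<sigma>
      using that g by (auto simp: representations_def)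
    then have \<sigma>C: "\<sigma> g (c *\<^sub>C x) = c *\<^sub>C \<sigma> g x" if "\<sigma> \<in> ?I" for \<sigma> c x
      using that by (simp add: bounded_ops_def)
    have "?T (c *\<^sub>C x) = c *\<^sub>C ?T x" for c x
    proof (intro coord_inject[THEN iffD1] ext)
      show "coord (?T (c *\<^sub>C x)) p = coord (c *\<^sub>C ?T x) p" for p
        by (cases p, simp only: T scaleC_ell2.rep_eq[of c "?T x"], simp only: sC)
           (simp add: \<sigma>C scaleC_ell2.rep_eq)
    qed
    then show "?T \<in> M"
      by (intro MI) (simp_all add: bounded_ops_def WT TV)
  qed
  have sub: "universal_cstar gens R \<subseteq> M"
    unfolding universal_cstar_def cstar_gen_def using gen M by (intro hull_minimal) auto
  define f where "f T = W o\<^sub>L T o\<^sub>L V" for T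
  have "star_hom M bounded_ops f"
    unfolding star_hom_def
  proof (intro conjI ballI allI)
    show "f ` M \<subseteq> bounded_ops"
      using Mb by (auto simp: f_def bounded_ops_def VC WC)
    fix S T c assume S: "S \<in> M" and T: "T \<in> M"
    show "f (S + T) = f S + f T"
      by (rule blinfun_eqI) (simp add: f_def blinfun.add_left blinfun.add_right)
    show "f (S o\<^sub>L T) = f S o\<^sub>L f T"
      by (rule blinfun_eqI) (simp add: f_def comm[OF T] WV)
  next
    fix T c assume T: "T \<in> M"
    show "f (c *\<^sub>C T) = c *\<^sub>C f T"
      by (rule blinfun_eqI) (simp add: f_def scaleC_blinfun.rep_eq WC)
    show "f (adj T) = adj (f T)"
      by (rule adj_eqI[symmetric]) (simp add: f_def cinner_V cinner_W adj_works[OF Mb[OF T]])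
  qed
  then have "star_hom (universal_cstar gens R) bounded_ops f"
    using sub unfolding star_hom_def by blast
  moreover have "f (universal_gen gens R g) = \<rho> g" if "g \<in> gens" for g
    by (rule blinfun_eqI) (simp add: f_def W_gen[OF that] WV)
  ultimately show ?thesis by blast
qed

section \<open>Cuntz-Pimsner algebras\<close>

text \<open>A C*-correspondence over a concrete C*-algebra \<open>A\<close> is given by a closed subspace \<open>E\<close> of the
  ambient \<open>B(H)\<close> with \<open>A E \<subseteq> E\<close>, \<open>E A \<subseteq> E\<close> and \<open>E\<^sup>* E \<subseteq> A\<close>: the actions of \<open>A\<close> are given
  by composition and the inner product is \<open>\<langle>\<xi>, \<eta>\<rangle> = \<xi>\<^sup>* \<eta>\<close>, so that the norm of
  \<open>E\<close> is the operator norm.  Operators on the module \<open>E\<close> are functions on \<open>E\<close>, taken extensional.\<close>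

definition module_inner :: "'k op \<Rightarrow> 'k op \<Rightarrow> 'k op" where
  "module_inner \<xi> \<eta> = adj \<xi> o\<^sub>L \<eta>"

definition left_action :: "'k op set \<Rightarrow> 'k op \<Rightarrow> 'k op \<Rightarrow> 'k op" where
  "left_action E a = (\<lambda>\<xi>\<in>E. a o\<^sub>L \<xi>)"

definition rank_one :: "'k op set \<Rightarrow> 'k op \<Rightarrow> 'k op \<Rightarrow> 'k op \<Rightarrow> 'k op" where
  "rank_one E \<xi> \<eta> = (\<lambda>\<zeta>\<in>E. \<xi> o\<^sub>L module_inner \<eta> \<zeta>)"

text \<open>The closed linear span of the \<open>\<Theta>\<^sub>\<xi>\<^sub>,\<^sub>\<eta>\<close> for the operator norm on \<open>E\<close>; scalar
  coefficients are absorbed into \<open>\<xi>\<close>.\<close>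

definition module_compacts :: "'k op set \<Rightarrow> ('k op \<Rightarrow> 'k op) set" where
  "module_compacts E = {k \<in> E \<rightarrow>\<^sub>E E. \<forall>\<epsilon>>0. \<exists>(n::nat) X Y.
     (\<forall>j<n. X j \<in> E \<and> Y j \<in> E) \<and>
     (\<forall>\<zeta>\<in>E. norm (k \<zeta> - (\<Sum>j<n. rank_one E (X j) (Y j) \<zeta>)) \<le> \<epsilon> * norm \<zeta>)}"

definition module_adjoints ::
    "'k op set \<Rightarrow> ('k op \<Rightarrow> 'k op) \<Rightarrow> ('k op \<Rightarrow> 'k op) \<Rightarrow> bool" where
  "module_adjoints E k l \<longleftrightarrow>
     (\<forall>\<xi>\<in>E. \<forall>\<eta>\<in>E. module_inner (k \<xi>) \<eta> = module_inner \<xi> (l \<eta>))"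

definition action_kernel :: "'k op set \<Rightarrow> 'k op set \<Rightarrow> 'k op set" where
  "action_kernel A E = {a \<in> A. \<forall>\<xi>\<in>E. a o\<^sub>L \<xi> = 0}"

definition katsura_ideal :: "'k op set \<Rightarrow> 'k op set \<Rightarrow> 'k op set" where
  "katsura_ideal A E = {a \<in> A. (\<forall>b\<in>action_kernel A E. a o\<^sub>L b = 0) \<and>
     left_action E a \<in> module_compacts E}"

definition correspondence_rep ::
    "'k op set \<Rightarrow> 'k op set \<Rightarrow> ('k op \<Rightarrow> 'h op) \<Rightarrow> ('k op \<Rightarrow> 'h op) \<Rightarrow> bool" where
  "correspondence_rep A E \<pi> t \<longleftrightarrow>
     star_hom A bounded_ops \<pi> \<and> t ` E \<subseteq> bounded_ops \<and>
     (\<forall>\<xi>\<in>E. \<forall>\<eta>\<in>E. t (\<xi> + \<eta>) = t \<xi> + t \<eta>) \<and>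
     (\<forall>c. \<forall>\<xi>\<in>E. t (c *\<^sub>C \<xi>) = c *\<^sub>C t \<xi>) \<and>
     (\<forall>\<xi>\<in>E. \<forall>\<eta>\<in>E. adj (t \<xi>) o\<^sub>L t \<eta> = \<pi> (module_inner \<xi> \<eta>)) \<and>
     (\<forall>a\<in>A. \<forall>\<xi>\<in>E. \<pi> a o\<^sub>L t \<xi> = t (left_action E a \<xi>))"

text \<open>\<open>\<psi>\<close> is the *-homomorphism \<open>\<psi>\<^sub>t\<close> on the compacts. It is unique because
  *-homomorphisms of C*-algebras are continuous.\<close>

definition compacts_rep ::
    "'k op set \<Rightarrow> ('k op \<Rightarrow> 'h op) \<Rightarrow> (('k op \<Rightarrow> 'k op) \<Rightarrow> 'h op) \<Rightarrow> bool" where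
  "compacts_rep E t \<psi> \<longleftrightarrow>
     (let K = module_compacts E in
       \<psi> ` K \<subseteq> bounded_ops \<and>
       (\<forall>k\<in>K. \<forall>l\<in>K. \<psi> (\<lambda>\<xi>\<in>E. k \<xi> + l \<xi>) = \<psi> k + \<psi> l) \<and>
       (\<forall>c. \<forall>k\<in>K. \<psi> (\<lambda>\<xi>\<in>E. c *\<^sub>C k \<xi>) = c *\<^sub>C \<psi> k) \<and>
       (\<forall>k\<in>K. \<forall>l\<in>K. \<psi> (\<lambda>\<xi>\<in>E. k (l \<xi>)) = \<psi> k o\<^sub>L \<psi> l) \<and>
       (\<forall>k\<in>K. \<forall>l\<in>K. module_adjoints E k l \<longrightarrow> \<psi> l = adj (\<psi> k)) \<and>
       (\<forall>\<xi>\<in>E. \<forall>\<eta>\<in>E. \<psi> (rank_one E \<xi> \<eta>) = t \<xi> o\<^sub>L adj (t \<eta>)))"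

definition covariant_rep ::
    "'k op set \<Rightarrow> 'k op set \<Rightarrow> ('k op \<Rightarrow> 'h op) \<Rightarrow> ('k op \<Rightarrow> 'h op) \<Rightarrow> bool" where
  "covariant_rep A E \<pi> t \<longleftrightarrow> correspondence_rep A E \<pi> t \<and>
     (\<exists>\<psi>. compacts_rep E t \<psi> \<and> (\<forall>a\<in>katsura_ideal A E. \<pi> a = \<psi> (left_action E a)))"

definition cuntz_pimsner ::
    "'k op set \<Rightarrow> 'k op set \<Rightarrow> (('k op + 'k op \<Rightarrow> 'h::infinite op) \<times> 'h) op set" where
  "cuntz_pimsner A E = universal_cstar (A <+> E) (\<lambda>\<rho>. covariant_rep A E (\<rho> \<circ> Inl) (\<rho> \<circ> Inr))"

section \<open>Graph C*-algebras\<close>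

definition cuntz_krieger_family ::
    "('v, 'e) pre_digraph \<Rightarrow> ('v \<Rightarrow> 'h op) \<Rightarrow> ('e \<Rightarrow> 'h op) \<Rightarrow> bool" where
  "cuntz_krieger_family G P S \<longleftrightarrow>
     (\<forall>v\<in>verts G. P v \<in> bounded_ops \<and> P v o\<^sub>L P v = P v \<and> adj (P v) = P v) \<and>
     (\<forall>v\<in>verts G. \<forall>w\<in>verts G. v \<noteq> w \<longrightarrow> P v o\<^sub>L P w = 0) \<and>
     (\<forall>e\<in>arcs G. S e \<in> bounded_ops \<and> adj (S e) o\<^sub>L S e = P (tail G e)) \<and>
     (\<forall>v\<in>verts G. in_arcs G v \<noteq> {} \<longrightarrow> P v = (\<Sum>e\<in>in_arcs G v. S e o\<^sub>L adj (S e)))"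

text \<open>Meant for finite graphs.  The source and range of an edge are its \<open>tail\<close> and \<open>head\<close>.\<close>

definition graph_cstar ::
    "('v, 'e) pre_digraph \<Rightarrow> (('v + 'e \<Rightarrow> 'h::infinite op) \<times> 'h) op set" where
  "graph_cstar G = universal_cstar (verts G <+> arcs G)
     (\<lambda>\<rho>. cuntz_krieger_family G (\<rho> \<circ> Inl) (\<rho> \<circ> Inr))"

section \<open>Subshifts\<close>

definition shift :: "(int \<Rightarrow> nat) \<Rightarrow> (int \<Rightarrow> nat)" where
  "shift x = (\<lambda>n. x (n + 1))"

text \<open>\<open>closed\<close> refers to the product topology, \<open>nat\<close> being discrete.\<close>

definition subshift :: "nat \<Rightarrow> (int \<Rightarrow> nat) set \<Rightarrow> bool" where
  "subshift d \<Lambda> \<longleftrightarrow> \<Lambda> \<subseteq> UNIV \<rightarrow> {1..d} \<and> closed \<Lambda> \<and> shift ` \<Lambda> = \<Lambda>"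

definition occurs :: "nat list \<Rightarrow> (int \<Rightarrow> nat) \<Rightarrow> bool" where
  "occurs w x \<longleftrightarrow> (\<exists>k. \<forall>j<length w. x (k + int j) = w ! j)"

definition finite_type :: "(int \<Rightarrow> nat) set \<Rightarrow> bool" where
  "finite_type \<Gamma> \<longleftrightarrow>
     (\<exists>m W. finite W \<and> \<Gamma> = {x \<in> UNIV \<rightarrow> {1..m}. \<forall>w\<in>W. \<not> occurs w x})"

definition sofic :: "(int \<Rightarrow> nat) set \<Rightarrow> bool" where
  "sofic \<Lambda> \<longleftrightarrow> (\<exists>\<Gamma> f. finite_type \<Gamma> \<and> continuous_on \<Gamma> f \<and> f ` \<Gamma> = \<Lambda> \<and>
     (\<forall>x\<in>\<Gamma>. f (shift x) = shift (f x)))"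

definition language :: "(int \<Rightarrow> nat) set \<Rightarrow> nat list set" where
  "language \<Lambda> = insert [] {w. \<exists>x\<in>\<Lambda>. occurs w x}"

section \<open>The C*-correspondence of a subshift\<close>

text \<open>The Fock space is the closed linear span of the \<open>ket \<mu>\<close>, \<open>\<mu> \<in> language \<Lambda>\<close>, in the space
  of square-summable functions on all words, and an operator on the Fock space is extended by \<open>0\<close>
  on its orthogonal complement.  The identity of the Fock space is thus the projection
  \<open>fock_id\<close>.\<close>

definition fock_id :: "(int \<Rightarrow> nat) set \<Rightarrow> nat list op" where
  "fock_id \<Lambda> = Blinfun (\<lambda>x. Abs_ell2 (\<lambda>w. if w \<in> language \<Lambda> then coord x w else 0))"

definition creation :: "(int \<Rightarrow> nat) set \<Rightarrow> nat \<Rightarrow> nat list op" where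
  "creation \<Lambda> i = Blinfun (\<lambda>x. Abs_ell2 (\<lambda>w.
     case w of [] \<Rightarrow> 0 | j # \<nu> \<Rightarrow> if j = i \<and> i # \<nu> \<in> language \<Lambda> then coord x \<nu> else 0))"

lemma coord_fock_id: "coord (fock_id \<Lambda> x) w = (if w \<in> language \<Lambda> then coord x w else 0)"
proof -
  note * = ell2_relabel[of "\<lambda>w. w" "language \<Lambda>"
      "\<lambda>x w. if w \<in> language \<Lambda> then coord x w else 0"]
  show ?thesis
    unfolding fock_id_def by (subst bounded_linear_Blinfun_apply) (use * in auto)
qed

lemma coord_creation:
  "coord (creation \<Lambda> i x) w =
    (case w of [] \<Rightarrow> 0 | j # \<nu> \<Rightarrow> if j = i \<and> i # \<nu> \<in> language \<Lambda> then coord x \<nu> else 0)"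
proof -
  define f where "f x w = (case w of [] \<Rightarrow> 0
    | j # \<nu> \<Rightarrow> if j = i \<and> i # \<nu> \<in> language \<Lambda> then coord x \<nu> else 0)" for x :: "nat list ell2" and w
  define D where "D = {i # \<nu> | \<nu>. i # \<nu> \<in> language \<Lambda>}"
  have "f x w = (if w \<in> D then coord x (tl w) else 0)" for x w
    by (cases w) (auto simp: f_def D_def)
  moreover have "inj_on tl D" by (auto simp: inj_on_def D_def)
  ultimately have "bounded_linear (\<lambda>x. Abs_ell2 (f x))" "coord (Abs_ell2 (f x)) = f x"
    using ell2_relabel[of tl D f] by blast+
  moreover have "creation \<Lambda> i = Blinfun (\<lambda>x. Abs_ell2 (f x))"
    unfolding creation_def f_def ..
  ultimately have "coord (creation \<Lambda> i x) w = f x w"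
    by (simp add: bounded_linear_Blinfun_apply)
  then show ?thesis by (simp only: f_def)
qed

lemma fock_id_ket: "fock_id \<Lambda> (ket \<nu>) = (if \<nu> \<in> language \<Lambda> then ket \<nu> else 0)"
  by (intro coord_inject[THEN iffD1] ext)
     (simp add: coord_fock_id ket.rep_eq zero_ell2.rep_eq)

lemma creation_ket:
  "creation \<Lambda> i (ket \<nu>) = (if i # \<nu> \<in> language \<Lambda> then ket (i # \<nu>) else 0)"
  by (intro coord_inject[THEN iffD1] ext)
     (simp add: coord_creation ket.rep_eq zero_ell2.rep_eq split: list.split)

definition word_op :: "(int \<Rightarrow> nat) set \<Rightarrow> nat list \<Rightarrow> nat list op" where
  "word_op \<Lambda> \<mu> = foldr (\<lambda>i T. creation \<Lambda> i o\<^sub>L T) \<mu> (fock_id \<Lambda>)"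

definition coefficient_algebra :: "(int \<Rightarrow> nat) set \<Rightarrow> nat list op set" where
  "coefficient_algebra \<Lambda> =
     cstar_gen ((\<lambda>\<mu>. adj (word_op \<Lambda> \<mu>) o\<^sub>L word_op \<Lambda> \<mu>) ` language \<Lambda>)"

definition shift_module :: "nat \<Rightarrow> (int \<Rightarrow> nat) set \<Rightarrow> nat list op set" where
  "shift_module d \<Lambda> =
     closure (cspan {creation \<Lambda> i o\<^sub>L a | i a. i \<in> {1..d} \<and> a \<in> coefficient_algebra \<Lambda>})"

section \<open>The follower set graph\<close>

definition follower_set :: "(int \<Rightarrow> nat) set \<Rightarrow> nat list \<Rightarrow> nat list set" where
  "follower_set \<Lambda> \<mu> = {w \<in> language \<Lambda>. w @ \<mu> \<in> language \<Lambda>}"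

text \<open>An edge is the triple of its source, label and range; as a graph without labels, parallel edges
  remain distinct.\<close>

definition follower_graph ::
    "(int \<Rightarrow> nat) set \<Rightarrow> (nat list set, nat list set \<times> nat \<times> nat list set) pre_digraph" where
  "follower_graph \<Lambda> =
     \<lparr> verts = follower_set \<Lambda> ` language \<Lambda>,
       arcs = {(follower_set \<Lambda> \<mu>, i, follower_set \<Lambda> (i # \<mu>)) | \<mu> i. i # \<mu> \<in> language \<Lambda>},
       tail = \<lambda>(u, i, v). u,
       head = \<lambda>(u, i, v). v \<rparr>"

end

theory Submission
  imports Defs
begin

text \<open>The coefficient algebra \<open>A\<close> of \<open>\<Lambda>\<close> consists of diagonal operators, because \<open>T\<^sub>\<mu>\<^sup>* T\<^sub>\<mu>\<close> is the
  projection onto the words \<open>\<nu>\<close> with \<open>\<mu> \<in> F(\<nu>)\<close>. Whether \<open>\<nu>\<close> belongs to this set only depends on the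
  follower set of \<open>\<nu>\<close>, and a sofic subshift has finitely many follower sets
  (\<open>finite_follower_sets\<close>), so \<open>A\<close> is the algebra of all functions on the set \<open>G\<^sup>0\<close> of follower sets
  (\<open>coefficient_algebra_eq\<close>). Let \<open>Q\<^sub>v\<close> be its minimal projections. The module \<open>E\<close> is spanned by the
  operators \<open>T\<^sub>i Q\<^sub>v\<close>, and \<open>T\<^sub>i Q\<^sub>v\<close> is nonzero exactly if an edge labelled \<open>i\<close> leaves \<open>v\<close>; if \<open>w\<close> is the
  end of that edge, then \<open>Q\<^sub>w T\<^sub>i Q\<^sub>v = T\<^sub>i Q\<^sub>v\<close>. So \<open>E\<close> has a basis \<open>X\<^sub>e\<close> indexed by the edges
  (\<open>shift_module_eq\<close>) with \<open>\<langle>X\<^sub>e, X\<^sub>f\<rangle> = \<delta>\<^sub>e\<^sub>f Q\<^bsub>s(e)\<^esub>\<close> (\<open>graph_correspondence_follower_graph\<close>): it is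
  the correspondence of the graph \<open>G\<close>.

  For such a correspondence the identity of \<open>E\<close> is the finite sum of the \<open>\<Theta>\<^sub>e\<^sub>,\<^sub>e\<close>, where \<open>\<Theta>\<^sub>e\<^sub>,\<^sub>e\<close> is the rank
  one operator of \<open>X\<^sub>e\<close>. Hence \<open>A\<close> acts by compact operators and Katsura's ideal is spanned by the \<open>Q\<^sub>v\<close>
  at the vertices \<open>v\<close> receiving an edge. Since \<open>Q\<^sub>v\<close> acts as the sum of the \<open>\<Theta>\<^sub>e\<^sub>,\<^sub>e\<close> over the edges
  \<open>e\<close> into \<open>v\<close>, a representation \<open>(\<pi>, t)\<close> is covariant if and only if \<open>\<pi>(Q\<^sub>v)\<close> and \<open>t(X\<^sub>e)\<close> form a
  Cuntz-Krieger family. Restriction to the bases and linear extension are therefore mutually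
  inverse bijections between the covariant representations and the Cuntz-Krieger families
  (\<open>covariant_rep_cuntz_krieger\<close>, \<open>cuntz_krieger_covariant_rep\<close>). Each universal algebra is generated
  by a direct sum over all representations, so that relabelling the summands along this bijection
  carries the one to the other (\<open>universal_cstar_isomorphic\<close>).\<close>

section \<open>Calculus of operators and adjoints\<close>

lemma compose_assoc: "(A o\<^sub>L B) o\<^sub>L C = A o\<^sub>L (B o\<^sub>L C)"
  by (rule blinfun_eqI) simp

lemma compose_add_left: "(A + B) o\<^sub>L C = (A o\<^sub>L C) + (B o\<^sub>L C)"
  by (rule blinfun_eqI) (simp add: blinfun.add_left)

lemma compose_diff_left: "(A - B) o\<^sub>L C = (A o\<^sub>L C) - (B o\<^sub>L C)"
  by (rule blinfun_eqI) (simp add: blinfun.diff_left)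

lemma compose_sum_left: "(\<Sum>i\<in>I. A i) o\<^sub>L C = (\<Sum>i\<in>I. A i o\<^sub>L C)"
  by (rule blinfun_eqI) (simp add: blinfun.sum_left)

lemma compose_sum_right: "A o\<^sub>L (\<Sum>i\<in>I. B i) = (\<Sum>i\<in>I. A o\<^sub>L B i)"
  by (rule blinfun_eqI) (simp add: blinfun.sum_left blinfun.sum_right)

lemma compose_scaleC_left: "(c *\<^sub>C A) o\<^sub>L B = c *\<^sub>C (A o\<^sub>L B)"
  by (rule blinfun_eqI) (simp add: scaleC_blinfun.rep_eq)

lemma compose_scaleC_right: "A \<in> bounded_ops \<Longrightarrow> A o\<^sub>L (c *\<^sub>C B) = c *\<^sub>C (A o\<^sub>L B)"
  by (rule blinfun_eqI) (simp add: scaleC_blinfun.rep_eq bounded_ops_def)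

lemma compose_zero_left [simp]: "0 o\<^sub>L A = 0"
  by (rule blinfun_eqI) simp

lemma scaleC_zero_left [simp]: "0 *\<^sub>C (x :: 'a::complex_normed_vector) = 0"
  using scaleC_of_real[of 0 x] by simp

lemma scaleC_one [simp]: "1 *\<^sub>C (x :: 'a::complex_normed_vector) = x"
  using scaleC_of_real[of 1 x] by simp

lemma scaleC_sum_right:
  "c *\<^sub>C (\<Sum>i\<in>I. f i) = (\<Sum>i\<in>I. c *\<^sub>C (f i :: 'a::complex_normed_vector))"
  by (induction I rule: infinite_finite_induct) (simp_all add: scaleC_zero_right scaleC_add_right)

lemma scaleC_diff_left:
  "(b - c) *\<^sub>C (x :: 'a::complex_normed_vector) = b *\<^sub>C x - c *\<^sub>C x"
  using scaleC_add_left[of "b - c" c x] by (simp add: algebra_simps)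

lemma scaleC_eq_cancel:
  assumes "b *\<^sub>C x = c *\<^sub>C x" "x \<noteq> (0 :: 'a::complex_normed_vector)"
  shows "b = c"
proof -
  have "norm ((b - c) *\<^sub>C x) = 0" using assms(1) by (simp add: scaleC_diff_left)
  then show ?thesis using assms(2) by (simp add: norm_scaleC)
qed

lemma csubspace_sum:
  assumes "csubspace V" "\<And>i. i \<in> I \<Longrightarrow> f i \<in> V"
  shows "(\<Sum>i\<in>I. c i *\<^sub>C f i) \<in> V"
  using assms(2) by (induction I rule: infinite_finite_induct)
    (use assms(1) in \<open>auto simp: csubspace_def\<close>)

lemma csubspace_Inter: "(\<And>V. V \<in> \<V> \<Longrightarrow> csubspace V) \<Longrightarrow> csubspace (\<Inter>\<V>)"
  by (simp add: csubspace_def)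

lemma csubspace_cspan: "csubspace (cspan S)"
  unfolding cspan_def by (rule hull_in) (blast intro: csubspace_Inter)

lemma cspan_finite:
  assumes "finite I"
  shows "cspan (b ` I) = range (\<lambda>c. \<Sum>i\<in>I. c i *\<^sub>C b i)"
proof
  have "b i = (\<Sum>j\<in>I. (if j = i then 1 else 0) *\<^sub>C b j)" if "i \<in> I" for i
    using assms that by (simp add: if_distrib[of "\<lambda>c. c *\<^sub>C _"] cong: if_cong)
  then have "b ` I \<subseteq> range (\<lambda>c. \<Sum>i\<in>I. c i *\<^sub>C b i)" by (auto simp: image_iff)
  moreover have "csubspace (range (\<lambda>c. \<Sum>i\<in>I. c i *\<^sub>C b i))"
  proof -
    have "\<exists>e. (\<Sum>i\<in>I. c i *\<^sub>C b i) + (\<Sum>i\<in>I. d i *\<^sub>C b i) = (\<Sum>i\<in>I. e i *\<^sub>C b i)" for c d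
      by (rule exI[of _ "\<lambda>i. c i + d i"]) (simp add: scaleC_add_left sum.distrib)
    moreover have "\<exists>e. z *\<^sub>C (\<Sum>i\<in>I. c i *\<^sub>C b i) = (\<Sum>i\<in>I. e i *\<^sub>C b i)" for z c
      by (rule exI[of _ "\<lambda>i. z * c i"]) (simp add: scaleC_sum_right scaleC_scaleC)
    moreover have "\<exists>c. 0 = (\<Sum>i\<in>I. c i *\<^sub>C b i)"
      by (rule exI[of _ "\<lambda>i. 0"]) simp
    ultimately show ?thesis unfolding csubspace_def image_iff by fastforce
  qed
  ultimately show "cspan (b ` I) \<subseteq> range (\<lambda>c. \<Sum>i\<in>I. c i *\<^sub>C b i)"
    unfolding cspan_def by (rule hull_minimal)
  show "range (\<lambda>c. \<Sum>i\<in>I. c i *\<^sub>C b i) \<subseteq> cspan (b ` I)"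
    by (auto intro!: csubspace_sum csubspace_cspan) (auto simp: cspan_def hull_inc)
qed

text \<open>If \<open>b \<noteq> 0\<close>, then \<open>c \<mapsto> c b\<close> is a multiple of an isometry, so that its range is complete.\<close>

lemma closed_line: "closed (range (\<lambda>c. c *\<^sub>C (b :: 'a::complex_normed_vector)))"
proof (cases "b = 0")
  case True
  then show ?thesis by (simp add: scaleC_zero_right)
next
  case False
  have "bounded_linear (\<lambda>c. c *\<^sub>C b)"
    by (rule bounded_linear_intro[where K = "norm b"])
      (simp_all add: scaleC_add_left norm_scaleC scaleC_of_real[symmetric] scaleC_scaleC scaleR_conv_of_real)
  then have "complete ((\<lambda>c. c *\<^sub>C b) ` UNIV)"
    using False by (intro complete_isometric_image[where e = "norm b"])
      (auto simp: norm_scaleC complete_UNIV mult.commute)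
  then show ?thesis by (rule complete_imp_closed)
qed

lemma bounded_ops_csubspace: "csubspace (bounded_ops :: 'a op set)"
  and bounded_ops_closed: "closed (bounded_ops :: 'a op set)"
  and bounded_ops_compose: "S \<in> bounded_ops \<Longrightarrow> T \<in> bounded_ops \<Longrightarrow> S o\<^sub>L T \<in> (bounded_ops :: 'a op set)"
  using cstar_subalgebra_bounded_ops[where 'a = 'a] by (simp_all add: cstar_subalgebra_def)

lemma bounded_ops_zero [simp]: "(0 :: 'a op) \<in> bounded_ops"
  and bounded_ops_add: "S \<in> bounded_ops \<Longrightarrow> T \<in> bounded_ops \<Longrightarrow> S + T \<in> (bounded_ops :: 'a op set)"
  and bounded_ops_scaleC: "T \<in> bounded_ops \<Longrightarrow> c *\<^sub>C T \<in> (bounded_ops :: 'a op set)"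
  using bounded_ops_csubspace[where 'a = 'a] by (simp_all add: csubspace_def)

lemma bounded_ops_sum: "(\<And>i. i \<in> I \<Longrightarrow> f i \<in> bounded_ops) \<Longrightarrow> (\<Sum>i\<in>I. f i) \<in> bounded_ops"
  by (induction I rule: infinite_finite_induct) (auto intro: bounded_ops_add)

lemma adj_works': "T \<in> bounded_ops \<Longrightarrow> cinner (T x) y = cinner x (adj T y)"
  by (metis adj_works cinner_commute)

lemma adj_adj: "T \<in> bounded_ops \<Longrightarrow> adj (adj T) = T"
  by (rule adj_eqI) (simp add: adj_works')

lemma adj_compose: "S \<in> bounded_ops \<Longrightarrow> T \<in> bounded_ops \<Longrightarrow> adj (S o\<^sub>L T) = adj T o\<^sub>L adj S"
  by (rule adj_eqI) (simp add: adj_works)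

lemma adj_zero [simp]: "adj 0 = 0"
  by (rule adj_eqI) (simp add: cinner_def zero_ell2.rep_eq)

lemma adj_add: "S \<in> bounded_ops \<Longrightarrow> T \<in> bounded_ops \<Longrightarrow> adj (S + T) = adj S + adj T"
  by (rule adj_eqI) (simp add: adj_works blinfun.add_left cinner_add_left cinner_add_right)

lemma adj_scaleC: "T \<in> bounded_ops \<Longrightarrow> adj (c *\<^sub>C T) = cnj c *\<^sub>C adj T"
  by (rule adj_eqI)
    (simp add: adj_works scaleC_blinfun.rep_eq cinner_scaleC_left cinner_scaleC_right)

lemma adj_sum: "(\<And>i. i \<in> I \<Longrightarrow> f i \<in> bounded_ops) \<Longrightarrow> adj (\<Sum>i\<in>I. f i) = (\<Sum>i\<in>I. adj (f i))"
  by (induction I rule: infinite_finite_induct) (auto simp: adj_add bounded_ops_sum)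

lemma norm_apply_sq: "T \<in> bounded_ops \<Longrightarrow> (norm (T x))\<^sup>2 = Re (cinner x ((adj T o\<^sub>L T) x))"
  by (simp add: power2_norm_eq_inner inner_ell2_def adj_works'[symmetric])

lemma norm_projection_apply:
  assumes "P \<in> bounded_ops" "P o\<^sub>L P = P" "adj P = P"
  shows "(norm (P x))\<^sup>2 = Re (cinner x (P x))" and "norm (P x) \<le> norm x" and "norm P \<le> 1"
proof -
  show 1: "(norm (P x))\<^sup>2 = Re (cinner x (P x))" for x
    using norm_apply_sq[OF assms(1), of x] assms by simp
  show 2: "norm (P x) \<le> norm x" for x
  proof (cases "norm (P x) = 0")
    case False
    have "norm (P x) * norm (P x) \<le> norm x * norm (P x)"
      using 1[of x] norm_cauchy_schwarz[of x "P x"] by (simp add: power2_eq_square inner_ell2_def)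
    with False show ?thesis by simp
  qed simp
  show "norm P \<le> 1" by (rule norm_blinfun_bound) (simp_all add: 2)
qed

lemma norm_apply_partial_isometry:
  assumes "S \<in> bounded_ops" "P \<in> bounded_ops" "P o\<^sub>L P = P" "adj P = P" "adj S o\<^sub>L S = P"
  shows "norm (S x) = norm (P x)"
proof -
  have "(norm (S x))\<^sup>2 = (norm (P x))\<^sup>2"
    using norm_apply_sq[OF assms(1), of x] norm_projection_apply(1)[OF assms(2-4), of x] assms(5)
    by simp
  then show ?thesis by simp
qed

text \<open>Both facts follow from \<open>\<parallel>S x\<parallel> = \<parallel>P x\<parallel>\<close>, the first one with \<open>P x - x\<close> for \<open>x\<close>.\<close>

lemma partial_isometry:
  assumes "S \<in> bounded_ops" "P \<in> bounded_ops" "P o\<^sub>L P = P" "adj P = P" "adj S o\<^sub>L S = P"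
  shows "S o\<^sub>L P = S" and "norm S \<le> 1"
proof -
  note n = norm_apply_partial_isometry[OF assms]
  show "S o\<^sub>L P = S"
  proof (rule blinfun_eqI)
    fix x
    have "P (P x) = P x" by (metis assms(3) blinfun_apply_blinfun_compose)
    then have "norm (S (P x - x)) = 0"
      unfolding n by (simp add: blinfun.diff_right)
    then show "(S o\<^sub>L P) x = S x" by (simp add: blinfun.diff_right)
  qed
  show "norm S \<le> 1"
    by (rule norm_blinfun_bound)
      (use norm_projection_apply(2)[OF assms(2-4)] in \<open>simp_all add: n\<close>)
qed

text \<open>If finitely many range projections add up to a projection \<open>P\<close>, then
  \<open>\<Sum>\<^sub>f \<parallel>S\<^sub>f\<^sup>* S\<^sub>e x\<parallel>\<^sup>2 = \<langle>S\<^sub>e x, P S\<^sub>e x\<rangle> \<le> \<parallel>S\<^sub>e x\<parallel>\<^sup>2 = \<parallel>S\<^sub>e\<^sup>* S\<^sub>e x\<parallel>\<^sup>2\<close>, so that all summands with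
  \<open>f \<noteq> e\<close> vanish.\<close>

lemma range_projections_orthogonal:
  assumes fin: "finite F" and e: "e \<in> F"
    and S: "\<And>f. f \<in> F \<Longrightarrow> S f \<in> bounded_ops"
    and P: "P \<in> bounded_ops" "P o\<^sub>L P = P" "adj P = P" "P = (\<Sum>f\<in>F. S f o\<^sub>L adj (S f))"
    and R: "R \<in> bounded_ops" "R o\<^sub>L R = R" "adj R = R" "adj (S e) o\<^sub>L S e = R"
  shows "P o\<^sub>L S e = S e" and "\<And>f. f \<in> F \<Longrightarrow> f \<noteq> e \<Longrightarrow> adj (S f) o\<^sub>L S e = 0"
proof -
  have sum: "(norm (P y))\<^sup>2 = (\<Sum>f\<in>F. (norm (adj (S f) y))\<^sup>2)" for y
  proof -
    have "(norm (P y))\<^sup>2 = Re (cinner (P y) y)"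
      using norm_projection_apply(1)[OF P(1-3), of y] cinner_commute[of "P y" y] by simp
    also have "\<dots> = (\<Sum>f\<in>F. Re (cinner (S f (adj (S f) y)) y))"
      by (subst P(4)) (simp add: blinfun.sum_left cinner_sum_left)
    also have "\<dots> = (\<Sum>f\<in>F. (norm (adj (S f) y))\<^sup>2)"
      by (intro sum.cong refl)
        (simp add: adj_works'[OF S] power2_norm_eq_inner inner_ell2_def)
    finally show ?thesis .
  qed
  have main: "norm (P (S e x)) = norm (S e x)"
    "(\<Sum>f\<in>F - {e}. (norm (adj (S f) (S e x)))\<^sup>2) = 0" for x
  proof -
    have "adj (S e) (S e x) = R x" by (metis R(4) blinfun_apply_blinfun_compose)
    then have "(norm (P (S e x)))\<^sup>2
        = (norm (S e x))\<^sup>2 + (\<Sum>f\<in>F - {e}. (norm (adj (S f) (S e x)))\<^sup>2)"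
      using norm_apply_partial_isometry[OF S[OF e] R, of x]
      by (simp add: sum sum.remove[OF fin e])
    moreover have "(norm (P (S e x)))\<^sup>2 \<le> (norm (S e x))\<^sup>2"
      using norm_projection_apply(2)[OF P(1-3)] by (intro power_mono) auto
    moreover have "0 \<le> (\<Sum>f\<in>F - {e}. (norm (adj (S f) (S e x)))\<^sup>2)"
      by (intro sum_nonneg) simp
    ultimately have "(norm (P (S e x)))\<^sup>2 = (norm (S e x))\<^sup>2"
      "(\<Sum>f\<in>F - {e}. (norm (adj (S f) (S e x)))\<^sup>2) = 0" by linarith+
    then show "norm (P (S e x)) = norm (S e x)"
      "(\<Sum>f\<in>F - {e}. (norm (adj (S f) (S e x)))\<^sup>2) = 0" by simp_all
  qed
  show "P o\<^sub>L S e = S e"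
  proof (rule blinfun_eqI)
    fix x
    let ?y = "S e x"
    have "(norm (?y - P ?y))\<^sup>2 = (norm ?y)\<^sup>2 - 2 * inner ?y (P ?y) + (norm (P ?y))\<^sup>2"
      by (simp add: power2_norm_eq_inner inner_diff_left inner_diff_right inner_commute)
    also have "inner ?y (P ?y) = (norm (P ?y))\<^sup>2"
      using norm_projection_apply(1)[OF P(1-3)] by (simp add: inner_ell2_def)
    finally have "norm (?y - P ?y) = 0" using main(1)[of x] by simp
    then show "(P o\<^sub>L S e) x = S e x" by simp
  qed
  fix f assume f: "f \<in> F" "f \<noteq> e"
  show "adj (S f) o\<^sub>L S e = 0"
  proof (rule blinfun_eqI)
    fix x
    have "(norm (adj (S f) (S e x)))\<^sup>2 = 0"
      using main(2)[of x] f fin by (subst (asm) sum_nonneg_eq_0_iff) auto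
    then show "(adj (S f) o\<^sub>L S e) x = blinfun_apply 0 x" by simp
  qed
qed

section \<open>Isomorphisms implemented by partial unitaries\<close>

text \<open>The function \<open>adj\<close> is for operators from a space to itself, so that a partial isometry between
  two spaces is given together with its adjoint.\<close>

definition partial_unitary ::
    "('a ell2 \<Rightarrow>\<^sub>L 'b ell2) \<Rightarrow> ('b ell2 \<Rightarrow>\<^sub>L 'a ell2) \<Rightarrow> bool" where
  "partial_unitary V W \<longleftrightarrow>
     (\<forall>c x. V (c *\<^sub>C x) = c *\<^sub>C V x) \<and> (\<forall>c y. W (c *\<^sub>C y) = c *\<^sub>C W y) \<and>
     (\<forall>x y. cinner (V x) y = cinner x (W y)) \<and>
     (\<forall>x. V (W (V x)) = V x) \<and> (\<forall>y. W (V (W y)) = W y)"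

text \<open>The operators that live on the initial space of \<open>V\<close>; on them, transport along \<open>V\<close> loses
  nothing.\<close>

definition corner :: "('a ell2 \<Rightarrow>\<^sub>L 'b ell2) \<Rightarrow> ('b ell2 \<Rightarrow>\<^sub>L 'a ell2) \<Rightarrow> 'a op set" where
  "corner V W = {T \<in> bounded_ops. (\<forall>x. W (V (T x)) = T x) \<and> (\<forall>x. T (W (V x)) = T x)}"

definition transport ::
    "('a ell2 \<Rightarrow>\<^sub>L 'b ell2) \<Rightarrow> ('b ell2 \<Rightarrow>\<^sub>L 'a ell2) \<Rightarrow> 'a op \<Rightarrow> 'b op" where
  "transport V W T = V o\<^sub>L T o\<^sub>L W"

lemma transport_apply [simp]: "transport V W T y = V (T (W y))"
  by (simp add: transport_def)

lemma partial_unitary_sym: "partial_unitary V W \<Longrightarrow> partial_unitary W V"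
  unfolding partial_unitary_def by (metis cinner_commute)

lemma corner_bounded_ops: "T \<in> corner V W \<Longrightarrow> T \<in> bounded_ops"
  by (simp add: corner_def)

lemma transport_in_corner:
  assumes "partial_unitary V W" "T \<in> corner V W"
  shows "transport V W T \<in> corner W V" and "transport W V (transport V W T) = T"
  using assms by (auto simp: partial_unitary_def corner_def bounded_ops_def intro!: blinfun_eqI)

lemma adj_in_corner:
  assumes VW: "partial_unitary V W" and T: "T \<in> corner V W"
  shows "adj T \<in> corner V W"
proof -
  have Tb: "T \<in> bounded_ops" using T by (rule corner_bounded_ops)
  have c: "cinner (V x) y = cinner x (W y)" "cinner (W y) x = cinner y (V x)" for x y
    using VW partial_unitary_sym[OF VW] by (auto simp: partial_unitary_def)
  have 1: "W (V (adj T x)) = adj T x" for x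
  proof (rule cinner_eqI)
    fix z
    show "cinner z (W (V (adj T x))) = cinner z (adj T x)"
      using T by (simp add: c[symmetric] adj_works'[OF Tb, symmetric] corner_def)
  qed
  have 2: "adj T (W (V x)) = adj T x" for x
  proof (rule cinner_eqI)
    fix z
    show "cinner z (adj T (W (V x))) = cinner z (adj T x)"
      using T by (simp add: c[symmetric] adj_works'[OF Tb, symmetric] corner_def)
  qed
  show ?thesis using 1 2 adj_in_bounded_ops[OF Tb] by (simp add: corner_def)
qed

lemma transport_adj:
  assumes VW: "partial_unitary V W" and T: "T \<in> bounded_ops"
  shows "transport V W (adj T) = adj (transport V W T)"
proof (rule adj_eqI[symmetric])
  have c: "cinner (V x) y = cinner x (W y)" "cinner (W y) x = cinner y (V x)" for x y
    using VW partial_unitary_sym[OF VW] by (auto simp: partial_unitary_def)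
  show "cinner (transport V W (adj T) x) y = cinner x (transport V W T y)" for x y
    by (simp add: c adj_works[OF T])
qed

lemma continuous_on_transport: "continuous_on A (transport V W)"
  unfolding transport_def by (intro continuous_intros)

lemma cstar_subalgebra_corner:
  assumes VW: "partial_unitary V W"
  shows "cstar_subalgebra (corner V W)"
proof -
  have eq: "corner V W =
      bounded_ops \<inter> {T. (W o\<^sub>L V) o\<^sub>L T = T} \<inter> {T. T o\<^sub>L (W o\<^sub>L V) = T}"
    unfolding corner_def by (auto intro!: blinfun_eqI) (metis blinfun_apply_blinfun_compose)+
  have "closed (corner V W)"
    unfolding eq
    by (intro closed_Int bounded_ops_closed closed_Collect_eq continuous_intros)
  moreover have "csubspace (corner V W)"
    using VW bounded_ops_csubspace
    by (auto simp: csubspace_def corner_def partial_unitary_def blinfun.add_left blinfun.add_right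
        scaleC_blinfun.rep_eq)
  ultimately show ?thesis
    using adj_in_corner[OF VW]
    by (auto simp: cstar_subalgebra_def corner_def bounded_ops_compose)
qed

text \<open>The image is norm closed because it is also the preimage of \<open>M\<close> under the transport back.\<close>

lemma cstar_subalgebra_transport:
  assumes VW: "partial_unitary V W" and M: "cstar_subalgebra M" "M \<subseteq> corner V W"
  shows "cstar_subalgebra (transport V W ` M)"
proof -
  note WV = partial_unitary_sym[OF VW]
  have Mb: "M \<subseteq> bounded_ops" using M(1) by (simp add: cstar_subalgebra_def)
  have img: "transport V W ` M = {S \<in> corner W V. transport W V S \<in> M}"
  proof
    show "transport V W ` M \<subseteq> {S \<in> corner W V. transport W V S \<in> M}"
      using transport_in_corner[OF VW] M(2) by auto
    show "{S \<in> corner W V. transport W V S \<in> M} \<subseteq> transport V W ` M"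
      using transport_in_corner[OF WV] by (auto simp: image_iff) metis
  qed
  have "closed (corner W V \<inter> (transport W V) -` M)"
  proof (rule closed_Int)
    show "closed (corner W V)"
      using cstar_subalgebra_corner[OF WV] by (simp add: cstar_subalgebra_def)
    have "closed M" using M(1) by (simp add: cstar_subalgebra_def)
    then show "closed (transport W V -` M)"
      by (intro continuous_closed_vimage)
        (use continuous_on_transport[of UNIV W V] in \<open>auto simp: continuous_on_eq_continuous_at\<close>)
  qed
  moreover have "transport V W ` M = corner W V \<inter> (transport W V) -` M"
    unfolding img by auto
  ultimately have cl: "closed (transport V W ` M)" by simp
  have add: "transport V W S + transport V W T = transport V W (S + T)" for S T
    by (rule blinfun_eqI) (simp add: blinfun.add_left blinfun.add_right)
  have scale: "c *\<^sub>C transport V W T = transport V W (c *\<^sub>C T)" for c T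
    using VW by (intro blinfun_eqI) (simp add: scaleC_blinfun.rep_eq partial_unitary_def)
  have comp: "transport V W S o\<^sub>L transport V W T = transport V W (S o\<^sub>L T)" if "S \<in> M" for S T
    using that M(2) by (intro blinfun_eqI) (auto simp: corner_def)
  have zero: "transport V W 0 = 0"
    by (rule blinfun_eqI) simp
  have "csubspace (transport V W ` M)"
    unfolding csubspace_def
  proof (intro conjI ballI allI)
    have "0 \<in> M" using M(1) by (simp add: cstar_subalgebra_def csubspace_def)
    then show "0 \<in> transport V W ` M" using zero by (metis imageI)
  next
    fix x y assume "x \<in> transport V W ` M" "y \<in> transport V W ` M"
    then show "x + y \<in> transport V W ` M"
      using M(1) by (auto simp: add cstar_subalgebra_def csubspace_def)
  next
    fix c x assume "x \<in> transport V W ` M"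
    then show "c *\<^sub>C x \<in> transport V W ` M"
      using M(1) by (auto simp: scale cstar_subalgebra_def csubspace_def)
  qed
  moreover have "S o\<^sub>L T \<in> transport V W ` M"
    if "S \<in> transport V W ` M" "T \<in> transport V W ` M" for S T
    using that M(1) by (auto simp: comp cstar_subalgebra_def)
  moreover have "adj T \<in> transport V W ` M" if "T \<in> transport V W ` M" for T
    using that M(1) Mb by (auto simp: transport_adj[OF VW, symmetric] cstar_subalgebra_def subset_iff)
  moreover have "transport V W ` M \<subseteq> bounded_ops"
    unfolding img using corner_bounded_ops by auto
  ultimately show ?thesis using cl unfolding cstar_subalgebra_def by blast
qed

lemma cstar_gen_least: "cstar_subalgebra M \<Longrightarrow> S \<subseteq> M \<Longrightarrow> cstar_gen S \<subseteq> M"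
  unfolding cstar_gen_def by (rule hull_minimal)

lemma cstar_gen_superset: "S \<subseteq> cstar_gen S"
  unfolding cstar_gen_def by (rule hull_subset)

text \<open>Transport takes the algebra generated by \<open>S\<close> onto a C*-algebra containing the transported
  generators, and the same applies to the way back; so the two generated algebras correspond.\<close>

lemma star_isomorphic_transport:
  assumes VW: "partial_unitary V W" and S: "S \<subseteq> corner V W"
  shows "star_isomorphic (cstar_gen S) (cstar_gen (transport V W ` S))"
proof -
  note WV = partial_unitary_sym[OF VW]
  let ?f = "transport V W" and ?g = "transport W V"
  note into = cstar_gen_least[OF cstar_subalgebra_corner]
  have fS: "?f ` S \<subseteq> corner W V" using transport_in_corner(1)[OF VW] S by auto
  have Sb: "S \<subseteq> bounded_ops" "?f ` S \<subseteq> bounded_ops"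
    using S fS corner_bounded_ops by blast+
  have gf: "?g ` ?f ` S = S"
    using transport_in_corner(2)[OF VW] S by (force simp: image_image)
  have le1: "cstar_gen (?f ` S) \<subseteq> ?f ` cstar_gen S"
    using cstar_subalgebra_transport[OF VW cstar_subalgebra_cstar_gen[OF Sb(1)] into[OF VW S]]
    by (rule cstar_gen_least) (use cstar_gen_superset in blast)
  have le2: "cstar_gen S \<subseteq> ?g ` cstar_gen (?f ` S)"
    using cstar_subalgebra_transport[OF WV cstar_subalgebra_cstar_gen[OF Sb(2)] into[OF WV fS]]
    by (rule cstar_gen_least) (use cstar_gen_superset[of "?f ` S"] gf in blast)
  have fg: "?f (?g T) = T" if "T \<in> cstar_gen (?f ` S)" for T
    using transport_in_corner(2)[OF WV] into[OF WV fS] that by blast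
  have gf': "?g (?f T) = T" if "T \<in> cstar_gen S" for T
    using transport_in_corner(2)[OF VW] into[OF VW S] that by blast
  have img: "?f ` cstar_gen S = cstar_gen (?f ` S)"
  proof
    show "?f ` cstar_gen S \<subseteq> cstar_gen (?f ` S)" using le2 fg by force
  qed (rule le1)
  have "inj_on ?f (cstar_gen S)" using gf' by (metis inj_onI)
  with img have "bij_betw ?f (cstar_gen S) (cstar_gen (?f ` S))" by (simp add: bij_betw_def)
  moreover have "star_hom (cstar_gen S) (cstar_gen (?f ` S)) ?f"
    unfolding star_hom_def
  proof (intro conjI ballI allI)
    show "?f ` cstar_gen S \<subseteq> cstar_gen (?f ` S)" using img by simp
    fix A B c assume A: "A \<in> cstar_gen S"
    show "?f (A + B) = ?f A + ?f B"
      by (rule blinfun_eqI) (simp add: blinfun.add_left blinfun.add_right)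
    show "?f (A o\<^sub>L B) = ?f A o\<^sub>L ?f B"
      using into[OF VW S] A by (intro blinfun_eqI) (auto simp: corner_def)
    show "?f (c *\<^sub>C A) = c *\<^sub>C ?f A"
      using VW by (intro blinfun_eqI) (simp add: scaleC_blinfun.rep_eq partial_unitary_def)
    show "?f (adj A) = adj (?f A)"
      using into[OF VW S] A corner_bounded_ops by (intro transport_adj[OF VW]) blast
  qed
  ultimately show ?thesis unfolding star_isomorphic_def by blast
qed

section \<open>Universal algebras with matching representations\<close>

text \<open>The component of a vector of \<open>\<Oplus>\<^sub>i \<ell>\<^sup>2('h)\<close> in the summand \<open>i\<close>.\<close>

definition slice :: "'i \<Rightarrow> ('i \<times> 'h) ell2 \<Rightarrow> 'h ell2" where
  "slice i x = Abs_ell2 (\<lambda>h. coord x (i, h))"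

lemma coord_slice: "coord (slice i x) h = coord x (i, h)"
proof -
  have "inj_on (Pair i) UNIV" by (simp add: inj_on_def)
  note r = ell2_relabel(2)[OF this, where f = "\<lambda>x h. coord x (i, h)"]
  have "coord (Abs_ell2 (\<lambda>h. coord x (i, h))) = (\<lambda>h. coord x (i, h))"
    by (rule r) simp
  then show ?thesis by (simp add: slice_def)
qed

lemma slice_eqI:
  assumes "\<And>i. slice i x = slice i y"
  shows "x = y"
proof (intro coord_inject[THEN iffD1] ext)
  fix p show "coord x p = coord y p"
    using assms[of "fst p"] by (metis coord_slice prod.collapse)
qed

lemma slice_scaleC: "slice i (c *\<^sub>C x) = c *\<^sub>C slice i x"
  by (intro coord_inject[THEN iffD1] ext) (simp add: coord_slice scaleC_ell2.rep_eq)

lemma slice_add: "slice i (x + y) = slice i x + slice i y"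
  by (intro coord_inject[THEN iffD1] ext) (simp add: coord_slice plus_ell2.rep_eq)

lemma slice_zero [simp]: "slice i 0 = 0"
  by (intro coord_inject[THEN iffD1] ext) (simp add: coord_slice zero_ell2.rep_eq)

lemma slice_sum: "slice i (\<Sum>j\<in>J. f j) = (\<Sum>j\<in>J. slice i (f j))"
  by (induction J rule: infinite_finite_induct) (simp_all add: slice_add)

lemma slice_universal_gen:
  assumes "\<exists>M. \<forall>\<rho>\<in>representations gens R. norm (\<rho> g) \<le> M"
  shows "slice \<rho> (universal_gen gens R g x)
    = (if \<rho> \<in> representations gens R then \<rho> g (slice \<rho> x) else 0)"
proof -
  obtain M where M: "\<And>\<rho>. \<rho> \<in> representations gens R \<Longrightarrow> norm (\<rho> g) \<le> M" using assms by blast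
  have ds: "coord (direct_sum (representations gens R) (\<lambda>\<rho>. \<rho> g) x) (\<rho>, h) =
      (if \<rho> \<in> representations gens R then coord (\<rho> g (slice \<rho> x)) h else 0)" for h
    unfolding slice_def
    by (rule direct_sum[where T = "\<lambda>\<rho>. \<rho> g" and I = "representations gens R" and M = M]) (rule M)
  show ?thesis
    by (intro coord_inject[THEN iffD1] ext)
      (simp add: coord_slice universal_gen_def ds zero_ell2.rep_eq)
qed

lemma universal_gen_bounded_ops:
  assumes "g \<in> gens" "\<exists>M. \<forall>\<rho>\<in>representations gens R. norm (\<rho> g) \<le> M"
  shows "universal_gen gens R g \<in> bounded_ops"
  unfolding bounded_ops_def
proof (clarify, rule slice_eqI)
  fix c x \<rho>
  have "\<rho> g \<in> bounded_ops" if "\<rho> \<in> representations gens R"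
    using that assms(1) by (auto simp: representations_def)
  then show "slice \<rho> (universal_gen gens R g (c *\<^sub>C x)) = slice \<rho> (c *\<^sub>C universal_gen gens R g x)"
    by (simp add: slice_universal_gen[OF assms(2)] slice_scaleC scaleC_zero_right bounded_ops_def)
qed

text \<open>The partial unitary that renames the summand \<open>\<phi> j\<close> of a direct sum to \<open>j\<close>. The summands outside
  \<open>J\<close> are killed: the direct sums defining a universal algebra range over all functions, and the
  generators vanish on the summands of those that are not representations.\<close>

definition reindex :: "'j set \<Rightarrow> ('j \<Rightarrow> 'i) \<Rightarrow> ('i \<times> 'h) ell2 \<Rightarrow>\<^sub>L ('j \<times> 'h) ell2" where
  "reindex J \<phi> = Blinfun (\<lambda>x. Abs_ell2 (\<lambda>p.
     if p \<in> J \<times> UNIV then coord x (map_prod \<phi> id p) else 0))"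

lemma coord_reindex:
  assumes "inj_on \<phi> J"
  shows "coord (reindex J \<phi> x) p = (if fst p \<in> J then coord x (\<phi> (fst p), snd p) else 0)"
proof -
  have "inj_on (map_prod \<phi> id) (J \<times> (UNIV :: 'c set))"
    using assms by (auto simp: inj_on_def)
  note r = ell2_relabel[OF this, of "\<lambda>x p. if p \<in> J \<times> UNIV then coord x (map_prod \<phi> id p) else 0", OF refl]
  show ?thesis
    unfolding reindex_def
    by (subst bounded_linear_Blinfun_apply[OF r(1)], subst r(2)) (cases p; simp)
qed

lemma slice_reindex:
  assumes "inj_on \<phi> J"
  shows "slice j (reindex J \<phi> x) = (if j \<in> J then slice (\<phi> j) x else 0)"
  by (intro coord_inject[THEN iffD1] ext)
    (simp add: coord_slice coord_reindex[OF assms] zero_ell2.rep_eq)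

lemma partial_unitary_reindex:
  assumes \<phi>: "bij_betw \<phi> J I" and \<psi>: "\<And>j. j \<in> J \<Longrightarrow> \<psi> (\<phi> j) = j"
  shows "partial_unitary (reindex J \<phi> :: ('i \<times> 'h) ell2 \<Rightarrow>\<^sub>L ('j \<times> 'h) ell2) (reindex I \<psi>)"
proof -
  have \<psi>': "\<psi> i \<in> J \<and> \<phi> (\<psi> i) = i" if "i \<in> I" for i
    using that \<phi> \<psi> by (auto simp: bij_betw_def)
  have \<phi>': "\<phi> j \<in> I" if "j \<in> J" for j using that \<phi> by (auto simp: bij_betw_def)
  have i\<phi>: "inj_on \<phi> J" using \<phi> by (simp add: bij_betw_def)
  have i\<psi>: "inj_on \<psi> I" by (metis \<psi>' inj_onI)
  note sl = slice_reindex[OF i\<phi>] slice_reindex[OF i\<psi>]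
  have bij: "bij_betw (map_prod \<phi> id) (J \<times> (UNIV :: 'h set)) (I \<times> UNIV)"
    unfolding map_prod_def id_def
    by (rule bij_betw_byWitness[where f' = "\<lambda>(i, h). (\<psi> i, h)"]) (use \<phi>' \<psi> \<psi>' in auto)
  show ?thesis
    unfolding partial_unitary_def
  proof (intro conjI allI)
    fix x :: "('i \<times> 'h) ell2" and y :: "('j \<times> 'h) ell2"
    have "cinner (reindex J \<phi> x) y
        = (\<Sum>\<^sub>\<infinity>p\<in>J \<times> UNIV. cnj (coord x (map_prod \<phi> id p)) * coord y (map_prod \<psi> id (map_prod \<phi> id p)))"
      unfolding cinner_def
      by (rule infsum_cong_neutral) (auto simp: coord_reindex[OF i\<phi>] \<psi>)
    also have "\<dots> = (\<Sum>\<^sub>\<infinity>p\<in>I \<times> UNIV. cnj (coord x p) * coord y (map_prod \<psi> id p))"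
      by (rule infsum_reindex_bij_betw[OF bij])
    also have "\<dots> = cinner x (reindex I \<psi> y)"
      unfolding cinner_def
      by (rule infsum_cong_neutral) (auto simp: coord_reindex[OF i\<psi>])
    finally show "cinner (reindex J \<phi> x) y = cinner x (reindex I \<psi> y)" .
  qed (rule slice_eqI, simp add: sl slice_scaleC scaleC_zero_right \<psi> \<psi>' \<phi>')+
qed

text \<open>The universal algebra only depends on its representations: if those of two sets of generators
  correspond to each other and the first generators are, uniformly in the representation, linear
  combinations of the second and include them, then relabelling the summands of the universal
  representation carries one algebra onto the other.\<close>

theorem universal_cstar_isomorphic:
  fixes R1 :: "('g \<Rightarrow> 'h::infinite op) \<Rightarrow> bool" and R2 :: "('k \<Rightarrow> 'h op) \<Rightarrow> bool"
  assumes \<Phi>: "bij_betw \<Phi> (representations gens1 R1) (representations gens2 R2)"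
    and bnd1: "\<And>g. g \<in> gens1 \<Longrightarrow> \<exists>M. \<forall>\<rho>\<in>representations gens1 R1. norm (\<rho> g) \<le> M"
    and bnd2: "\<And>h. h \<in> gens2 \<Longrightarrow> \<exists>M. \<forall>\<sigma>\<in>representations gens2 R2. norm (\<sigma> h) \<le> M"
    and comb: "\<And>g. g \<in> gens1 \<Longrightarrow> \<exists>F c. F \<subseteq> gens2 \<and>
      (\<forall>\<rho>\<in>representations gens1 R1. \<rho> g = (\<Sum>h\<in>F. c h *\<^sub>C \<Phi> \<rho> h))"
    and gen: "\<And>h. h \<in> gens2 \<Longrightarrow> \<exists>g\<in>gens1. \<forall>\<rho>\<in>representations gens1 R1. \<Phi> \<rho> h = \<rho> g"
  shows "star_isomorphic (universal_cstar gens1 R1) (universal_cstar gens2 R2)"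
proof -
  define I where "I = representations gens1 R1"
  define J where "J = representations gens2 R2"
  define \<phi> where "\<phi> = inv_into I \<Phi>"
  have \<Phi>: "bij_betw \<Phi> I J" using assms(1) by (simp add: I_def J_def)
  have \<phi>: "bij_betw \<phi> J I" unfolding \<phi>_def by (rule bij_betw_inv_into[OF \<Phi>])
  have \<Phi>\<phi>: "\<Phi> (\<phi> \<sigma>) = \<sigma>" if "\<sigma> \<in> J" for \<sigma>
    unfolding \<phi>_def by (rule bij_betw_inv_into_right[OF \<Phi> that])
  have \<phi>\<Phi>: "\<phi> (\<Phi> \<rho>) = \<rho>" if "\<rho> \<in> I" for \<rho>
    unfolding \<phi>_def by (rule bij_betw_inv_into_left[OF \<Phi> that])
  have mem: "\<Phi> \<rho> \<in> J" if "\<rho> \<in> I" for \<rho> using that \<Phi> by (auto simp: bij_betw_def)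
  have mem': "\<phi> \<sigma> \<in> I" if "\<sigma> \<in> J" for \<sigma> using that \<phi> by (auto simp: bij_betw_def)
  let ?V = "reindex J \<phi> :: (('g \<Rightarrow> 'h op) \<times> 'h) ell2 \<Rightarrow>\<^sub>L (('k \<Rightarrow> 'h op) \<times> 'h) ell2"
  let ?W = "reindex I \<Phi> :: (('k \<Rightarrow> 'h op) \<times> 'h) ell2 \<Rightarrow>\<^sub>L (('g \<Rightarrow> 'h op) \<times> 'h) ell2"
  let ?u1 = "universal_gen gens1 R1" and ?u2 = "universal_gen gens2 R2"
  have VW: "partial_unitary ?V ?W" by (rule partial_unitary_reindex[OF \<phi>]) (rule \<Phi>\<phi>)
  have inj: "inj_on \<phi> J" "inj_on \<Phi> I" using \<phi> \<Phi> by (simp_all add: bij_betw_def)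
  note sl = slice_reindex[OF inj(1)] slice_reindex[OF inj(2)]
  note su1 = slice_universal_gen[OF bnd1, folded I_def]
  note su2 = slice_universal_gen[OF bnd2, folded J_def]
  have corner: "?u1 ` gens1 \<subseteq> corner ?V ?W"
  proof clarify
    fix g assume g: "g \<in> gens1"
    have "?W (?V (?u1 g x)) = ?u1 g x" "?u1 g (?W (?V x)) = ?u1 g x" for x
      by (rule slice_eqI, simp add: sl su1[OF g] \<phi>\<Phi> mem)+
    then show "?u1 g \<in> corner ?V ?W"
      using universal_gen_bounded_ops[OF g bnd1[OF g]] by (simp add: corner_def)
  qed
  have bnd2': "?u2 ` gens2 \<subseteq> bounded_ops"
  proof clarify
    fix h assume h: "h \<in> gens2"
    show "?u2 h \<in> bounded_ops" by (rule universal_gen_bounded_ops[OF h bnd2[OF h]])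
  qed
  have tr: "slice \<sigma> (transport ?V ?W (?u1 g) x) = (if \<sigma> \<in> J then \<phi> \<sigma> g (slice \<sigma> x) else 0)"
    if "g \<in> gens1" for g \<sigma> x
    by (simp add: sl su1[OF that] mem' \<Phi>\<phi>)
  have "cstar_gen (transport ?V ?W ` ?u1 ` gens1) = cstar_gen (?u2 ` gens2)"
  proof
    have fb: "transport ?V ?W ` ?u1 ` gens1 \<subseteq> bounded_ops"
      using transport_in_corner(1)[OF VW] corner corner_bounded_ops by blast
    have "transport ?V ?W (?u1 g) \<in> cstar_gen (?u2 ` gens2)" if g: "g \<in> gens1" for g
    proof -
      from comb[OF g] obtain F c
        where Fc: "F \<subseteq> gens2 \<and> (\<forall>\<rho>\<in>I. \<rho> g = (\<Sum>h\<in>F. c h *\<^sub>C \<Phi> \<rho> h))"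
        unfolding I_def by (elim exE)
      note F = conjunct1[OF Fc] bspec[OF conjunct2[OF Fc]]
      have "transport ?V ?W (?u1 g) = (\<Sum>h\<in>F. c h *\<^sub>C ?u2 h)"
      proof (rule blinfun_eqI, rule slice_eqI)
        fix x \<sigma>
        have "slice \<sigma> ((c h *\<^sub>C ?u2 h) x) = (if \<sigma> \<in> J then c h *\<^sub>C \<sigma> h (slice \<sigma> x) else 0)"
          if "h \<in> F" for h
          using su2[of h] that F(1) by (auto simp: scaleC_blinfun.rep_eq slice_scaleC scaleC_zero_right)
        then have "slice \<sigma> ((\<Sum>h\<in>F. c h *\<^sub>C ?u2 h) x)
            = (\<Sum>h\<in>F. if \<sigma> \<in> J then c h *\<^sub>C \<sigma> h (slice \<sigma> x) else 0)"
          unfolding blinfun.sum_left slice_sum by (intro sum.cong refl)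
        also have "\<dots> = (if \<sigma> \<in> J then \<phi> \<sigma> g (slice \<sigma> x) else 0)"
        proof (cases "\<sigma> \<in> J")
          case True
          then have "\<phi> \<sigma> g = (\<Sum>h\<in>F. c h *\<^sub>C \<sigma> h)"
            using F(2)[OF mem'[OF True]] \<Phi>\<phi>[OF True] by simp
          then show ?thesis by (simp add: blinfun.sum_left scaleC_blinfun.rep_eq)
        qed simp
        finally show "slice \<sigma> (transport ?V ?W (?u1 g) x) = slice \<sigma> ((\<Sum>h\<in>F. c h *\<^sub>C ?u2 h) x)"
          unfolding tr[OF g] by (rule sym)
      qed
      also have "\<dots> \<in> cstar_gen (?u2 ` gens2)"
        using cstar_subalgebra_cstar_gen[OF bnd2'] cstar_gen_superset[of "?u2 ` gens2"] F(1)
        by (intro csubspace_sum) (auto simp: cstar_subalgebra_def)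
      finally show ?thesis .
    qed
    then show "cstar_gen (transport ?V ?W ` ?u1 ` gens1) \<subseteq> cstar_gen (?u2 ` gens2)"
      by (intro cstar_gen_least cstar_subalgebra_cstar_gen[OF bnd2']) blast
    have "?u2 h \<in> transport ?V ?W ` ?u1 ` gens1" if h: "h \<in> gens2" for h
    proof -
      from gen[OF h] obtain g where g1: "g \<in> gens1" and g2: "\<forall>\<rho>\<in>I. \<Phi> \<rho> h = \<rho> g"
        unfolding I_def by (elim bexE)
      note g = g1 bspec[OF g2]
      have "?u2 h = transport ?V ?W (?u1 g)"
      proof (rule blinfun_eqI, rule slice_eqI)
        fix x \<sigma>
        have "\<phi> \<sigma> g = \<sigma> h" if "\<sigma> \<in> J" using g(2)[OF mem'[OF that]] \<Phi>\<phi>[OF that] by simp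
        then show "slice \<sigma> (?u2 h x) = slice \<sigma> (transport ?V ?W (?u1 g) x)"
          unfolding tr[OF g(1)] by (simp add: su2[OF h])
      qed
      then show ?thesis using g(1) by blast
    qed
    then show "cstar_gen (?u2 ` gens2) \<subseteq> cstar_gen (transport ?V ?W ` ?u1 ` gens1)"
      by (intro cstar_gen_least cstar_subalgebra_cstar_gen[OF fb])
        (use cstar_gen_superset[of "transport ?V ?W ` ?u1 ` gens1"] in blast)
  qed
  then show ?thesis
    using star_isomorphic_transport[OF VW corner] unfolding universal_cstar_def by simp
qed

section \<open>Families of projections and partial isometries indexed by a graph\<close>

lemma sum_scaleC_delta:
  fixes f :: "'i \<Rightarrow> 'a::complex_normed_vector"
  assumes "finite I"
  shows "(\<Sum>i\<in>I. c i *\<^sub>C (if i = j then f i else 0)) = (if j \<in> I then c j *\<^sub>C f j else 0)"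
    and "(\<Sum>i\<in>I. c i *\<^sub>C (if j = i then f i else 0)) = (if j \<in> I then c j *\<^sub>C f j else 0)"
  using assms by (simp_all add: if_distrib[of "\<lambda>x. _ *\<^sub>C x"] scaleC_zero_right cong: if_cong)

lemma linear_on_sum:
  assumes V: "csubspace V"
    and add: "\<And>x y. x \<in> V \<Longrightarrow> y \<in> V \<Longrightarrow> f (x + y) = f x + f y"
    and scale: "\<And>c x. x \<in> V \<Longrightarrow> f (c *\<^sub>C x) = c *\<^sub>C f x"
    and b: "\<And>i. i \<in> I \<Longrightarrow> b i \<in> V"
  shows "f (\<Sum>i\<in>I. c i *\<^sub>C b i) = (\<Sum>i\<in>I. c i *\<^sub>C (f (b i) :: 'b::complex_normed_vector))"
proof -
  have "0 \<in> V" using V by (simp add: csubspace_def)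
  then have 0: "f 0 = 0" using scale[of 0 0] by simp
  show ?thesis
    using b
  proof (induction I rule: infinite_finite_induct)
    case (insert i I)
    have "(\<Sum>i\<in>I. c i *\<^sub>C b i) \<in> V" "c i *\<^sub>C b i \<in> V"
      using V insert.prems by (auto intro!: csubspace_sum simp: csubspace_def)
    then show ?case using insert by (simp add: add scale)
  qed (simp_all add: 0)
qed

text \<open>The relations common to the standard basis of the correspondence of a graph and to a
  Cuntz-Krieger family. The relation \<open>P\<^sub>v = \<Sum>\<^sub>e S\<^sub>e S\<^sub>e\<^sup>*\<close> is not among them, as it fails in general for
  the basis: on the Fock space the empty word lies in no range of a creation operator.\<close>

locale graph_family = fin_digraph G for G :: "('v, 'e) pre_digraph" +
  fixes P :: "'v \<Rightarrow> 'k op" and S :: "'e \<Rightarrow> 'k op"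
  assumes P_bounded: "v \<in> verts G \<Longrightarrow> P v \<in> bounded_ops"
    and P_adj: "v \<in> verts G \<Longrightarrow> adj (P v) = P v"
    and P_mult: "v \<in> verts G \<Longrightarrow> w \<in> verts G \<Longrightarrow> P v o\<^sub>L P w = (if v = w then P v else 0)"
    and S_bounded: "e \<in> arcs G \<Longrightarrow> S e \<in> bounded_ops"
    and S_inner: "e \<in> arcs G \<Longrightarrow> f \<in> arcs G \<Longrightarrow>
      adj (S e) o\<^sub>L S f = (if e = f then P (tail G e) else 0)"
    and P_S: "v \<in> verts G \<Longrightarrow> e \<in> arcs G \<Longrightarrow>
      P v o\<^sub>L S e = (if v = head G e then S e else 0)"
begin

definition vsum :: "('v \<Rightarrow> complex) \<Rightarrow> 'k op" where
  "vsum c = (\<Sum>v\<in>verts G. c v *\<^sub>C P v)"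

definition esum :: "('e \<Rightarrow> complex) \<Rightarrow> 'k op" where
  "esum z = (\<Sum>e\<in>arcs G. z e *\<^sub>C S e)"

lemma S_P:
  assumes "e \<in> arcs G" "v \<in> verts G"
  shows "S e o\<^sub>L P v = (if v = tail G e then S e else 0)"
proof -
  have t: "tail G e \<in> verts G" using assms by simp
  have 1: "S e o\<^sub>L P (tail G e) = S e"
    by (rule partial_isometry(1))
      (use assms t S_inner[of e e] in \<open>simp_all add: S_bounded P_bounded P_mult P_adj\<close>)
  then have "S e o\<^sub>L P v = S e o\<^sub>L (P (tail G e) o\<^sub>L P v)" by (metis compose_assoc)
  then show ?thesis using 1 assms t by (auto simp: P_mult)
qed

lemma vsum_bounded: "vsum c \<in> bounded_ops"
  unfolding vsum_def by (intro bounded_ops_sum bounded_ops_scaleC P_bounded)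

lemma esum_bounded: "esum z \<in> bounded_ops"
  unfolding esum_def by (intro bounded_ops_sum bounded_ops_scaleC S_bounded)

lemma vsum_add: "vsum c + vsum d = vsum (\<lambda>v. c v + d v)"
  by (simp add: vsum_def sum.distrib scaleC_add_left)

lemma esum_add: "esum y + esum z = esum (\<lambda>e. y e + z e)"
  by (simp add: esum_def sum.distrib scaleC_add_left)

lemma vsum_scaleC: "a *\<^sub>C vsum c = vsum (\<lambda>v. a * c v)"
  by (simp add: vsum_def scaleC_sum_right scaleC_scaleC)

lemma esum_scaleC: "a *\<^sub>C esum z = esum (\<lambda>e. a * z e)"
  by (simp add: esum_def scaleC_sum_right scaleC_scaleC)

lemma vsum_adj: "adj (vsum c) = vsum (\<lambda>v. cnj (c v))"
  unfolding vsum_def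
  by (subst adj_sum) (auto simp: P_bounded bounded_ops_scaleC adj_scaleC P_adj intro!: sum.cong)

lemma P_vsum: "v \<in> verts G \<Longrightarrow> P v o\<^sub>L vsum c = c v *\<^sub>C P v"
  unfolding vsum_def compose_sum_right
  by (simp add: compose_scaleC_right P_bounded P_mult sum_scaleC_delta cong: sum.cong)

lemma vsum_P: "v \<in> verts G \<Longrightarrow> vsum c o\<^sub>L P v = c v *\<^sub>C P v"
  unfolding vsum_def compose_sum_left compose_scaleC_left
  by (simp add: P_mult sum_scaleC_delta cong: sum.cong)

lemma vsum_mult: "vsum c o\<^sub>L vsum d = vsum (\<lambda>v. c v * d v)"
  unfolding vsum_def[of c] compose_sum_left compose_scaleC_left
  by (simp add: P_vsum scaleC_scaleC, simp add: vsum_def)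

lemma vsum_S: "e \<in> arcs G \<Longrightarrow> vsum c o\<^sub>L S e = c (head G e) *\<^sub>C S e"
  unfolding vsum_def compose_sum_left compose_scaleC_left
  by (simp add: P_S sum_scaleC_delta(1) cong: sum.cong)

lemma vsum_esum: "vsum c o\<^sub>L esum z = esum (\<lambda>e. c (head G e) * z e)"
  unfolding esum_def compose_sum_right
  by (simp add: compose_scaleC_right vsum_bounded vsum_S scaleC_scaleC mult.commute)

lemma S_vsum: "e \<in> arcs G \<Longrightarrow> S e o\<^sub>L vsum c = c (tail G e) *\<^sub>C S e"
  unfolding vsum_def compose_sum_right
  by (simp add: compose_scaleC_right S_bounded S_P sum_scaleC_delta(1) cong: sum.cong)

lemma esum_vsum: "esum z o\<^sub>L vsum c = esum (\<lambda>e. z e * c (tail G e))"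
  unfolding esum_def compose_sum_left compose_scaleC_left
  by (simp add: S_vsum scaleC_scaleC)

lemma adj_S_esum: "e \<in> arcs G \<Longrightarrow> adj (S e) o\<^sub>L esum z = z e *\<^sub>C P (tail G e)"
  unfolding esum_def compose_sum_right
  by (simp add: compose_scaleC_right S_bounded adj_in_bounded_ops S_inner cong: sum.cong)
    (simp add: if_distrib[of "\<lambda>x. _ *\<^sub>C x"] scaleC_zero_right cong: if_cong)

lemma adj_esum_esum:
  "adj (esum y) o\<^sub>L esum z = vsum (\<lambda>v. \<Sum>e\<in>out_arcs G v. cnj (y e) * z e)"
proof -
  have "adj (esum y) = (\<Sum>e\<in>arcs G. cnj (y e) *\<^sub>C adj (S e))"
    unfolding esum_def
    by (subst adj_sum) (auto simp: S_bounded bounded_ops_scaleC adj_scaleC intro!: sum.cong)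
  then have "adj (esum y) o\<^sub>L esum z
      = (\<Sum>e\<in>arcs G. (cnj (y e) * z e) *\<^sub>C P (tail G e))"
    by (simp add: compose_sum_left compose_scaleC_left adj_S_esum scaleC_scaleC)
  also have "\<dots> = (\<Sum>v\<in>verts G. \<Sum>e\<in>{e \<in> arcs G. tail G e = v}. (cnj (y e) * z e) *\<^sub>C P (tail G e))"
    by (rule sum.group[symmetric]) auto
  also have "\<dots> = vsum (\<lambda>v. \<Sum>e\<in>out_arcs G v. cnj (y e) * z e)"
    unfolding vsum_def out_arcs_def
  proof (rule sum.cong)
    fix v
    have "(\<Sum>e\<in>F. c e) *\<^sub>C P v = (\<Sum>e\<in>F. c e *\<^sub>C P v)" for c and F :: "'e set"
      by (induction F rule: infinite_finite_induct) (simp_all add: scaleC_add_left)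
    then show "(\<Sum>e\<in>{e \<in> arcs G. tail G e = v}. (cnj (y e) * z e) *\<^sub>C P (tail G e))
        = (\<Sum>e\<in>{e \<in> arcs G. tail G e = v}. cnj (y e) * z e) *\<^sub>C P v"
      by simp
  qed simp
  finally show ?thesis .
qed

text \<open>\<open>S\<^sub>e\<^sup>* \<xi>\<close> is the coefficient of \<open>\<xi>\<close> at \<open>S\<^sub>e\<close> as an element of the coefficient algebra, so \<open>\<xi>\<close> is
  recovered from its coefficients.\<close>

lemma frame: "(\<Sum>e\<in>arcs G. S e o\<^sub>L (adj (S e) o\<^sub>L esum z)) = esum z"
  by (simp add: adj_S_esum compose_scaleC_right S_bounded S_P cong: sum.cong)
    (simp add: esum_def)

lemma vsum_cong: "(\<And>v. v \<in> verts G \<Longrightarrow> c v = d v) \<Longrightarrow> vsum c = vsum d"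
  by (simp add: vsum_def)

lemma esum_cong: "(\<And>e. e \<in> arcs G \<Longrightarrow> y e = z e) \<Longrightarrow> esum y = esum z"
  by (simp add: esum_def)

lemma S_as_esum: "e \<in> arcs G \<Longrightarrow> S e = esum (\<lambda>f. if f = e then 1 else 0)"
  unfolding esum_def by (simp add: if_distrib[of "\<lambda>c. c *\<^sub>C _"] cong: if_cong)

lemma P_as_vsum: "v \<in> verts G \<Longrightarrow> P v = vsum (\<lambda>w. if w = v then 1 else 0)"
  unfolding vsum_def by (simp add: if_distrib[of "\<lambda>c. c *\<^sub>C _"] cong: if_cong)

end

text \<open>These bounds make the direct sum of all Cuntz-Krieger families, and by linear extension that of
  all covariant representations, consist of bounded operators.\<close>

lemma cuntz_krieger_family_bounds:
  assumes CK: "cuntz_krieger_family G P S" and G: "wf_digraph G"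
  shows "v \<in> verts G \<Longrightarrow> norm (P v) \<le> 1" and "e \<in> arcs G \<Longrightarrow> norm (S e) \<le> 1"
proof -
  have P: "P v \<in> bounded_ops" "P v o\<^sub>L P v = P v" "adj (P v) = P v" if "v \<in> verts G" for v
    using CK that by (simp_all add: cuntz_krieger_family_def)
  show "norm (P v) \<le> 1" if "v \<in> verts G" for v
    using norm_projection_apply(3)[OF P] that by blast
  assume e: "e \<in> arcs G"
  then have "tail G e \<in> verts G" by (rule wf_digraph.tail_in_verts[OF G])
  from partial_isometry(2)[OF _ P[OF this]] show "norm (S e) \<le> 1"
    using CK e by (simp add: cuntz_krieger_family_def)
qed

text \<open>The Cuntz-Krieger relations do not mention \<open>S\<^sub>f\<^sup>* S\<^sub>e\<close> for \<open>f \<noteq> e\<close>. It vanishes for edges into the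
  same vertex because their range projections add up to a projection, and for edges into different
  vertices because the vertex projections are orthogonal.\<close>

lemma cuntz_krieger_graph_family:
  assumes CK: "cuntz_krieger_family G P S" and G: "fin_digraph G"
  shows "graph_family G P S"
proof -
  interpret fin_digraph G by (rule G)
  have P: "P v \<in> bounded_ops" "P v o\<^sub>L P v = P v" "adj (P v) = P v" if "v \<in> verts G" for v
    using CK that by (simp_all add: cuntz_krieger_family_def)
  have P0: "P v o\<^sub>L P w = 0" if "v \<in> verts G" "w \<in> verts G" "v \<noteq> w" for v w
    using CK that by (simp add: cuntz_krieger_family_def)
  have S: "S e \<in> bounded_ops" "adj (S e) o\<^sub>L S e = P (tail G e)" if "e \<in> arcs G" for e
    using CK that by (simp_all add: cuntz_krieger_family_def)
  have sum: "P (head G e) = (\<Sum>f\<in>in_arcs G (head G e). S f o\<^sub>L adj (S f))" if "e \<in> arcs G" for e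
  proof -
    have "e \<in> in_arcs G (head G e)" using that by simp
    then have "in_arcs G (head G e) \<noteq> {}" by blast
    moreover have "head G e \<in> verts G" using that by simp
    ultimately show ?thesis using CK unfolding cuntz_krieger_family_def by blast
  qed
  have fin: "finite (in_arcs G v)" for v by (simp add: in_arcs_def)
  have orth: "P (head G e) o\<^sub>L S e = S e"
    "f \<in> in_arcs G (head G e) \<Longrightarrow> f \<noteq> e \<Longrightarrow> adj (S f) o\<^sub>L S e = 0" if e: "e \<in> arcs G" for e f
    using range_projections_orthogonal[OF fin[of "head G e"], of e S "P (head G e)" "P (tail G e)"]
      e P[of "head G e"] P[of "tail G e"] S sum[OF e] by auto
  have inner: "adj (S f) o\<^sub>L S e = 0" if "e \<in> arcs G" "f \<in> arcs G" "f \<noteq> e" for e f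
  proof (cases "head G f = head G e")
    case True
    then show ?thesis using orth(2)[of e f] that by simp
  next
    case False
    have "adj (S f) = adj (S f) o\<^sub>L P (head G f)"
      using adj_compose[of "P (head G f)" "S f"] orth(1)[OF that(2)] P S that by simp
    then have "adj (S f) o\<^sub>L S e = adj (S f) o\<^sub>L ((P (head G f) o\<^sub>L P (head G e)) o\<^sub>L S e)"
      using orth(1)[OF that(1)] by (metis compose_assoc)
    then show ?thesis using P0[of "head G f" "head G e"] False that by simp
  qed
  show ?thesis
  proof
    fix v e assume ve: "v \<in> verts G" "e \<in> arcs G"
    show "P v o\<^sub>L S e = (if v = head G e then S e else 0)"
    proof (cases "v = head G e")
      case False
      have "P v o\<^sub>L S e = (P v o\<^sub>L P (head G e)) o\<^sub>L S e"
        using orth(1)[OF ve(2)] by (metis compose_assoc)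
      then show ?thesis using False ve P0 by simp
    qed (use ve orth(1) in simp)
  qed (use P P0 S inner in auto)
qed

section \<open>Correspondences with a basis indexed by a graph\<close>

text \<open>With nonzero projections, the \<open>Q v\<close> and the \<open>X e\<close> are bases of a finite-dimensional commutative
  C*-algebra \<open>A\<close> and of a module \<open>E\<close> over it.\<close>

locale graph_correspondence = graph_family G Q X
  for G :: "('v, 'e) pre_digraph" and Q :: "'v \<Rightarrow> 'k op" and X :: "'e \<Rightarrow> 'k op" +
  assumes Q_nonzero: "v \<in> verts G \<Longrightarrow> Q v \<noteq> 0"
begin

abbreviation "A \<equiv> cspan (Q ` verts G)"
abbreviation "E \<equiv> cspan (X ` arcs G)"

lemma A_eq: "A = range vsum"
  unfolding vsum_def[abs_def] by (rule cspan_finite) simp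

lemma E_eq: "E = range esum"
  unfolding esum_def[abs_def] by (rule cspan_finite) simp

lemma vsum_in_A [simp]: "vsum c \<in> A" and esum_in_E [simp]: "esum z \<in> E"
  by (simp_all add: A_eq E_eq)

lemma Q_in_A: "v \<in> verts G \<Longrightarrow> Q v \<in> A" and X_in_E: "e \<in> arcs G \<Longrightarrow> X e \<in> E"
  by (simp_all add: cspan_def hull_inc)

lemma X_nonzero: "e \<in> arcs G \<Longrightarrow> X e \<noteq> 0"
  using S_inner[of e e] Q_nonzero[of "tail G e"] by auto

text \<open>The coordinates with respect to the two bases. They are unique since no \<open>Q v\<close> is zero.\<close>

definition vcoef :: "'k op \<Rightarrow> 'v \<Rightarrow> complex" where
  "vcoef a v = (THE c. a o\<^sub>L Q v = c *\<^sub>C Q v)"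

definition ecoef :: "'k op \<Rightarrow> 'e \<Rightarrow> complex" where
  "ecoef \<xi> e = vcoef (adj (X e) o\<^sub>L \<xi>) (tail G e)"

lemma vcoef_vsum: "v \<in> verts G \<Longrightarrow> vcoef (vsum c) v = c v"
  unfolding vcoef_def using scaleC_eq_cancel[OF _ Q_nonzero]
  by (intro the_equality) (auto simp: vsum_P)

lemma ecoef_esum: "e \<in> arcs G \<Longrightarrow> ecoef (esum z) e = z e"
proof -
  assume e: "e \<in> arcs G"
  have "adj (X e) o\<^sub>L esum z = vsum (\<lambda>v. z e * (if v = tail G e then 1 else 0))"
    using e by (simp add: adj_S_esum P_as_vsum[of "tail G e"] vsum_scaleC)
  then show ?thesis using e by (simp add: ecoef_def vcoef_vsum)
qed

lemma vsum_vcoef: "a \<in> A \<Longrightarrow> vsum (vcoef a) = a"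
  by (auto simp: A_eq intro!: vsum_cong vcoef_vsum)

lemma esum_ecoef: "\<xi> \<in> E \<Longrightarrow> esum (ecoef \<xi>) = \<xi>"
  by (auto simp: E_eq intro!: esum_cong ecoef_esum)

lemma A_E: "a \<in> A \<Longrightarrow> \<xi> \<in> E \<Longrightarrow> a o\<^sub>L \<xi> \<in> E"
  by (auto simp: A_eq E_eq vsum_esum)

lemma E_A: "\<xi> \<in> E \<Longrightarrow> a \<in> A \<Longrightarrow> \<xi> o\<^sub>L a \<in> E"
  by (auto simp: A_eq E_eq esum_vsum)

lemma inner_in_A: "\<xi> \<in> E \<Longrightarrow> \<eta> \<in> E \<Longrightarrow> adj \<xi> o\<^sub>L \<eta> \<in> A"
  by (auto simp: A_eq E_eq adj_esum_esum)

lemma E_sum: "(\<And>i. i \<in> I \<Longrightarrow> f i \<in> E) \<Longrightarrow> (\<Sum>i\<in>I. f i) \<in> E"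
  using csubspace_sum[where c = "\<lambda>_. 1" and V = E and f = f and I = I, OF csubspace_cspan] by simp

lemma frame_E: "\<xi> \<in> E \<Longrightarrow> (\<Sum>e\<in>arcs G. X e o\<^sub>L (adj (X e) o\<^sub>L \<xi>)) = \<xi>"
  by (auto simp: E_eq frame)

text \<open>\<open>A\<close> and \<open>E\<close> are cut out by reconstruction formulas and by the condition that each coefficient lies
  on a line, all of which are closed conditions.\<close>

lemma closed_A: "closed A"
proof -
  let ?C = "{a. a = (\<Sum>v\<in>verts G. a o\<^sub>L Q v)} \<inter>
    (\<Inter>v\<in>verts G. (\<lambda>a. a o\<^sub>L Q v) -` range (\<lambda>c. c *\<^sub>C Q v))"
  have "A = ?C"
  proof
    show "A \<subseteq> ?C" by (auto simp: A_eq vsum_P) (simp add: vsum_def)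
    show "?C \<subseteq> A"
    proof
      fix a assume a: "a \<in> ?C"
      then have "\<forall>v\<in>verts G. \<exists>c. a o\<^sub>L Q v = c *\<^sub>C Q v" by auto
      then obtain c where "\<forall>v\<in>verts G. a o\<^sub>L Q v = c v *\<^sub>C Q v"
        unfolding bchoice_iff by (elim exE)
      moreover have "a = (\<Sum>v\<in>verts G. a o\<^sub>L Q v)" using a by simp
      ultimately have "a = vsum c" by (simp add: vsum_def)
      then show "a \<in> A" by simp
    qed
  qed
  moreover have "closed ?C"
    by (intro closed_Int closed_INT ballI closed_Collect_eq closed_vimage closed_line continuous_intros)
  ultimately show ?thesis by (simp only:)
qed

lemma closed_E: "closed E"
proof -
  let ?C = "{\<xi>. \<xi> = (\<Sum>e\<in>arcs G. X e o\<^sub>L (adj (X e) o\<^sub>L \<xi>))} \<inter>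
    (\<Inter>e\<in>arcs G. (\<lambda>\<xi>. adj (X e) o\<^sub>L \<xi>) -` range (\<lambda>c. c *\<^sub>C Q (tail G e)))"
  have "E = ?C"
  proof
    show "E \<subseteq> ?C"
    proof
      fix \<xi> assume \<xi>: "\<xi> \<in> E"
      then obtain z where "\<xi> = esum z" by (auto simp: E_eq)
      then have *: "adj (X e) o\<^sub>L \<xi> = z e *\<^sub>C Q (tail G e)" if "e \<in> arcs G" for e
        using that by (simp add: adj_S_esum)
      show "\<xi> \<in> ?C"
        by (intro IntI CollectI INT_I vimageI2) (rule frame_E[OF \<xi>, symmetric], use * in auto)
    qed
    show "?C \<subseteq> E"
    proof
      fix \<xi> assume \<xi>: "\<xi> \<in> ?C"
      then have "\<forall>e\<in>arcs G. \<exists>c. adj (X e) o\<^sub>L \<xi> = c *\<^sub>C Q (tail G e)" by auto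
      then obtain z where z: "\<forall>e\<in>arcs G. adj (X e) o\<^sub>L \<xi> = z e *\<^sub>C Q (tail G e)"
        unfolding bchoice_iff by (elim exE)
      have "\<xi> = (\<Sum>e\<in>arcs G. X e o\<^sub>L (adj (X e) o\<^sub>L \<xi>))" using \<xi> by simp
      also have "\<dots> = esum z"
        by (simp add: z compose_scaleC_right S_bounded S_P esum_def cong: sum.cong)
      finally show "\<xi> \<in> E" by simp
    qed
  qed
  moreover have "closed ?C"
    by (intro closed_Int closed_INT ballI closed_Collect_eq closed_vimage closed_line continuous_intros)
  ultimately show ?thesis by (simp only:)
qed

lemma cstar_subalgebra_A: "cstar_subalgebra A"
  unfolding cstar_subalgebra_def
  using closed_A csubspace_cspan[of "Q ` verts G"] by (auto simp: A_eq vsum_bounded vsum_mult vsum_adj)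

subsection \<open>Compact operators\<close>

text \<open>As \<open>E\<close> has a finite frame, every right \<open>A\<close>-linear operator on \<open>E\<close> has finite rank, and
  being compact means no more than being determined \<open>A\<close>-linearly by the values on the frame.\<close>

lemma compact_determined_by_frame:
  assumes k: "k \<in> module_compacts E" and \<xi>: "\<xi> \<in> E"
  shows "k \<xi> = (\<Sum>e\<in>arcs G. k (X e) o\<^sub>L (adj (X e) o\<^sub>L \<xi>))"
proof -
  define C where "C = norm \<xi> + (\<Sum>e\<in>arcs G. norm (X e) * norm (adj (X e) o\<^sub>L \<xi>))"
  define D where "D = k \<xi> - (\<Sum>e\<in>arcs G. k (X e) o\<^sub>L (adj (X e) o\<^sub>L \<xi>))"
  have C0: "0 \<le> C" unfolding C_def by (intro add_nonneg_nonneg sum_nonneg) simp_all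
  have le: "norm D \<le> \<epsilon> * C" if "\<epsilon> > 0" for \<epsilon>
  proof -
    from k[unfolded module_compacts_def mem_Collect_eq, THEN conjunct2, THEN spec, THEN mp, OF that]
    obtain n :: nat and x y where
      app: "\<forall>\<zeta>\<in>E. norm (k \<zeta> - (\<Sum>j<n. rank_one E (x j) (y j) \<zeta>)) \<le> \<epsilon> * norm \<zeta>"
      by (elim exE conjE)
    define r where "r \<zeta> = (\<Sum>j<n. x j o\<^sub>L (adj (y j) o\<^sub>L \<zeta>))" for \<zeta> :: "'k op"
    have kr: "norm (k \<zeta> - r \<zeta>) \<le> \<epsilon> * norm \<zeta>" if "\<zeta> \<in> E" for \<zeta>
      using bspec[OF app that] that by (simp add: r_def rank_one_def module_inner_def)
    have "r \<xi> = (\<Sum>j<n. x j o\<^sub>L (adj (y j) o\<^sub>L (\<Sum>e\<in>arcs G. X e o\<^sub>L (adj (X e) o\<^sub>L \<xi>))))"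
      by (simp add: frame_E[OF \<xi>] r_def)
    also have "\<dots> = (\<Sum>j<n. \<Sum>e\<in>arcs G. (x j o\<^sub>L (adj (y j) o\<^sub>L X e)) o\<^sub>L (adj (X e) o\<^sub>L \<xi>))"
      by (simp add: compose_sum_right compose_assoc)
    also have "\<dots> = (\<Sum>e\<in>arcs G. r (X e) o\<^sub>L (adj (X e) o\<^sub>L \<xi>))"
      unfolding r_def compose_sum_left by (rule sum.swap)
    finally have "D = (k \<xi> - r \<xi>) - (\<Sum>e\<in>arcs G. (k (X e) - r (X e)) o\<^sub>L (adj (X e) o\<^sub>L \<xi>))"
      by (simp add: D_def compose_diff_left sum_subtractf)
    also have "norm \<dots> \<le> norm (k \<xi> - r \<xi>)
        + norm (\<Sum>e\<in>arcs G. (k (X e) - r (X e)) o\<^sub>L (adj (X e) o\<^sub>L \<xi>))"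
      by (rule norm_triangle_ineq4)
    also have "\<dots> \<le> \<epsilon> * norm \<xi> + (\<Sum>e\<in>arcs G. (\<epsilon> * norm (X e)) * norm (adj (X e) o\<^sub>L \<xi>))"
    proof (intro add_mono kr[OF \<xi>] order_trans[OF norm_sum] sum_mono)
      fix e assume e: "e \<in> arcs G"
      show "norm ((k (X e) - r (X e)) o\<^sub>L (adj (X e) o\<^sub>L \<xi>))
          \<le> (\<epsilon> * norm (X e)) * norm (adj (X e) o\<^sub>L \<xi>)"
        by (rule order_trans[OF norm_blinfun_compose])
          (intro mult_right_mono kr X_in_E e norm_ge_zero)
    qed
    also have "\<dots> = \<epsilon> * C" by (simp add: C_def distrib_left sum_distrib_left mult.assoc)
    finally show ?thesis .
  qed
  have small: "norm D \<le> \<delta>" if "\<delta> > 0" for \<delta>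
  proof -
    have "\<delta> / (C + 1) * C \<le> \<delta>"
      using that C0 by (simp add: field_simps)
    then show ?thesis using le[of "\<delta> / (C + 1)"] that C0 by simp
  qed
  have "norm D \<le> 0" by (rule dense_ge) (rule small)
  then show ?thesis by (simp add: D_def)
qed

lemma compactI:
  assumes k: "k \<in> E \<rightarrow>\<^sub>E E"
    and lin: "\<And>\<xi>. \<xi> \<in> E \<Longrightarrow> k \<xi> = (\<Sum>e\<in>arcs G. k (X e) o\<^sub>L (adj (X e) o\<^sub>L \<xi>))"
  shows "k \<in> module_compacts E"
proof -
  obtain h where h: "bij_betw h {0..<card (arcs G)} (arcs G)"
    using ex_bij_betw_nat_finite[of "arcs G"] by auto
  have arc: "h j \<in> arcs G" if "j < card (arcs G)" for j
    using that h by (auto simp: bij_betw_def)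
  have eq: "k \<zeta> = (\<Sum>j<card (arcs G). rank_one E (k (X (h j))) (X (h j)) \<zeta>)" if "\<zeta> \<in> E" for \<zeta>
  proof -
    have "k \<zeta> = (\<Sum>e\<in>arcs G. rank_one E (k (X e)) (X e) \<zeta>)"
      using that by (subst lin) (simp_all add: rank_one_def module_inner_def)
    then show ?thesis
      using sum.reindex_bij_betw[OF h, of "\<lambda>e. rank_one E (k (X e)) (X e) \<zeta>"]
      by (simp add: atLeast0LessThan)
  qed
  have mem: "k (X (h j)) \<in> E \<and> X (h j) \<in> E" if "j < card (arcs G)" for j
    using k arc[OF that] X_in_E by auto
  show ?thesis
    unfolding module_compacts_def mem_Collect_eq
  proof (intro conjI allI impI k exI ballI)
    fix \<epsilon> :: real and \<zeta> assume "\<epsilon> > 0" and \<zeta>: "\<zeta> \<in> E"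
    then show "norm (k \<zeta> - (\<Sum>j<card (arcs G). rank_one E (k (X (h j))) (X (h j)) \<zeta>)) \<le> \<epsilon> * norm \<zeta>"
      unfolding eq[OF \<zeta>, symmetric] by simp
  qed (use mem in simp_all)
qed

lemma finite_rank_compact:
  assumes xy: "\<And>i. i \<in> I \<Longrightarrow> x i \<in> E" "\<And>i. i \<in> I \<Longrightarrow> y i \<in> E"
  shows "(\<lambda>\<zeta>\<in>E. \<Sum>i\<in>I. rank_one E (x i) (y i) \<zeta>) \<in> module_compacts E"
proof (rule compactI)
  show "(\<lambda>\<zeta>\<in>E. \<Sum>i\<in>I. rank_one E (x i) (y i) \<zeta>) \<in> E \<rightarrow>\<^sub>E E"
    using xy by (auto simp: rank_one_def module_inner_def intro!: E_sum E_A inner_in_A)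
  fix \<xi> assume \<xi>: "\<xi> \<in> E"
  have "(\<Sum>i\<in>I. x i o\<^sub>L (adj (y i) o\<^sub>L \<xi>))
      = (\<Sum>i\<in>I. x i o\<^sub>L (adj (y i) o\<^sub>L (\<Sum>e\<in>arcs G. X e o\<^sub>L (adj (X e) o\<^sub>L \<xi>))))"
    by (simp add: frame_E[OF \<xi>])
  also have "\<dots> = (\<Sum>i\<in>I. \<Sum>e\<in>arcs G. (x i o\<^sub>L (adj (y i) o\<^sub>L X e)) o\<^sub>L (adj (X e) o\<^sub>L \<xi>))"
    by (simp add: compose_sum_right compose_assoc)
  also have "\<dots> = (\<Sum>e\<in>arcs G. (\<Sum>i\<in>I. x i o\<^sub>L (adj (y i) o\<^sub>L X e)) o\<^sub>L (adj (X e) o\<^sub>L \<xi>))"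
    unfolding compose_sum_left by (rule sum.swap)
  finally show "(\<lambda>\<zeta>\<in>E. \<Sum>i\<in>I. rank_one E (x i) (y i) \<zeta>) \<xi> = (\<Sum>e\<in>arcs G.
      (\<lambda>\<zeta>\<in>E. \<Sum>i\<in>I. rank_one E (x i) (y i) \<zeta>) (X e) o\<^sub>L (adj (X e) o\<^sub>L \<xi>))"
    using \<xi> by (simp add: rank_one_def module_inner_def X_in_E cong: sum.cong)
qed

lemma compacts_rep_finite_rank:
  assumes \<psi>: "compacts_rep E t \<psi>" and I: "finite I"
    and xy: "\<And>i. i \<in> I \<Longrightarrow> x i \<in> E" "\<And>i. i \<in> I \<Longrightarrow> y i \<in> E"
  shows "\<psi> (\<lambda>\<zeta>\<in>E. \<Sum>i\<in>I. rank_one E (x i) (y i) \<zeta>) = (\<Sum>i\<in>I. t (x i) o\<^sub>L adj (t (y i)))"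
  using I xy
proof (induction I)
  case empty
  have "(\<lambda>\<zeta>\<in>E. 0) \<in> module_compacts E"
    using finite_rank_compact[of "{}"] by simp
  then have "\<psi> (\<lambda>\<xi>\<in>E. 0 *\<^sub>C (\<lambda>\<zeta>\<in>E. 0) \<xi>) = 0 *\<^sub>C \<psi> (\<lambda>\<zeta>\<in>E. 0)"
    using \<psi> unfolding compacts_rep_def Let_def by blast
  moreover have "(\<lambda>\<xi>\<in>E. 0 *\<^sub>C (\<lambda>\<zeta>\<in>E. 0 :: 'k op) \<xi>) = (\<lambda>\<xi>\<in>E. 0)"
    by (rule restrict_ext) simp
  ultimately have "\<psi> (\<lambda>\<xi>\<in>E. 0) = 0" by (simp only: scaleC_zero_left)
  then show ?case by (simp only: sum.empty)
next
  case (insert i I)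
  have mem: "rank_one E (x i) (y i) \<in> module_compacts E"
    using finite_rank_compact[of "{i}" x y] insert.prems
    by (simp add: rank_one_def cong: restrict_cong)
  have mem': "(\<lambda>\<zeta>\<in>E. \<Sum>i\<in>I. rank_one E (x i) (y i) \<zeta>) \<in> module_compacts E"
    using finite_rank_compact[of I x y] insert.prems by simp
  have add: "\<psi> (\<lambda>\<xi>\<in>E. k \<xi> + l \<xi>) = \<psi> k + \<psi> l"
    if "k \<in> module_compacts E" "l \<in> module_compacts E" for k l
    using \<psi> that by (simp add: compacts_rep_def Let_def)
  have "(\<lambda>\<zeta>\<in>E. \<Sum>j\<in>insert i I. rank_one E (x j) (y j) \<zeta>)
      = (\<lambda>\<xi>\<in>E. rank_one E (x i) (y i) \<xi> + (\<lambda>\<zeta>\<in>E. \<Sum>i\<in>I. rank_one E (x i) (y i) \<zeta>) \<xi>)"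
    using insert.hyps by (intro ext) simp
  then have eq: "\<psi> (\<lambda>\<zeta>\<in>E. \<Sum>j\<in>insert i I. rank_one E (x j) (y j) \<zeta>)
      = \<psi> (rank_one E (x i) (y i)) + \<psi> (\<lambda>\<zeta>\<in>E. \<Sum>i\<in>I. rank_one E (x i) (y i) \<zeta>)"
    by (simp only: add[OF mem mem'])
  have one: "\<psi> (rank_one E (x i) (y i)) = t (x i) o\<^sub>L adj (t (y i))"
    using \<psi> insert.prems unfolding compacts_rep_def Let_def by simp
  have IH: "\<psi> (\<lambda>\<zeta>\<in>E. \<Sum>i\<in>I. rank_one E (x i) (y i) \<zeta>) = (\<Sum>i\<in>I. t (x i) o\<^sub>L adj (t (y i)))"
    by (rule insert.IH) (simp_all add: insert.prems)
  show ?case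
    unfolding eq one IH by (simp add: insert.hyps)
qed

lemma left_action_compact:
  assumes a: "a \<in> A"
  shows "left_action E a \<in> module_compacts E"
proof (rule compactI)
  show "left_action E a \<in> E \<rightarrow>\<^sub>E E" using A_E[OF a] by (auto simp: left_action_def)
  fix \<xi> assume \<xi>: "\<xi> \<in> E"
  have "a o\<^sub>L \<xi> = a o\<^sub>L (\<Sum>e\<in>arcs G. X e o\<^sub>L (adj (X e) o\<^sub>L \<xi>))" by (simp add: frame_E[OF \<xi>])
  then show "left_action E a \<xi> = (\<Sum>e\<in>arcs G. left_action E a (X e) o\<^sub>L (adj (X e) o\<^sub>L \<xi>))"
    using \<xi> by (simp add: left_action_def X_in_E compose_sum_right compose_assoc cong: sum.cong)
qed

subsection \<open>Katsura's ideal\<close>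

text \<open>The kernel of the left action is spanned by the \<open>Q v\<close> with \<open>v\<close> a vertex receiving no edge, so
  that Katsura's ideal is spanned by the other ones.\<close>

lemma Q_in_katsura_ideal:
  assumes v: "v \<in> verts G" and e: "in_arcs G v \<noteq> {}"
  shows "Q v \<in> katsura_ideal A E"
  unfolding katsura_ideal_def
proof (intro CollectI conjI ballI Q_in_A left_action_compact v)
  fix b assume b: "b \<in> action_kernel A E"
  then obtain c where c: "b = vsum c" by (auto simp: action_kernel_def A_eq)
  from e obtain e where "e \<in> in_arcs G v" by blast
  then have e: "e \<in> arcs G" "head G e = v" by simp_all
  have "c v *\<^sub>C X e = 0"
    using b e X_in_E by (auto simp: action_kernel_def c vsum_S[symmetric])
  then have "c v = 0" using X_nonzero[OF e(1)] scaleC_eq_cancel[of "c v" "X e" 0] by simp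
  then show "Q v o\<^sub>L b = 0" using v by (simp add: c P_vsum)
qed

lemma katsura_ideal_vcoef:
  assumes a: "a \<in> katsura_ideal A E" and v: "v \<in> verts G" "in_arcs G v = {}"
  shows "vcoef a v = 0"
proof -
  obtain c where c: "a = vsum c" using a by (auto simp: katsura_ideal_def A_eq)
  have "Q v o\<^sub>L esum z = 0" for z
    using v by (auto simp: esum_def compose_sum_right compose_scaleC_right P_bounded P_S
        scaleC_zero_right intro!: sum.neutral)
  then have "Q v \<in> action_kernel A E"
    using v by (auto simp: action_kernel_def Q_in_A E_eq)
  then have "c v *\<^sub>C Q v = 0 *\<^sub>C Q v"
    using a v by (simp add: katsura_ideal_def c vsum_P[symmetric])
  then have "c v = 0" using Q_nonzero[OF v(1)] by (rule scaleC_eq_cancel)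
  then show ?thesis using v by (simp add: c vcoef_vsum)
qed

subsection \<open>Representations\<close>

text \<open>Covariance turns the frame identity \<open>\<phi>(Q v) = \<Sum>\<^sub>e \<Theta>\<^bsub>X e, X e\<^esub>\<close>, the sum being over the edges
  into \<open>v\<close>, into the Cuntz-Krieger relation at \<open>v\<close>.\<close>

lemma covariant_rep_cuntz_krieger:
  assumes rep: "covariant_rep A E \<pi> t"
    and P: "\<And>v. v \<in> verts G \<Longrightarrow> P v = \<pi> (Q v)" and S: "\<And>e. e \<in> arcs G \<Longrightarrow> S e = t (X e)"
  shows "cuntz_krieger_family G P S"
proof -
  have \<pi>: "star_hom A bounded_ops \<pi>"
    and t: "t ` E \<subseteq> bounded_ops"
    and inner: "\<And>\<xi> \<eta>. \<xi> \<in> E \<Longrightarrow> \<eta> \<in> E \<Longrightarrow> adj (t \<xi>) o\<^sub>L t \<eta> = \<pi> (module_inner \<xi> \<eta>)"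
    using rep by (simp_all add: covariant_rep_def correspondence_rep_def)
  obtain \<psi> where \<psi>: "compacts_rep E t \<psi>"
    and cov: "\<And>a. a \<in> katsura_ideal A E \<Longrightarrow> \<pi> a = \<psi> (left_action E a)"
    using rep by (auto simp: covariant_rep_def)
  have mult: "\<pi> (a o\<^sub>L b) = \<pi> a o\<^sub>L \<pi> b" if "a \<in> A" "b \<in> A" for a b
    using \<pi> that by (simp add: star_hom_def)
  have adj: "\<pi> (adj a) = adj (\<pi> a)" and bdd: "\<pi> a \<in> bounded_ops" if "a \<in> A" for a
    using \<pi> that by (auto simp: star_hom_def)
  have zero: "\<pi> 0 = 0"
  proof -
    have "0 \<in> A" using csubspace_cspan[of "Q ` verts G"] by (simp add: csubspace_def)
    then have "\<pi> (0 *\<^sub>C 0) = 0 *\<^sub>C \<pi> 0" using \<pi> unfolding star_hom_def by blast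
    then show ?thesis by simp
  qed
  show ?thesis
    unfolding cuntz_krieger_family_def
  proof (intro conjI ballI impI)
    fix v assume v: "v \<in> verts G"
    show "P v \<in> bounded_ops" using v by (simp add: P bdd Q_in_A)
    show "P v o\<^sub>L P v = P v"
      using v mult[of "Q v" "Q v"] by (simp add: P Q_in_A P_mult)
    show "adj (P v) = P v" using v adj[of "Q v"] by (simp add: P Q_in_A P_adj)
    show "P v o\<^sub>L P w = 0" if "w \<in> verts G" "v \<noteq> w" for w
      using v that mult[of "Q v" "Q w"] by (simp add: P Q_in_A P_mult zero)
  next
    fix e assume e: "e \<in> arcs G"
    show "S e \<in> bounded_ops" using t e X_in_E by (auto simp: S)
    show "adj (S e) o\<^sub>L S e = P (tail G e)"
      using e inner[of "X e" "X e"] by (simp add: S P X_in_E module_inner_def S_inner)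
  next
    fix v assume v: "v \<in> verts G" "in_arcs G v \<noteq> {}"
    have "left_action E (Q v) = (\<lambda>\<zeta>\<in>E. \<Sum>e\<in>in_arcs G v. rank_one E (X e) (X e) \<zeta>)"
      unfolding left_action_def
    proof (rule restrict_ext)
      fix \<zeta> assume \<zeta>: "\<zeta> \<in> E"
      have "Q v o\<^sub>L \<zeta> = (\<Sum>e\<in>arcs G. (Q v o\<^sub>L X e) o\<^sub>L (adj (X e) o\<^sub>L \<zeta>))"
        by (subst frame_E[OF \<zeta>, symmetric]) (simp add: compose_sum_right compose_assoc)
      also have "\<dots> = (\<Sum>e\<in>in_arcs G v. X e o\<^sub>L (adj (X e) o\<^sub>L \<zeta>))"
        using v(1) by (intro sum.mono_neutral_cong_right) (auto simp: P_S)
      finally show "Q v o\<^sub>L \<zeta> = (\<Sum>e\<in>in_arcs G v. rank_one E (X e) (X e) \<zeta>)"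
        using \<zeta> by (simp add: rank_one_def module_inner_def)
    qed
    then have "\<pi> (Q v) = (\<Sum>e\<in>in_arcs G v. t (X e) o\<^sub>L adj (t (X e)))"
      using cov[OF Q_in_katsura_ideal[OF v]] compacts_rep_finite_rank[OF \<psi>, of "in_arcs G v" X X]
      by (simp add: X_in_E in_arcs_def)
    then show "P v = (\<Sum>e\<in>in_arcs G v. S e o\<^sub>L adj (S e))"
      unfolding P[OF v(1)] by (auto intro!: sum.cong simp: S)
  qed
qed

text \<open>Conversely a Cuntz-Krieger family extends linearly. The homomorphism \<open>\<psi>\<close> on the compacts is
  \<open>k \<mapsto> \<Sum>\<^sub>e t(k X\<^sub>e) t(X\<^sub>e)\<^sup>*\<close>, forced by \<open>k = \<Sum>\<^sub>e \<Theta>\<^bsub>k X e, X e\<^esub>\<close>; all its properties come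
  from \<open>\<psi>(k) t(\<xi>) = t(k \<xi>)\<close>.\<close>

lemma cuntz_krieger_covariant_rep:
  assumes CK: "cuntz_krieger_family G P S"
    and \<pi>: "\<And>a. a \<in> A \<Longrightarrow> \<pi> a = (\<Sum>v\<in>verts G. vcoef a v *\<^sub>C P v)"
    and t: "\<And>\<xi>. \<xi> \<in> E \<Longrightarrow> t \<xi> = (\<Sum>e\<in>arcs G. ecoef \<xi> e *\<^sub>C S e)"
  shows "covariant_rep A E \<pi> t"
proof -
  interpret F: graph_family G P S
    by (rule cuntz_krieger_graph_family[OF CK]) unfold_locales
  have \<pi>v: "\<pi> (vsum c) = F.vsum c" for c
    unfolding \<pi>[OF vsum_in_A] F.vsum_def[symmetric] by (intro F.vsum_cong vcoef_vsum)
  have te: "t (esum z) = F.esum z" for z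
    unfolding t[OF esum_in_E] F.esum_def[symmetric] by (intro F.esum_cong ecoef_esum)
  have tX: "t (X e) = S e" if "e \<in> arcs G" for e
    by (metis te S_as_esum[OF that] F.S_as_esum[OF that])
  have tb: "t \<xi> \<in> bounded_ops" if "\<xi> \<in> E" for \<xi>
    using that by (auto simp: E_eq te F.esum_bounded)
  have inner: "adj (t \<xi>) o\<^sub>L t \<eta> = \<pi> (adj \<xi> o\<^sub>L \<eta>)" if "\<xi> \<in> E" "\<eta> \<in> E" for \<xi> \<eta>
    using that by (auto simp: E_eq te \<pi>v adj_esum_esum F.adj_esum_esum)
  have t\<pi>: "t (\<xi> o\<^sub>L a) = t \<xi> o\<^sub>L \<pi> a" if "\<xi> \<in> E" "a \<in> A" for \<xi> a
    using that by (auto simp: E_eq A_eq te \<pi>v esum_vsum F.esum_vsum)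
  have \<pi>t: "\<pi> a o\<^sub>L t \<xi> = t (a o\<^sub>L \<xi>)" if "\<xi> \<in> E" "a \<in> A" for \<xi> a
    using that by (auto simp: E_eq A_eq te \<pi>v vsum_esum F.vsum_esum)
  have t_add: "t (\<xi> + \<eta>) = t \<xi> + t \<eta>" if "\<xi> \<in> E" "\<eta> \<in> E" for \<xi> \<eta>
    using that by (auto simp: E_eq te esum_add F.esum_add)
  have t_scale: "t (c *\<^sub>C \<xi>) = c *\<^sub>C t \<xi>" if "\<xi> \<in> E" for c \<xi>
    using that by (auto simp: E_eq te esum_scaleC F.esum_scaleC)
  have t_sum: "t (\<Sum>i\<in>I. f i) = (\<Sum>i\<in>I. t (f i))" if "\<And>i. i \<in> I \<Longrightarrow> f i \<in> E" for f and I :: "'e set"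
    using linear_on_sum[where V = E and f = t and b = f and I = I and c = "\<lambda>_. 1",
        OF csubspace_cspan t_add t_scale that] by simp
  have corr: "correspondence_rep A E \<pi> t"
    unfolding correspondence_rep_def star_hom_def module_inner_def left_action_def
    using t_add t_scale inner \<pi>t tb
    by (auto simp: A_eq \<pi>v F.vsum_bounded vsum_add F.vsum_add vsum_scaleC F.vsum_scaleC
        vsum_mult F.vsum_mult vsum_adj F.vsum_adj)
  have t_frame: "(\<Sum>e\<in>arcs G. S e o\<^sub>L (adj (S e) o\<^sub>L t \<xi>)) = t \<xi>" if "\<xi> \<in> E" for \<xi>
    using that by (auto simp: E_eq te F.frame)
  \<comment> \<open>a unit for the image of \<open>t\<close>\<close>
  define N where "N = (\<Sum>e\<in>arcs G. S e o\<^sub>L adj (S e))"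
  have Nt: "N o\<^sub>L t \<xi> = t \<xi>" if "\<xi> \<in> E" for \<xi>
    using t_frame[OF that] by (simp add: N_def compose_sum_left compose_assoc)
  have Nb: "N \<in> bounded_ops"
    unfolding N_def by (intro bounded_ops_sum bounded_ops_compose F.S_bounded adj_in_bounded_ops)
  have "adj N = N"
    unfolding N_def
    by (subst adj_sum)
      (auto simp: bounded_ops_compose F.S_bounded adj_in_bounded_ops adj_compose adj_adj
        intro!: sum.cong)
  then have tN: "adj (t \<xi>) o\<^sub>L N = adj (t \<xi>)" if "\<xi> \<in> E" for \<xi>
    using adj_compose[OF Nb tb[OF that]] Nt[OF that] by simp
  define \<psi> where "\<psi> k = (\<Sum>e\<in>arcs G. t (k (X e)) o\<^sub>L adj (S e))" for k
  have kE: "k \<xi> \<in> E" if "k \<in> module_compacts E" "\<xi> \<in> E" for k \<xi>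
    using that by (auto simp: module_compacts_def)
  have \<psi>t: "\<psi> k o\<^sub>L t \<xi> = t (k \<xi>)" if k: "k \<in> module_compacts E" and \<xi>: "\<xi> \<in> E" for k \<xi>
  proof -
    have "t (k \<xi>) = (\<Sum>e\<in>arcs G. t (k (X e) o\<^sub>L (adj (X e) o\<^sub>L \<xi>)))"
      by (subst compact_determined_by_frame[OF k \<xi>], rule t_sum)
        (intro E_A kE[OF k] X_in_E inner_in_A \<xi>)
    also have "\<dots> = (\<Sum>e\<in>arcs G. t (k (X e)) o\<^sub>L (adj (S e) o\<^sub>L t \<xi>))"
      using inner[OF X_in_E \<xi>]
      by (intro sum.cong refl) (simp add: t\<pi> kE[OF k] X_in_E inner_in_A \<xi> tX)
    finally show ?thesis by (simp add: \<psi>_def compose_sum_left compose_assoc)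
  qed
  have "compacts_rep E t \<psi>"
    unfolding compacts_rep_def Let_def
  proof (intro conjI ballI allI impI)
    show "\<psi> ` module_compacts E \<subseteq> bounded_ops"
    proof clarify
      fix k assume k: "k \<in> module_compacts E"
      show "\<psi> k \<in> bounded_ops"
        unfolding \<psi>_def
        by (intro bounded_ops_sum bounded_ops_compose tb kE[OF k] X_in_E adj_in_bounded_ops
            F.S_bounded)
    qed
  next
    fix k l assume kl: "k \<in> module_compacts E" "l \<in> module_compacts E"
    note kE = kE[OF kl(1)] kE[OF kl(2)]
    note \<psi>t = \<psi>t[OF kl(1)]
    show "\<psi> (\<lambda>\<xi>\<in>E. k \<xi> + l \<xi>) = \<psi> k + \<psi> l"
      by (simp add: \<psi>_def X_in_E t_add kE compose_add_left sum.distrib cong: sum.cong)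
    show "\<psi> (\<lambda>\<xi>\<in>E. k (l \<xi>)) = \<psi> k o\<^sub>L \<psi> l"
      by (simp add: \<psi>_def[of l] \<psi>_def[of "\<lambda>\<xi>\<in>E. k (l \<xi>)"] X_in_E kE compose_sum_right
          compose_assoc[symmetric] \<psi>t cong: sum.cong)
    assume adj: "module_adjoints E k l"
    \<comment> \<open>both sides equal \<open>\<Sum>\<^sub>e S\<^sub>e t(k X\<^sub>e)\<^sup>*\<close>\<close>
    have tk: "adj (t (k (X e))) o\<^sub>L N = adj (t (k (X e)))" if "e \<in> arcs G" for e
      by (rule tN[OF kE(1)[OF X_in_E[OF that]]])
    have "t (l (X f)) = (\<Sum>e\<in>arcs G. S e o\<^sub>L (adj (t (k (X e))) o\<^sub>L S f))" if f: "f \<in> arcs G" for f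
    proof -
      have "t (l (X f)) = (\<Sum>e\<in>arcs G. S e o\<^sub>L (adj (S e) o\<^sub>L t (l (X f))))"
        using t_frame[OF kE(2)[OF X_in_E[OF f]]] by simp
      also have "\<dots> = (\<Sum>e\<in>arcs G. S e o\<^sub>L (adj (t (k (X e))) o\<^sub>L S f))"
      proof (intro sum.cong refl)
        fix e assume e: "e \<in> arcs G"
        have "adj (X e) o\<^sub>L l (X f) = adj (k (X e)) o\<^sub>L X f"
          using adj X_in_E e f by (simp add: module_adjoints_def module_inner_def)
        then have "adj (S e) o\<^sub>L t (l (X f)) = adj (t (k (X e))) o\<^sub>L S f"
          using inner[of "X e" "l (X f)"] inner[of "k (X e)" "X f"] e f kE X_in_E
          by (simp add: tX)
        then show "S e o\<^sub>L (adj (S e) o\<^sub>L t (l (X f))) = S e o\<^sub>L (adj (t (k (X e))) o\<^sub>L S f)"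
          by simp
      qed
      finally show ?thesis .
    qed
    then have "\<psi> l = (\<Sum>f\<in>arcs G. \<Sum>e\<in>arcs G. S e o\<^sub>L (adj (t (k (X e))) o\<^sub>L (S f o\<^sub>L adj (S f))))"
      by (simp add: \<psi>_def compose_sum_left compose_assoc cong: sum.cong)
    also have "\<dots> = (\<Sum>e\<in>arcs G. S e o\<^sub>L (adj (t (k (X e))) o\<^sub>L N))"
      by (subst sum.swap) (simp add: N_def compose_sum_right)
    also have "\<dots> = (\<Sum>e\<in>arcs G. S e o\<^sub>L adj (t (k (X e))))"
      by (simp add: tk cong: sum.cong)
    also have "\<dots> = adj (\<psi> k)"
      unfolding \<psi>_def
      by (subst adj_sum)
        (auto simp: bounded_ops_compose F.S_bounded adj_in_bounded_ops adj_compose adj_adj tb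
          kE X_in_E intro!: sum.cong)
    finally show "\<psi> l = adj (\<psi> k)" .
  next
    fix c k assume k: "k \<in> module_compacts E"
    note kE = kE[OF k]
    show "\<psi> (\<lambda>\<xi>\<in>E. c *\<^sub>C k \<xi>) = c *\<^sub>C \<psi> k"
      by (simp add: \<psi>_def X_in_E t_scale kE compose_scaleC_left scaleC_sum_right cong: sum.cong)
  next
    fix \<xi> \<eta> assume \<xi>: "\<xi> \<in> E" and \<eta>: "\<eta> \<in> E"
    have "\<psi> (rank_one E \<xi> \<eta>) = (\<Sum>e\<in>arcs G. t \<xi> o\<^sub>L (adj (t \<eta>) o\<^sub>L (S e o\<^sub>L adj (S e))))"
      unfolding \<psi>_def
    proof (intro sum.cong refl)
      fix e assume e: "e \<in> arcs G"
      have "t (rank_one E \<xi> \<eta> (X e)) = t \<xi> o\<^sub>L (adj (t \<eta>) o\<^sub>L S e)"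
        using inner[OF \<eta> X_in_E[OF e]] X_in_E[OF e] \<xi> \<eta>
        by (simp add: rank_one_def module_inner_def t\<pi> inner_in_A tX e)
      then show "t (rank_one E \<xi> \<eta> (X e)) o\<^sub>L adj (S e)
          = t \<xi> o\<^sub>L (adj (t \<eta>) o\<^sub>L (S e o\<^sub>L adj (S e)))"
        by (simp add: compose_assoc)
    qed
    also have "\<dots> = t \<xi> o\<^sub>L (adj (t \<eta>) o\<^sub>L N)" by (simp add: N_def compose_sum_right)
    finally show "\<psi> (rank_one E \<xi> \<eta>) = t \<xi> o\<^sub>L adj (t \<eta>)" by (simp add: tN \<eta>)
  qed
  moreover have "\<pi> a = \<psi> (left_action E a)" if a: "a \<in> katsura_ideal A E" for a
  proof -
    have aA: "a \<in> A" using a by (simp add: katsura_ideal_def)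
    have "t (left_action E a (X e)) = vcoef a (head G e) *\<^sub>C S e" if "e \<in> arcs G" for e
    proof -
      have "a o\<^sub>L X e = vcoef a (head G e) *\<^sub>C X e"
        using vsum_S[OF that, of "vcoef a"] by (simp add: vsum_vcoef[OF aA])
      then show ?thesis using that X_in_E by (simp add: left_action_def t_scale tX)
    qed
    then have "\<psi> (left_action E a) = (\<Sum>e\<in>arcs G. vcoef a (head G e) *\<^sub>C (S e o\<^sub>L adj (S e)))"
      by (simp add: \<psi>_def compose_scaleC_left cong: sum.cong)
    also have "\<dots> = (\<Sum>v\<in>verts G. \<Sum>e\<in>{e \<in> arcs G. head G e = v}.
        vcoef a (head G e) *\<^sub>C (S e o\<^sub>L adj (S e)))"
      by (rule sum.group[symmetric]) auto
    also have "\<dots> = (\<Sum>v\<in>verts G. vcoef a v *\<^sub>C P v)"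
    proof (intro sum.cong refl)
      fix v assume v: "v \<in> verts G"
      have "(\<Sum>e\<in>{e \<in> arcs G. head G e = v}. vcoef a (head G e) *\<^sub>C (S e o\<^sub>L adj (S e)))
          = vcoef a v *\<^sub>C (\<Sum>e\<in>in_arcs G v. S e o\<^sub>L adj (S e))"
        by (simp add: scaleC_sum_right in_arcs_def)
      also have "\<dots> = vcoef a v *\<^sub>C P v"
        using CK v katsura_ideal_vcoef[OF a v]
        by (cases "in_arcs G v = {}") (auto simp: cuntz_krieger_family_def)
      finally show "(\<Sum>e\<in>{e \<in> arcs G. head G e = v}. vcoef a (head G e) *\<^sub>C (S e o\<^sub>L adj (S e)))
          = vcoef a v *\<^sub>C P v" .
    qed
    finally show ?thesis by (simp add: \<pi>[OF aA])
  qed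
  ultimately show ?thesis using corr unfolding covariant_rep_def by blast
qed

lemma covariant_rep_expand:
  assumes "covariant_rep A E \<pi> t"
  shows "a \<in> A \<Longrightarrow> (\<Sum>v\<in>verts G. vcoef a v *\<^sub>C \<pi> (Q v)) = \<pi> a"
    and "\<xi> \<in> E \<Longrightarrow> (\<Sum>e\<in>arcs G. ecoef \<xi> e *\<^sub>C t (X e)) = t \<xi>"
proof -
  have "star_hom A bounded_ops \<pi>"
    and "\<And>\<xi> \<eta>. \<xi> \<in> E \<Longrightarrow> \<eta> \<in> E \<Longrightarrow> t (\<xi> + \<eta>) = t \<xi> + t \<eta>"
    and "\<And>c \<xi>. \<xi> \<in> E \<Longrightarrow> t (c *\<^sub>C \<xi>) = c *\<^sub>C t \<xi>"
    using assms by (simp_all add: covariant_rep_def correspondence_rep_def)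
  note t = this(2,3) and \<pi> = this(1)[unfolded star_hom_def]
  show "(\<Sum>v\<in>verts G. vcoef a v *\<^sub>C \<pi> (Q v)) = \<pi> a" if "a \<in> A"
    using linear_on_sum[where V = A and f = \<pi> and b = Q and I = "verts G" and c = "vcoef a",
        OF csubspace_cspan] \<pi> Q_in_A vsum_vcoef[OF that]
    by (simp add: vsum_def)
  show "(\<Sum>e\<in>arcs G. ecoef \<xi> e *\<^sub>C t (X e)) = t \<xi>" if "\<xi> \<in> E"
    using linear_on_sum[where V = E and f = t and b = X and I = "arcs G" and c = "ecoef \<xi>",
        OF csubspace_cspan t X_in_E] esum_ecoef[OF that]
    by (simp add: esum_def)
qed

text \<open>The graph algebra is the Cuntz-Pimsner algebra of the correspondence of the graph: below,
  \<open>\<Phi>\<close> restricts a covariant representation to the bases and \<open>\<Psi>\<close> extends a Cuntz-Krieger family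
  linearly.\<close>

theorem cuntz_pimsner_isomorphic_graph_cstar:
  "star_isomorphic
    (cuntz_pimsner A E :: (('k op + 'k op \<Rightarrow> 'h::infinite op) \<times> 'h) op set)
    (graph_cstar G :: (('v + 'e \<Rightarrow> 'h op) \<times> 'h) op set)"
proof -
  let ?R1 = "\<lambda>\<rho> :: 'k op + 'k op \<Rightarrow> 'h op. covariant_rep A E (\<rho> \<circ> Inl) (\<rho> \<circ> Inr)"
  let ?R2 = "\<lambda>\<rho> :: 'v + 'e \<Rightarrow> 'h op. cuntz_krieger_family G (\<rho> \<circ> Inl) (\<rho> \<circ> Inr)"
  define \<Phi> where "\<Phi> \<rho> = restrict (case_sum (\<lambda>v. \<rho> (Inl (Q v))) (\<lambda>e. \<rho> (Inr (X e)))) (verts G <+> arcs G)"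
    for \<rho> :: "'k op + 'k op \<Rightarrow> 'h op"
  define \<Psi> where "\<Psi> \<sigma> = restrict (case_sum (\<lambda>a. \<Sum>v\<in>verts G. vcoef a v *\<^sub>C \<sigma> (Inl v))
      (\<lambda>\<xi>. \<Sum>e\<in>arcs G. ecoef \<xi> e *\<^sub>C \<sigma> (Inr e))) (A <+> E)" for \<sigma> :: "'v + 'e \<Rightarrow> 'h op"
  have \<Phi>_Inl: "\<Phi> \<rho> (Inl v) = \<rho> (Inl (Q v))" if "v \<in> verts G" for \<rho> v
    using that by (auto simp: \<Phi>_def)
  have \<Phi>_Inr: "\<Phi> \<rho> (Inr e) = \<rho> (Inr (X e))" if "e \<in> arcs G" for \<rho> e
    using that by (auto simp: \<Phi>_def)
  have \<Psi>_Inl: "\<Psi> \<sigma> (Inl a) = (\<Sum>v\<in>verts G. vcoef a v *\<^sub>C \<sigma> (Inl v))" if "a \<in> A" for \<sigma> a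
    using that by (auto simp: \<Psi>_def)
  have \<Psi>_Inr: "\<Psi> \<sigma> (Inr \<xi>) = (\<Sum>e\<in>arcs G. ecoef \<xi> e *\<^sub>C \<sigma> (Inr e))" if "\<xi> \<in> E" for \<sigma> \<xi>
    using that by (auto simp: \<Psi>_def)
  let ?I = "representations (A <+> E) ?R1" and ?J = "representations (verts G <+> arcs G) ?R2"
  have \<Phi>: "\<Phi> \<rho> \<in> ?J" if \<rho>: "\<rho> \<in> ?I" for \<rho>
  proof -
    have "\<Phi> \<rho> \<in> verts G <+> arcs G \<rightarrow>\<^sub>E bounded_ops"
      using \<rho> Q_in_A X_in_E by (auto simp: representations_def \<Phi>_def)
    moreover have "?R2 (\<Phi> \<rho>)"
      using \<rho> by (intro covariant_rep_cuntz_krieger[of "\<rho> \<circ> Inl" "\<rho> \<circ> Inr"])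
        (auto simp: representations_def \<Phi>_Inl \<Phi>_Inr)
    ultimately show ?thesis by (simp add: representations_def)
  qed
  have \<Psi>: "\<Psi> \<sigma> \<in> ?I" if \<sigma>: "\<sigma> \<in> ?J" for \<sigma>
  proof -
    have "\<sigma> (Inl v) \<in> bounded_ops" if "v \<in> verts G" for v
      using \<sigma> that by (auto simp: representations_def)
    moreover have "\<sigma> (Inr e) \<in> bounded_ops" if "e \<in> arcs G" for e
      using \<sigma> that by (auto simp: representations_def)
    ultimately have "\<Psi> \<sigma> \<in> A <+> E \<rightarrow>\<^sub>E bounded_ops"
      by (auto simp: \<Psi>_def intro!: bounded_ops_sum bounded_ops_scaleC)
    moreover have "?R1 (\<Psi> \<sigma>)"
      using \<sigma> by (intro cuntz_krieger_covariant_rep[of "\<sigma> \<circ> Inl" "\<sigma> \<circ> Inr"])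
        (auto simp: representations_def \<Psi>_Inl \<Psi>_Inr)
    ultimately show ?thesis by (simp add: representations_def)
  qed
  have \<Psi>\<Phi>: "\<Psi> (\<Phi> \<rho>) = \<rho>" if \<rho>: "\<rho> \<in> ?I" for \<rho>
  proof
    fix g
    have "?R1 \<rho>" using \<rho> by (simp add: representations_def)
    note ex = covariant_rep_expand[OF this]
    show "\<Psi> (\<Phi> \<rho>) g = \<rho> g"
    proof (cases "g \<in> A <+> E")
      case True
      then show ?thesis
        using ex by (auto simp: \<Psi>_Inl \<Psi>_Inr \<Phi>_Inl \<Phi>_Inr cong: sum.cong)
    next
      case False
      then show ?thesis using \<rho> by (auto simp: \<Psi>_def representations_def PiE_arb[of \<rho>])
    qed
  qed
  have \<Phi>\<Psi>: "\<Phi> (\<Psi> \<sigma>) = \<sigma>" if \<sigma>: "\<sigma> \<in> ?J" for \<sigma>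
  proof
    fix g
    have Qc: "vcoef (Q v) w = (if w = v then 1 else 0)" if "v \<in> verts G" "w \<in> verts G" for v w
      using that by (simp add: P_as_vsum[of v] vcoef_vsum)
    have Xc: "ecoef (X e) f = (if f = e then 1 else 0)" if "e \<in> arcs G" "f \<in> arcs G" for e f
      using that by (simp add: S_as_esum[of e] ecoef_esum)
    show "\<Phi> (\<Psi> \<sigma>) g = \<sigma> g"
    proof (cases "g \<in> verts G <+> arcs G")
      case True
      then show ?thesis
        by (auto simp: \<Psi>_Inl \<Psi>_Inr \<Phi>_Inl \<Phi>_Inr Q_in_A X_in_E Qc Xc
            if_distrib[of "\<lambda>c. c *\<^sub>C _"] cong: sum.cong if_cong)
    next
      case False
      then show ?thesis using \<sigma> by (auto simp: \<Phi>_def representations_def PiE_arb[of \<sigma>])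
    qed
  qed
  have bound: "norm (\<sigma> h) \<le> 1" if \<sigma>: "\<sigma> \<in> ?J" and h: "h \<in> verts G <+> arcs G" for \<sigma> h
    using cuntz_krieger_family_bounds[of G "\<sigma> \<circ> Inl" "\<sigma> \<circ> Inr"] h \<sigma> wf_digraph
    by (auto simp: representations_def)
  have comb: "\<exists>F c. F \<subseteq> verts G <+> arcs G \<and> (\<forall>\<rho>\<in>?I. \<rho> g = (\<Sum>h\<in>F. c h *\<^sub>C \<Phi> \<rho> h))"
    if g: "g \<in> A <+> E" for g
    using g
  proof (rule PlusE)
    fix a assume a: "a \<in> A" "g = Inl a"
    have "\<rho> g = (\<Sum>h\<in>Inl ` verts G. vcoef a (projl h) *\<^sub>C \<Phi> \<rho> h)" if "\<rho> \<in> ?I" for \<rho>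
      using fun_cong[OF \<Psi>\<Phi>[OF that], of g] a by (simp add: \<Psi>_Inl sum.reindex)
    moreover have "Inl ` verts G \<subseteq> verts G <+> arcs G" by auto
    ultimately show ?thesis by (intro exI conjI ballI)
  next
    fix \<xi> assume \<xi>: "\<xi> \<in> E" "g = Inr \<xi>"
    have "\<rho> g = (\<Sum>h\<in>Inr ` arcs G. ecoef \<xi> (projr h) *\<^sub>C \<Phi> \<rho> h)" if "\<rho> \<in> ?I" for \<rho>
      using fun_cong[OF \<Psi>\<Phi>[OF that], of g] \<xi> by (simp add: \<Psi>_Inr sum.reindex)
    moreover have "Inr ` arcs G \<subseteq> verts G <+> arcs G" by auto
    ultimately show ?thesis by (intro exI conjI ballI)
  qed
  have bound1: "\<exists>M. \<forall>\<rho>\<in>?I. norm (\<rho> g) \<le> M" if gen: "g \<in> A <+> E" for g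
  proof -
    obtain F and c :: "'v + 'e \<Rightarrow> complex" where F: "F \<subseteq> verts G <+> arcs G"
      and g: "\<forall>\<rho>\<in>?I. \<rho> g = (\<Sum>h\<in>F. c h *\<^sub>C \<Phi> \<rho> h)"
      using comb[OF gen] by (elim exE conjE)
    have "norm (\<rho> g) \<le> (\<Sum>h\<in>F. cmod (c h))" if \<rho>: "\<rho> \<in> ?I" for \<rho>
    proof -
      have "norm (c h *\<^sub>C \<Phi> \<rho> h) \<le> cmod (c h)" if "h \<in> F" for h
        using bound[OF \<Phi>[OF \<rho>], of h] F that mult_left_mono[of "norm (\<Phi> \<rho> h)" 1 "cmod (c h)"]
        by (auto simp: norm_scaleC)
      then have "norm (\<Sum>h\<in>F. c h *\<^sub>C \<Phi> \<rho> h) \<le> (\<Sum>h\<in>F. cmod (c h))"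
        by (rule sum_norm_le)
      then show ?thesis using bspec[OF g \<rho>] by simp
    qed
    then show ?thesis by (intro exI ballI)
  qed
  show ?thesis
    unfolding cuntz_pimsner_def graph_cstar_def
  proof (rule universal_cstar_isomorphic[where \<Phi> = \<Phi>])
    show "bij_betw \<Phi> ?I ?J"
      by (rule bij_betw_byWitness[where f' = \<Psi>]) (use \<Phi> \<Psi> \<Phi>\<Psi> \<Psi>\<Phi> in auto)
    show "\<exists>M. \<forall>\<sigma>\<in>?J. norm (\<sigma> h) \<le> M" if "h \<in> verts G <+> arcs G" for h
      using bound that by (intro exI ballI)
    fix h assume h: "h \<in> verts G <+> arcs G"
    show "\<exists>g\<in>A <+> E. \<forall>\<rho>\<in>?I. \<Phi> \<rho> h = \<rho> g"
      using h
    proof (rule PlusE)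
      fix v assume "v \<in> verts G" "h = Inl v"
      then show ?thesis
        by (intro bexI[of _ "Inl (Q v)"] ballI) (auto simp: \<Phi>_Inl Q_in_A)
    next
      fix e assume "e \<in> arcs G" "h = Inr e"
      then show ?thesis
        by (intro bexI[of _ "Inr (X e)"] ballI) (auto simp: \<Phi>_Inr X_in_E)
    qed
  qed (rule bound1 comb, assumption)+
qed

end

section \<open>A sofic subshift has finitely many follower sets\<close>

lemma language_infix:
  assumes "u @ w @ v \<in> language \<Lambda>"
  shows "w \<in> language \<Lambda>"
proof (cases "w = []")
  case False
  then obtain x k where x: "x \<in> \<Lambda>" and k: "\<forall>j<length (u @ w @ v). x (k + int j) = (u @ w @ v) ! j"
    using assms by (auto simp: language_def occurs_def)
  have "x (k + int (length u) + int j) = w ! j" if "j < length w" for j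
    using k[rule_format, of "length u + j"] that by (simp add: nth_append add.assoc)
  then show ?thesis using x by (auto simp: language_def occurs_def)
qed (simp add: language_def)

lemma language_appendD1: "u @ v \<in> language \<Lambda> \<Longrightarrow> u \<in> language \<Lambda>"
  using language_infix[of "[]" u v] by simp

lemma language_appendD2: "u @ v \<in> language \<Lambda> \<Longrightarrow> v \<in> language \<Lambda>"
  using language_infix[of u v "[]"] by simp

lemma language_ConsD: "i # \<nu> \<in> language \<Lambda> \<Longrightarrow> \<nu> \<in> language \<Lambda>"
  using language_appendD2[of "[i]" \<nu>] by simp

lemma letter_bounds:
  assumes "subshift d \<Lambda>" "i # \<nu> \<in> language \<Lambda>"
  shows "i \<in> {1..d}"
proof -
  obtain x k where "x \<in> \<Lambda>" "\<forall>j<length (i # \<nu>). x (k + int j) = (i # \<nu>) ! j"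
    using assms(2) by (auto simp: language_def occurs_def)
  then have "x k = i" "x \<in> UNIV \<rightarrow> {1..d}"
    using assms(1) by (auto simp: subshift_def dest: spec[of _ 0])
  then show ?thesis by auto
qed

definition translate :: "int \<Rightarrow> (int \<Rightarrow> nat) \<Rightarrow> (int \<Rightarrow> nat)" where
  "translate k x = (\<lambda>n. x (n + k))"

lemma occurs_translate: "occurs w (translate k x) \<longleftrightarrow> occurs w x"
proof
  assume "occurs w (translate k x)"
  then obtain l where "\<forall>j<length w. x (l + int j + k) = w ! j"
    by (auto simp: occurs_def translate_def)
  then show "occurs w x" unfolding occurs_def by (intro exI[of _ "l + k"]) (simp add: algebra_simps)
next
  assume "occurs w x"
  then obtain l where "\<forall>j<length w. x (l + int j) = w ! j" by (auto simp: occurs_def)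
  then show "occurs w (translate k x)"
    unfolding occurs_def translate_def by (intro exI[of _ "l - k"]) (simp add: algebra_simps)
qed

text \<open>Compactness of \<open>\<Gamma>\<close> makes the continuous map \<open>x \<mapsto> f x 0\<close> depend on finitely many
  coordinates only, uniformly in \<open>x\<close> (the theorem of Curtis, Hedlund and Lyndon).\<close>

lemma local_rule:
  fixes f :: "(int \<Rightarrow> nat) \<Rightarrow> (int \<Rightarrow> nat)"
  assumes \<Gamma>: "finite_type \<Gamma>" and f: "continuous_on \<Gamma> f"
  obtains N :: int where "\<And>x y. x \<in> \<Gamma> \<Longrightarrow> y \<in> \<Gamma> \<Longrightarrow> (\<And>j. \<bar>j\<bar> \<le> N \<Longrightarrow> x j = y j) \<Longrightarrow> f x 0 = f y 0"
proof -
  obtain m W where W: "finite W" "\<Gamma> = {x \<in> UNIV \<rightarrow> {1..m}. \<forall>w\<in>W. \<not> occurs w x}"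
    using \<Gamma> by (auto simp: finite_type_def)
  have coord: "continuous_on UNIV (\<lambda>x :: int \<Rightarrow> nat. x j)" for j
    by simp
  have "compactin (product_topology (\<lambda>_. euclidean) UNIV) (PiE UNIV (\<lambda>_ :: int. {1..m}))"
    unfolding compactin_PiE by (simp add: finite_imp_compact)
  then have comp: "compact (PiE UNIV (\<lambda>_ :: int. {1..m}))"
    by (simp add: euclidean_product_topology)
  have avoid: "closed {x :: int \<Rightarrow> nat. \<not> occurs w x}" for w
  proof -
    have "open {x :: int \<Rightarrow> nat. occurs w x}"
    proof -
      have "{x :: int \<Rightarrow> nat. occurs w x}
          = (\<Union>k. \<Inter>j\<in>{..<length w}. (\<lambda>x. x (k + int j)) -` {w ! j})"
        by (auto simp: occurs_def)
      moreover have "open ((\<lambda>x :: int \<Rightarrow> nat. x (k + int j)) -` {w ! j})" for k j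
        by (rule open_vimage[OF open_discrete coord])
      ultimately show ?thesis by (simp only:) (intro open_UN open_INT ballI finite_lessThan)
    qed
    then show ?thesis by (simp add: closed_def Collect_neg_eq)
  qed
  have "\<Gamma> = PiE UNIV (\<lambda>_. {1..m}) \<inter> (\<Inter>w\<in>W. {x. \<not> occurs w x})"
    by (auto simp: W(2))
  then have \<Gamma>c: "compact \<Gamma>"
    using compact_Int_closed[OF comp closed_INT[of W]] avoid by simp
  define U where "U p = (\<Inter>j\<in>{- snd p..snd p}. (\<lambda>x. x j) -` {fst p j})"
    for p :: "(int \<Rightarrow> nat) \<times> int"
  have U: "open (U p)" for p
    unfolding U_def by (intro open_INT ballI open_vimage[OF open_discrete coord]) auto
  define C where "C = {p. fst p \<in> \<Gamma> \<and> (\<forall>y\<in>\<Gamma> \<inter> U p. f y 0 = f (fst p) 0)}"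
  have cover: "\<Gamma> \<subseteq> (\<Union>p\<in>C. U p)"
  proof
    fix x assume x: "x \<in> \<Gamma>"
    have "continuous_on \<Gamma> (\<lambda>y. f y 0)"
      by (rule continuous_on_compose2[OF coord f]) simp
    then have *: "open {f x 0} \<longrightarrow> (\<exists>T. open T \<and> T \<inter> \<Gamma> = (\<lambda>y. f y 0) -` {f x 0} \<inter> \<Gamma>)"
      unfolding continuous_on_open_invariant by (rule spec)
    from mp[OF * open_discrete] obtain T
      where T: "open T" "T \<inter> \<Gamma> = (\<lambda>y. f y 0) -` {f x 0} \<inter> \<Gamma>"
      by (elim exE conjE)
    have xT: "x \<in> T" using x T(2) by blast
    have "openin (product_topology (\<lambda>_. euclidean) UNIV) T"
      using T(1) unfolding open_fun_def .
    from product_topology_open_contains_basis[OF this xT]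
    obtain Y where Y: "x \<in> PiE UNIV Y" "finite {i. Y i \<noteq> UNIV}" "PiE UNIV Y \<subseteq> T"
      by auto
    obtain N :: int where N: "\<And>i. Y i \<noteq> UNIV \<Longrightarrow> \<bar>i\<bar> \<le> N"
    proof
      fix i assume "Y i \<noteq> UNIV"
      then show "\<bar>i\<bar> \<le> (\<Sum>i\<in>{i. Y i \<noteq> UNIV}. \<bar>i\<bar>)"
        using Y(2) by (intro member_le_sum) auto
    qed
    have "y \<in> T" if "y \<in> U (x, N)" for y
    proof -
      have "y i \<in> Y i" for i
      proof (cases "Y i = UNIV")
        case False
        have "i \<in> {- N..N}" using N[OF False] by (simp add: abs_le_iff)
        then have "y i = x i" using that by (simp add: U_def)
        then show ?thesis using Y(1) by (auto simp: PiE_iff)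
      qed simp
      then show ?thesis using Y(3) by (auto simp: PiE_iff)
    qed
    then have "(x, N) \<in> C" using T x by (auto simp: C_def)
    moreover have "x \<in> U (x, N)" by (simp add: U_def)
    ultimately show "x \<in> (\<Union>p\<in>C. U p)" by blast
  qed
  obtain D where D: "D \<subseteq> C" "finite D" "\<Gamma> \<subseteq> (\<Union>p\<in>D. U p)"
    using compactE_image[OF \<Gamma>c U cover] by blast
  define N where "N = (\<Sum>p\<in>D. \<bar>snd p\<bar>)"
  have N: "snd p \<le> N" if "p \<in> D" for p
    using member_le_sum[of p D "\<lambda>p. \<bar>snd p\<bar>"] that D(2) by (auto simp: N_def)
  show ?thesis
  proof
    fix x y assume xy: "x \<in> \<Gamma>" "y \<in> \<Gamma>" "\<And>j. \<bar>j\<bar> \<le> N \<Longrightarrow> x j = y j"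
    obtain p where p: "p \<in> D" "x \<in> U p" using D(3) xy(1) by blast
    have "x j = y j" if "j \<in> {- snd p..snd p}" for j
      using that N[OF p(1)] by (intro xy(3)) auto
    then have "y \<in> U p" using p(2) by (auto simp: U_def)
    moreover have "\<forall>z\<in>\<Gamma> \<inter> U p. f z 0 = f (fst p) 0"
      using D(1) p(1) by (auto simp: C_def)
    ultimately show "f x 0 = f y 0" using p(2) xy by simp
  qed
qed

text \<open>Let \<open>K\<close> be at least the radius of the local rule and the length of each forbidden word. Two
  points of \<open>\<Gamma>\<close> that agree on \<open>[-K, K]\<close> can be spliced there, the left half of one continuing as
  the right half of the other. Hence whether \<open>w\<mu>\<close> is admissible only depends on \<open>w\<close> and on the set
  of blocks on \<open>[-K, K]\<close> of points of \<open>\<Gamma>\<close> with \<open>\<mu>\<close> at the origin of their image, and there are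
  finitely many such sets.\<close>

lemma finite_follower_sets:
  assumes sofic: "sofic \<Lambda>"
  shows "finite (follower_set \<Lambda> ` language \<Lambda>)"
proof -
  obtain \<Gamma> f where \<Gamma>: "finite_type \<Gamma>" and f: "continuous_on \<Gamma> f" and img: "f ` \<Gamma> = \<Lambda>"
    and comm: "\<And>x. x \<in> \<Gamma> \<Longrightarrow> f (shift x) = shift (f x)"
    using sofic by (auto simp: sofic_def)
  obtain m W where W: "finite W" "\<Gamma> = {x \<in> UNIV \<rightarrow> {1..m}. \<forall>w\<in>W. \<not> occurs w x}"
    using \<Gamma> by (auto simp: finite_type_def)
  obtain N :: int
    where N: "\<And>x y. x \<in> \<Gamma> \<Longrightarrow> y \<in> \<Gamma> \<Longrightarrow> (\<And>j. \<bar>j\<bar> \<le> N \<Longrightarrow> x j = y j) \<Longrightarrow> f x 0 = f y 0"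
    using local_rule[OF \<Gamma> f] by blast
  have T\<Gamma>: "translate k x \<in> \<Gamma>" if "x \<in> \<Gamma>" for k x
    using that occurs_translate[of _ k x] by (auto simp: W(2) translate_def)
  have fT_nat: "f (translate (int n) x) = translate (int n) (f x)" if "x \<in> \<Gamma>" for n x
  proof (induction n)
    case (Suc n)
    have "translate (int (Suc n)) x = shift (translate (int n) x)" for x
      by (simp add: translate_def shift_def add.assoc)
    then show ?case using comm[OF T\<Gamma>[OF that, of "int n"]] Suc by simp
  qed (simp add: translate_def)
  have fT: "f (translate k x) = translate k (f x)" if "x \<in> \<Gamma>" for k x
  proof (cases "k \<ge> 0")
    case True
    then show ?thesis using fT_nat[OF that, of "nat k"] by simp
  next
    case False
    have "translate (- k) (translate k x) = x" by (simp add: translate_def)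
    then have "f x = translate (- k) (f (translate k x))"
      using fT_nat[OF T\<Gamma>[OF that, of k], of "nat (- k)"] False by simp
    then show ?thesis by (simp add: translate_def)
  qed
  have rule: "f x n = f y n"
    if "x \<in> \<Gamma>" "y \<in> \<Gamma>" "\<And>j. n - N \<le> j \<Longrightarrow> j \<le> n + N \<Longrightarrow> x j = y j" for x y n
  proof -
    have "f (translate n x) 0 = f (translate n y) 0"
      by (rule N[OF T\<Gamma>[OF that(1)] T\<Gamma>[OF that(2)]]) (auto simp: translate_def intro: that(3))
    then show ?thesis unfolding fT[OF that(1)] fT[OF that(2)] by (simp add: translate_def)
  qed
  define K where "K = \<bar>N\<bar> + (\<Sum>w\<in>W. int (length w))"
  have KN: "N \<le> K" unfolding K_def by (rule order_trans[OF abs_ge_self]) (simp add: sum_nonneg)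
  have KW: "int (length w) \<le> K" if "w \<in> W" for w
    using member_le_sum[of w W "\<lambda>w. int (length w)"] that W(1) by (simp add: K_def)
  have K0: "0 \<le> K" by (simp add: K_def sum_nonneg)
  have word: "\<exists>x\<in>\<Gamma>. \<forall>j<length w. f x (int j) = w ! j" if w: "w \<in> language \<Lambda>" "w \<noteq> []" for w
  proof -
    obtain y where y: "y \<in> \<Lambda>" "occurs w y" using w by (auto simp: language_def)
    obtain x where x: "x \<in> \<Gamma>" "y = f x" using y(1) unfolding img[symmetric] by (rule imageE)
    obtain k where k: "\<forall>j<length w. f x (k + int j) = w ! j"
      using y(2) unfolding x(2) occurs_def by (elim exE)
    have "f (translate k x) (int j) = w ! j" if "j < length w" for j
      using k that unfolding fT[OF x(1)] by (simp add: translate_def add.commute)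
    then show ?thesis using T\<Gamma>[OF x(1)] by blast
  qed
  define S where "S \<mu> = {restrict x {- K..K} | x. x \<in> \<Gamma> \<and> (\<forall>j<length \<mu>. f x (int j) = \<mu> ! j)}"
    for \<mu>
  have "S ` language \<Lambda> \<subseteq> Pow (PiE {- K..K} (\<lambda>_. {1..m}))"
    by (auto simp: S_def W(2) Pi_iff)
  then have finS: "finite (S ` language \<Lambda>)"
    by (rule finite_subset) (simp add: finite_PiE)
  have splice: "(\<lambda>n. if n \<le> K then x n else y n) \<in> \<Gamma>"
    if x: "x \<in> \<Gamma>" and y: "y \<in> \<Gamma>" and xy: "\<And>j. - K \<le> j \<Longrightarrow> j \<le> K \<Longrightarrow> x j = y j" for x y
  proof -
    let ?z = "\<lambda>n. if n \<le> K then x n else y n"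
    have "\<not> occurs w ?z" if w: "w \<in> W" for w
    proof
      assume "occurs w ?z"
      then obtain k where k: "\<forall>j<length w. ?z (k + int j) = w ! j" by (auto simp: occurs_def)
      show False
      proof (cases "k + int (length w) \<le> K + 1")
        case True
        then have "\<forall>j<length w. x (k + int j) = w ! j" using k by auto
        then have "occurs w x" unfolding occurs_def by blast
        then show False using x w unfolding W(2) by blast
      next
        case False
        then have "\<forall>j<length w. y (k + int j) = w ! j" using k KW[OF w] K0 xy by (auto split: if_splits)
        then have "occurs w y" unfolding occurs_def by blast
        then show False using y w unfolding W(2) by blast
      qed
    qed
    then show ?thesis using x y by (auto simp: W(2) Pi_iff)
  qed
  have sub: "follower_set \<Lambda> \<mu> \<subseteq> follower_set \<Lambda> \<nu>"
    if \<mu>: "\<mu> \<in> language \<Lambda>" and \<nu>: "\<nu> \<in> language \<Lambda>" and S: "S \<mu> = S \<nu>" for \<mu> \<nu>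
  proof
    fix w assume w: "w \<in> follower_set \<Lambda> \<mu>"
    then have wL: "w \<in> language \<Lambda>" "w @ \<mu> \<in> language \<Lambda>" by (simp_all add: follower_set_def)
    have "w @ \<nu> \<in> language \<Lambda>"
    proof (cases "w @ \<mu> = []")
      case True
      then show ?thesis using \<nu> by simp
    next
      case False
      then obtain x0 where x0: "x0 \<in> \<Gamma>" "\<forall>j<length (w @ \<mu>). f x0 (int j) = (w @ \<mu>) ! j"
        using word[OF wL(2)] by blast
      define x where "x = translate (int (length w)) x0"
      have x: "x \<in> \<Gamma>" unfolding x_def by (rule T\<Gamma>[OF x0(1)])
      have fx: "f x = translate (int (length w)) (f x0)"
        unfolding x_def by (rule fT[OF x0(1)])
      have x\<mu>: "f x (int j) = \<mu> ! j" if "j < length \<mu>" for j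
        using x0(2)[rule_format, of "length w + j"] that
        by (simp add: fx translate_def nth_append add.commute)
      have xw: "f x (int j - int (length w)) = w ! j" if "j < length w" for j
        using x0(2)[rule_format, of j] that
        by (simp add: fx translate_def nth_append)
      have "restrict x {- K..K} \<in> S \<mu>"
        unfolding S_def mem_Collect_eq by (intro exI[of _ x] conjI refl allI impI x x\<mu>)
      then have "restrict x {- K..K} \<in> S \<nu>" by (simp only: S)
      then obtain y where y: "restrict x {- K..K} = restrict y {- K..K} \<and> y \<in> \<Gamma> \<and>
          (\<forall>j<length \<nu>. f y (int j) = \<nu> ! j)"
        unfolding S_def mem_Collect_eq by (elim exE)
      then have eq: "restrict x {- K..K} = restrict y {- K..K}" by (rule conjunct1)
      have y: "y \<in> \<Gamma>" "\<And>j. j < length \<nu> \<Longrightarrow> f y (int j) = \<nu> ! j" using y by simp_all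
      have xy: "x j = y j" if "- K \<le> j" "j \<le> K" for j
        using fun_cong[OF eq, of j] that by simp
      define z where "z = (\<lambda>n. if n \<le> K then x n else y n)"
      have z: "z \<in> \<Gamma>" unfolding z_def by (rule splice[OF x y(1) xy])
      have "f z (- int (length w) + int j) = (w @ \<nu>) ! j" if j: "j < length (w @ \<nu>)" for j
      proof (cases "j < length w")
        case True
        have "f z (int j - int (length w)) = f x (int j - int (length w))"
          by (rule rule[OF z x]) (use True KN in \<open>auto simp: z_def\<close>)
        then show ?thesis using xw[OF True] True by (simp add: nth_append)
      next
        case False
        have "f z (int (j - length w)) = f y (int (j - length w))"
          by (rule rule[OF z y(1)]) (use KN xy in \<open>auto simp: z_def\<close>)
        moreover have "int (j - length w) = - int (length w) + int j" using False by simp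
        ultimately show ?thesis using y(2)[of "j - length w"] False j by (simp add: nth_append)
      qed
      then have "occurs (w @ \<nu>) (f z)" unfolding occurs_def by blast
      moreover have "f z \<in> \<Lambda>" using z img by blast
      ultimately show ?thesis by (auto simp: language_def)
    qed
    then show "w \<in> follower_set \<Lambda> \<nu>" using wL by (simp add: follower_set_def)
  qed
  have "follower_set \<Lambda> ` language \<Lambda> \<subseteq> (\<lambda>s. follower_set \<Lambda> (inv_into (language \<Lambda>) S s)) ` S ` language \<Lambda>"
  proof clarify
    fix \<mu> assume \<mu>: "\<mu> \<in> language \<Lambda>"
    let ?\<nu> = "inv_into (language \<Lambda>) S (S \<mu>)"
    have "?\<nu> \<in> language \<Lambda>" "S ?\<nu> = S \<mu>"
      using inv_into_into[OF imageI[OF \<mu>]] f_inv_into_f[OF imageI[OF \<mu>]] .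
    then have "follower_set \<Lambda> \<mu> = follower_set \<Lambda> ?\<nu>"
      using sub \<mu> by (metis subset_antisym)
    then show "follower_set \<Lambda> \<mu> \<in> (\<lambda>s. follower_set \<Lambda> (inv_into (language \<Lambda>) S s)) ` S ` language \<Lambda>"
      using \<mu> by blast
  qed
  then show ?thesis by (rule finite_subset) (intro finite_imageI finS)
qed

section \<open>Diagonal projections and creation operators\<close>

lemma cinner_ket_ket: "cinner (ket a) (ket b) = (if a = b then 1 else 0)"
  by (simp add: cinner_ket ket.rep_eq)

text \<open>The kets span a dense subspace, hence operators with the same matrix are equal.\<close>

lemma bounded_ops_eqI:
  assumes S: "S \<in> bounded_ops" and T: "T \<in> bounded_ops"
    and eq: "\<And>a b. cinner (ket b) (S (ket a)) = cinner (ket b) (T (ket a))"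
  shows "S = T"
proof (rule blinfun_eqI)
  fix x
  have "S (ket a) = T (ket a)" for a
    using eq[of _ a] by (intro coord_inject[THEN iffD1] ext) (simp add: cinner_ket)
  then have "S (c *\<^sub>C ket a) = T (c *\<^sub>C ket a)" for c a
    using S T by (simp add: bounded_ops_def)
  then have "((\<lambda>i. T (coord x i *\<^sub>C ket i)) has_sum S x) UNIV"
    using has_sum_bounded_linear[OF blinfun.bounded_linear_right[of S] ell2_expansion[of x]] by simp
  moreover have "((\<lambda>i. T (coord x i *\<^sub>C ket i)) has_sum T x) UNIV"
    by (rule has_sum_bounded_linear[OF blinfun.bounded_linear_right ell2_expansion])
  ultimately show "S x = T x" by (rule has_sum_unique)
qed

definition diag :: "'a set \<Rightarrow> 'a op" where
  "diag M = Blinfun (\<lambda>x. Abs_ell2 (\<lambda>w. if w \<in> M then coord x w else 0))"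

lemma coord_diag: "coord (diag M x) w = (if w \<in> M then coord x w else 0)"
proof -
  note r = ell2_relabel[of "\<lambda>w. w" M "\<lambda>x w. if w \<in> M then coord x w else 0"]
  show ?thesis
    unfolding diag_def by (subst bounded_linear_Blinfun_apply) (use r in auto)
qed

lemma diag_bounded: "diag M \<in> bounded_ops"
  unfolding bounded_ops_def
  by (auto intro!: coord_inject[THEN iffD1] ext simp: coord_diag scaleC_ell2.rep_eq)

lemma diag_ket: "diag M (ket a) = (if a \<in> M then ket a else 0)"
  by (intro coord_inject[THEN iffD1] ext) (simp add: coord_diag ket.rep_eq zero_ell2.rep_eq)

lemma diag_compose: "diag M o\<^sub>L diag N = diag (M \<inter> N)"
  by (intro blinfun_eqI coord_inject[THEN iffD1] ext) (simp add: coord_diag)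

lemma diag_adj: "adj (diag M) = diag M"
  by (rule adj_eqI, unfold cinner_def, rule infsum_cong) (simp add: coord_diag)

lemma diag_Diff: "N \<subseteq> M \<Longrightarrow> diag (M - N) = diag M + (- 1) *\<^sub>C diag N"
  by (intro blinfun_eqI coord_inject[THEN iffD1] ext)
    (auto simp: coord_diag blinfun.add_left scaleC_blinfun.rep_eq plus_ell2.rep_eq scaleC_ell2.rep_eq)

lemma diag_empty: "diag {} = 0"
  by (intro blinfun_eqI coord_inject[THEN iffD1] ext) (simp add: coord_diag zero_ell2.rep_eq)

lemma creation_bounded: "creation \<Lambda> i \<in> bounded_ops"
  unfolding bounded_ops_def
  by (auto intro!: coord_inject[THEN iffD1] ext simp: coord_creation scaleC_ell2.rep_eq split: list.split)

lemma fock_id_diag: "fock_id \<Lambda> = diag (language \<Lambda>)"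
  by (simp add: fock_id_def diag_def)

lemma word_op_Nil: "word_op \<Lambda> [] = diag (language \<Lambda>)"
  and word_op_Cons: "word_op \<Lambda> (i # \<mu>) = creation \<Lambda> i o\<^sub>L word_op \<Lambda> \<mu>"
  by (simp_all add: word_op_def fock_id_diag)

lemma word_op_bounded: "word_op \<Lambda> \<mu> \<in> bounded_ops"
  by (induction \<mu>) (simp_all add: word_op_Nil word_op_Cons diag_bounded creation_bounded bounded_ops_compose)

lemma word_op_ket:
  "word_op \<Lambda> \<mu> (ket \<nu>) = (if \<mu> @ \<nu> \<in> language \<Lambda> then ket (\<mu> @ \<nu>) else 0)"
proof (induction \<mu>)
  case (Cons i \<mu>)
  then show ?case using language_ConsD[of i "\<mu> @ \<nu>" \<Lambda>] by (auto simp: word_op_Cons creation_ket)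
qed (simp add: word_op_Nil diag_ket)

lemma word_op_initial_projection:
  "adj (word_op \<Lambda> \<mu>) o\<^sub>L word_op \<Lambda> \<mu> = diag {\<nu>. \<mu> @ \<nu> \<in> language \<Lambda>}"
proof (rule bounded_ops_eqI)
  show "adj (word_op \<Lambda> \<mu>) o\<^sub>L word_op \<Lambda> \<mu> \<in> bounded_ops"
    by (intro bounded_ops_compose adj_in_bounded_ops word_op_bounded)
  show "cinner (ket b) ((adj (word_op \<Lambda> \<mu>) o\<^sub>L word_op \<Lambda> \<mu>) (ket a))
      = cinner (ket b) (diag {\<nu>. \<mu> @ \<nu> \<in> language \<Lambda>} (ket a))" for a b
    by (auto simp: adj_works'[OF word_op_bounded, symmetric] word_op_ket diag_ket cinner_ket_ket)
       (simp add: cinner_def zero_ell2.rep_eq)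
qed (rule diag_bounded)

section \<open>The correspondence of a sofic subshift\<close>

text \<open>The minimal projections of the coefficient algebra.\<close>

definition vertex_proj :: "(int \<Rightarrow> nat) set \<Rightarrow> nat list set \<Rightarrow> nat list op" where
  "vertex_proj \<Lambda> v = diag {\<nu> \<in> language \<Lambda>. follower_set \<Lambda> \<nu> = v}"

definition edge_op :: "(int \<Rightarrow> nat) set \<Rightarrow> nat list set \<times> nat \<times> nat list set \<Rightarrow> nat list op" where
  "edge_op \<Lambda> = (\<lambda>(u, i, v). creation \<Lambda> i o\<^sub>L vertex_proj \<Lambda> u)"

lemma vertex_proj_ket:
  "vertex_proj \<Lambda> v (ket \<nu>) = (if \<nu> \<in> language \<Lambda> \<and> follower_set \<Lambda> \<nu> = v then ket \<nu> else 0)"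
  by (simp add: vertex_proj_def diag_ket)

lemma vertex_proj_bounded: "vertex_proj \<Lambda> v \<in> bounded_ops"
  by (simp add: vertex_proj_def diag_bounded)

lemma edge_op_bounded: "edge_op \<Lambda> e \<in> bounded_ops"
  by (cases e) (simp add: edge_op_def creation_bounded vertex_proj_bounded bounded_ops_compose)

lemma edge_op_ket:
  "edge_op \<Lambda> (u, i, v) (ket \<nu>)
    = (if \<nu> \<in> language \<Lambda> \<and> follower_set \<Lambda> \<nu> = u \<and> i # \<nu> \<in> language \<Lambda> then ket (i # \<nu>) else 0)"
  by (simp add: edge_op_def vertex_proj_ket creation_ket)

lemma Cons_language_iff:
  "\<nu> \<in> language \<Lambda> \<Longrightarrow> i # \<nu> \<in> language \<Lambda> \<longleftrightarrow> [i] \<in> follower_set \<Lambda> \<nu>"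
  using language_appendD1[of "[i]" \<nu> \<Lambda>] by (auto simp: follower_set_def)

lemma follower_set_Cons:
  "i # \<nu> \<in> language \<Lambda> \<Longrightarrow> follower_set \<Lambda> (i # \<nu>) = {w. w @ [i] \<in> follower_set \<Lambda> \<nu>}"
  using language_appendD1[of "_ @ [i]" \<nu> \<Lambda>] language_appendD1[of _ "[i]" \<Lambda>]
  by (auto simp: follower_set_def)

lemma arc_cases:
  assumes "e \<in> arcs (follower_graph \<Lambda>)"
  obtains \<mu> i where "e = (follower_set \<Lambda> \<mu>, i, follower_set \<Lambda> (i # \<mu>))" "i # \<mu> \<in> language \<Lambda>"
    "\<mu> \<in> language \<Lambda>"
  using assms language_ConsD by (auto simp: follower_graph_def)

text \<open>Edges leaving a vertex are determined by their label: the target of an edge labelled \<open>i\<close> from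
  \<open>F(\<mu>)\<close> and its existence only depend on \<open>F(\<mu>)\<close>.\<close>

lemma follower_set_step:
  assumes "i # \<mu> \<in> language \<Lambda>" "\<nu> \<in> language \<Lambda>" "follower_set \<Lambda> \<nu> = follower_set \<Lambda> \<mu>"
  shows "i # \<nu> \<in> language \<Lambda>" and "follower_set \<Lambda> (i # \<nu>) = follower_set \<Lambda> (i # \<mu>)"
proof -
  show "i # \<nu> \<in> language \<Lambda>"
    using assms Cons_language_iff language_ConsD by metis
  then show "follower_set \<Lambda> (i # \<nu>) = follower_set \<Lambda> (i # \<mu>)"
    using assms by (simp add: follower_set_Cons)
qed

lemma edge_op_ket_arc:
  assumes "e \<in> arcs (follower_graph \<Lambda>)"
  shows "edge_op \<Lambda> e (ket \<nu>) = (if \<nu> \<in> language \<Lambda> \<and> follower_set \<Lambda> \<nu> = fst e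
    then ket (fst (snd e) # \<nu>) else 0)"
  using assms by (elim arc_cases) (auto simp: edge_op_ket dest: follower_set_step)

lemma graph_correspondence_follower_graph:
  assumes \<Lambda>: "subshift d \<Lambda>" "sofic \<Lambda>"
  shows "graph_correspondence (follower_graph \<Lambda>) (vertex_proj \<Lambda>) (edge_op \<Lambda>)"
proof
  let ?G = "follower_graph \<Lambda>"
  have verts: "verts ?G = follower_set \<Lambda> ` language \<Lambda>" by (simp add: follower_graph_def)
  have tail: "tail ?G e = fst e" and head: "head ?G e = snd (snd e)" for e
    by (cases e, simp add: follower_graph_def)+
  show fin: "finite (verts ?G)" using finite_follower_sets[OF \<Lambda>(2)] by (simp add: verts)
  show t: "tail ?G e \<in> verts ?G" and h: "head ?G e \<in> verts ?G" if "e \<in> arcs ?G" for e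
    using that by (auto elim!: arc_cases simp: verts tail head)
  have "arcs ?G \<subseteq> verts ?G \<times> {1..d} \<times> verts ?G"
    using letter_bounds[OF \<Lambda>(1)] by (auto elim!: arc_cases simp: verts)
  then show "finite (arcs ?G)" by (rule finite_subset) (simp add: fin)
  fix v w assume v: "v \<in> verts ?G"
  show "vertex_proj \<Lambda> v \<in> bounded_ops" by (rule vertex_proj_bounded)
  show "adj (vertex_proj \<Lambda> v) = vertex_proj \<Lambda> v" by (simp add: vertex_proj_def diag_adj)
  show "vertex_proj \<Lambda> v o\<^sub>L vertex_proj \<Lambda> w = (if v = w then vertex_proj \<Lambda> v else 0)"
  proof -
    have "{\<nu> \<in> language \<Lambda>. follower_set \<Lambda> \<nu> = v} \<inter> {\<nu> \<in> language \<Lambda>. follower_set \<Lambda> \<nu> = w}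
        = (if v = w then {\<nu> \<in> language \<Lambda>. follower_set \<Lambda> \<nu> = v} else {})" by auto
    then show ?thesis by (simp add: vertex_proj_def diag_compose diag_empty)
  qed
  obtain \<nu> where \<nu>: "\<nu> \<in> language \<Lambda>" "follower_set \<Lambda> \<nu> = v" using v by (auto simp: verts)
  show "vertex_proj \<Lambda> v \<noteq> 0"
  proof
    assume "vertex_proj \<Lambda> v = 0"
    then have "vertex_proj \<Lambda> v (ket \<nu>) = 0" by simp
    then have "cinner (ket \<nu>) (ket \<nu>) = 0" using \<nu> by (simp add: vertex_proj_ket)
    then show False by (simp add: cinner_ket_ket)
  qed
next
  let ?G = "follower_graph \<Lambda>"
  have tail: "tail ?G e = fst e" and head: "head ?G e = snd (snd e)" for e
    by (cases e, simp add: follower_graph_def)+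
  have c0: "cinner 0 x = 0" for x :: "nat list ell2" by (simp add: cinner_def zero_ell2.rep_eq)
  fix e f assume e: "e \<in> arcs ?G"
  show "edge_op \<Lambda> e \<in> bounded_ops" by (rule edge_op_bounded)
  show "vertex_proj \<Lambda> v o\<^sub>L edge_op \<Lambda> e = (if v = head ?G e then edge_op \<Lambda> e else 0)" for v
  proof (rule bounded_ops_eqI)
    show "vertex_proj \<Lambda> v o\<^sub>L edge_op \<Lambda> e \<in> bounded_ops"
      by (intro bounded_ops_compose vertex_proj_bounded edge_op_bounded)
    show "(if v = head ?G e then edge_op \<Lambda> e else 0) \<in> bounded_ops" by (simp add: edge_op_bounded)
    show "cinner (ket b) ((vertex_proj \<Lambda> v o\<^sub>L edge_op \<Lambda> e) (ket a))
        = cinner (ket b) ((if v = head ?G e then edge_op \<Lambda> e else 0) (ket a))" for a b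
      using e
    proof (rule arc_cases)
      fix \<mu> i assume *: "e = (follower_set \<Lambda> \<mu>, i, follower_set \<Lambda> (i # \<mu>))" "i # \<mu> \<in> language \<Lambda>"
      then have "fst e = follower_set \<Lambda> \<mu>" "fst (snd e) = i" "snd (snd e) = follower_set \<Lambda> (i # \<mu>)"
        by simp_all
      then show ?thesis
        using follower_set_step[OF *(2), of a]
        by (auto simp: edge_op_ket_arc[OF e] head vertex_proj_ket)
    qed
  qed
  assume f: "f \<in> arcs ?G"
  show "adj (edge_op \<Lambda> e) o\<^sub>L edge_op \<Lambda> f = (if e = f then vertex_proj \<Lambda> (tail ?G e) else 0)"
  proof (rule bounded_ops_eqI)
    show "adj (edge_op \<Lambda> e) o\<^sub>L edge_op \<Lambda> f \<in> bounded_ops"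
      by (intro bounded_ops_compose adj_in_bounded_ops edge_op_bounded)
    show "(if e = f then vertex_proj \<Lambda> (tail ?G e) else 0) \<in> bounded_ops"
      by (simp add: vertex_proj_bounded)
    have ef: "e = f" if "fst e = fst f" "fst (snd e) = fst (snd f)"
    proof -
      obtain \<mu> i where 1: "e = (follower_set \<Lambda> \<mu>, i, follower_set \<Lambda> (i # \<mu>))" "i # \<mu> \<in> language \<Lambda>"
        using e by (rule arc_cases)
      obtain \<nu> j where 2: "f = (follower_set \<Lambda> \<nu>, j, follower_set \<Lambda> (j # \<nu>))" "\<nu> \<in> language \<Lambda>"
        using f by (rule arc_cases)
      show ?thesis using follower_set_step(2)[OF 1(2) 2(2)] that by (simp add: 1(1) 2(1))
    qed
    show "cinner (ket b) ((adj (edge_op \<Lambda> e) o\<^sub>L edge_op \<Lambda> f) (ket a))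
        = cinner (ket b) ((if e = f then vertex_proj \<Lambda> (tail ?G e) else 0) (ket a))" for a b
      using ef by (auto simp: adj_works'[OF edge_op_bounded, symmetric] edge_op_ket_arc[OF e]
          edge_op_ket_arc[OF f] vertex_proj_ket tail cinner_ket_ket c0)
  qed
qed

text \<open>\<open>T\<^sub>\<mu>\<^sup>* T\<^sub>\<mu>\<close> is the sum of the vertex projections of the follower sets containing \<open>\<mu>\<close>; conversely,
  finitely many words distinguish the finitely many follower sets, so that each vertex projection
  is a product of such operators and of their complements.\<close>

lemma coefficient_algebra_eq:
  assumes \<Lambda>: "subshift d \<Lambda>" "sofic \<Lambda>"
  shows "coefficient_algebra \<Lambda> = cspan (vertex_proj \<Lambda> ` verts (follower_graph \<Lambda>))"
proof
  interpret graph_correspondence "follower_graph \<Lambda>" "vertex_proj \<Lambda>" "edge_op \<Lambda>"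
    by (rule graph_correspondence_follower_graph[OF \<Lambda>])
  let ?G = "follower_graph \<Lambda>" and ?L = "language \<Lambda>" and ?F = "follower_set \<Lambda>"
  have verts: "verts ?G = ?F ` ?L" by (simp add: follower_graph_def)
  let ?gen = "(\<lambda>\<mu>. adj (word_op \<Lambda> \<mu>) o\<^sub>L word_op \<Lambda> \<mu>) ` ?L"
  have "adj (word_op \<Lambda> \<mu>) o\<^sub>L word_op \<Lambda> \<mu> = vsum (\<lambda>v. if \<mu> \<in> v then 1 else 0)"
    if "\<mu> \<in> ?L" for \<mu>
    unfolding word_op_initial_projection
  proof (rule bounded_ops_eqI[OF diag_bounded vsum_bounded])
    fix a b
    have "vsum (\<lambda>v. if \<mu> \<in> v then 1 else 0) (ket a)
        = (\<Sum>v\<in>verts ?G. if v = ?F a then (if a \<in> ?L \<and> \<mu> \<in> v then ket a else 0) else 0)"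
      unfolding vsum_def blinfun.sum_left
      by (intro sum.cong refl) (auto simp: scaleC_blinfun.rep_eq vertex_proj_ket scaleC_zero_right)
    also have "\<dots> = (if a \<in> ?L \<and> \<mu> \<in> ?F a then ket a else 0)"
      using finite_follower_sets[OF \<Lambda>(2)] by (auto simp: verts)
    also have "\<dots> = diag {\<nu>. \<mu> @ \<nu> \<in> ?L} (ket a)"
      using that language_appendD2[of \<mu> a] by (auto simp: diag_ket follower_set_def)
    finally show "cinner (ket b) (diag {\<nu>. \<mu> @ \<nu> \<in> ?L} (ket a))
        = cinner (ket b) (vsum (\<lambda>v. if \<mu> \<in> v then 1 else 0) (ket a))" by simp
  qed
  then show "coefficient_algebra \<Lambda> \<subseteq> cspan (vertex_proj \<Lambda> ` verts ?G)"
    unfolding coefficient_algebra_def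
    by (intro cstar_gen_least cstar_subalgebra_A) auto
  have C: "cstar_subalgebra (coefficient_algebra \<Lambda>)"
    unfolding coefficient_algebra_def
    by (intro cstar_subalgebra_cstar_gen)
      (auto intro!: bounded_ops_compose adj_in_bounded_ops word_op_bounded)
  then have Csub: "csubspace (coefficient_algebra \<Lambda>)" by (simp add: cstar_subalgebra_def)
  have gen: "diag {\<nu>. \<mu> @ \<nu> \<in> ?L} \<in> coefficient_algebra \<Lambda>" if "\<mu> \<in> ?L" for \<mu>
    using cstar_gen_superset[of ?gen] that
    unfolding coefficient_algebra_def word_op_initial_projection[symmetric] by blast
  have one: "diag ?L \<in> coefficient_algebra \<Lambda>"
  proof -
    have "[] \<in> ?L" by (simp add: language_def)
    from gen[OF this] show ?thesis by simp
  qed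
  have compl: "diag (?L - M) \<in> coefficient_algebra \<Lambda>"
    if "diag M \<in> coefficient_algebra \<Lambda>" "M \<subseteq> ?L" for M
    using Csub one that by (simp add: diag_Diff csubspace_def)
  have sep: "\<exists>R. diag R \<in> coefficient_algebra \<Lambda> \<and> R \<subseteq> ?L \<and>
      {\<nu> \<in> ?L. ?F \<nu> = v} \<subseteq> R \<and> {\<nu> \<in> ?L. ?F \<nu> = u} \<inter> R = {}"
    if uv: "u \<noteq> v" "u \<in> verts ?G" "v \<in> verts ?G" for u v
  proof -
    obtain \<mu> where \<mu>: "\<mu> \<in> v \<and> \<mu> \<notin> u \<or> \<mu> \<in> u \<and> \<mu> \<notin> v" using uv(1) by blast
    then have \<mu>L: "\<mu> \<in> ?L" using uv by (auto simp: verts follower_set_def)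
    let ?M = "{\<nu>. \<mu> @ \<nu> \<in> ?L}"
    have M: "?M \<subseteq> ?L" using language_appendD2 by blast
    have F: "\<nu> \<in> ?M \<longleftrightarrow> \<mu> \<in> ?F \<nu>" for \<nu> using \<mu>L by (simp add: follower_set_def)
    from \<mu> show ?thesis
    proof
      assume "\<mu> \<in> v \<and> \<mu> \<notin> u"
      then show ?thesis using gen[OF \<mu>L] M F by (intro exI[of _ ?M]) auto
    next
      assume "\<mu> \<in> u \<and> \<mu> \<notin> v"
      then show ?thesis using compl[OF gen[OF \<mu>L] M] F by (intro exI[of _ "?L - ?M"]) auto
    qed
  qed
  have "vertex_proj \<Lambda> v \<in> coefficient_algebra \<Lambda>" if v: "v \<in> verts ?G" for v
  proof -
    have "\<exists>R. diag R \<in> coefficient_algebra \<Lambda> \<and> R \<subseteq> ?L \<and> {\<nu> \<in> ?L. ?F \<nu> = v} \<subseteq> R \<and>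
        (\<forall>u\<in>U. {\<nu> \<in> ?L. ?F \<nu> = u} \<inter> R = {})"
      if "finite U" "U \<subseteq> verts ?G - {v}" for U
      using that
    proof (induction U)
      case empty
      show ?case using one by (intro exI[of _ ?L]) auto
    next
      case (insert u U)
      obtain R where R: "diag R \<in> coefficient_algebra \<Lambda>" "R \<subseteq> ?L" "{\<nu> \<in> ?L. ?F \<nu> = v} \<subseteq> R"
        "\<forall>u\<in>U. {\<nu> \<in> ?L. ?F \<nu> = u} \<inter> R = {}" using insert by auto
      obtain R' where R': "diag R' \<in> coefficient_algebra \<Lambda>" "{\<nu> \<in> ?L. ?F \<nu> = v} \<subseteq> R'"
        "{\<nu> \<in> ?L. ?F \<nu> = u} \<inter> R' = {}" using sep[of u v] insert.prems v by auto
      have "diag (R \<inter> R') \<in> coefficient_algebra \<Lambda>"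
        using C R(1) R'(1) by (auto simp: cstar_subalgebra_def diag_compose[symmetric])
      then show ?case using R R' by (intro exI[of _ "R \<inter> R'"]) auto
    qed
    from this[of "verts ?G - {v}"] obtain R where R: "diag R \<in> coefficient_algebra \<Lambda>" "R \<subseteq> ?L"
      "{\<nu> \<in> ?L. ?F \<nu> = v} \<subseteq> R" "\<forall>u\<in>verts ?G - {v}. {\<nu> \<in> ?L. ?F \<nu> = u} \<inter> R = {}" by auto
    have "R = {\<nu> \<in> ?L. ?F \<nu> = v}"
    proof
      show "R \<subseteq> {\<nu> \<in> ?L. ?F \<nu> = v}" using R(2,4) by (auto simp: verts)
    qed (rule R(3))
    then show ?thesis using R(1) by (simp add: vertex_proj_def)
  qed
  then show "cspan (vertex_proj \<Lambda> ` verts ?G) \<subseteq> coefficient_algebra \<Lambda>"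
    unfolding cspan_def by (intro hull_minimal Csub) auto
qed

text \<open>Expanding \<open>a\<close> in the vertex projections writes \<open>T\<^sub>i a\<close> as a combination of the \<open>T\<^sub>i Q\<^sub>v\<close>, and these
  vanish unless an edge labelled \<open>i\<close> leaves \<open>v\<close>. Their span is closed already.\<close>

lemma shift_module_eq:
  assumes \<Lambda>: "subshift d \<Lambda>" "sofic \<Lambda>"
  shows "shift_module d \<Lambda> = cspan (edge_op \<Lambda> ` arcs (follower_graph \<Lambda>))"
proof
  interpret graph_correspondence "follower_graph \<Lambda>" "vertex_proj \<Lambda>" "edge_op \<Lambda>"
    by (rule graph_correspondence_follower_graph[OF \<Lambda>])
  let ?G = "follower_graph \<Lambda>"
  have step: "creation \<Lambda> i o\<^sub>L vertex_proj \<Lambda> v \<in> E" if v: "v \<in> verts ?G" for i v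
  proof -
    obtain \<mu> where \<mu>: "\<mu> \<in> language \<Lambda>" "v = follower_set \<Lambda> \<mu>"
      using v by (auto simp: follower_graph_def)
    show ?thesis
    proof (cases "i # \<mu> \<in> language \<Lambda>")
      case True
      then have "(v, i, follower_set \<Lambda> (i # \<mu>)) \<in> arcs ?G" using \<mu> by (auto simp: follower_graph_def)
      from X_in_E[OF this] show ?thesis by (simp add: edge_op_def)
    next
      case False
      have "i # \<nu> \<notin> language \<Lambda>" if "\<nu> \<in> language \<Lambda>" "follower_set \<Lambda> \<nu> = v" for \<nu>
        using False that \<mu> Cons_language_iff by metis
      then have "creation \<Lambda> i o\<^sub>L vertex_proj \<Lambda> v = 0"
        by (intro bounded_ops_eqI bounded_ops_compose creation_bounded vertex_proj_bounded)
          (auto simp: vertex_proj_ket creation_ket)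
      then show ?thesis using csubspace_cspan[of "edge_op \<Lambda> ` arcs ?G"] by (simp add: csubspace_def)
    qed
  qed
  have "creation \<Lambda> i o\<^sub>L a \<in> E" if "a \<in> coefficient_algebra \<Lambda>" for i a
  proof -
    have "a \<in> A" using that by (simp add: coefficient_algebra_eq[OF \<Lambda>])
    then obtain c where "a = vsum c" by (auto simp: A_eq)
    then have "creation \<Lambda> i o\<^sub>L a = (\<Sum>v\<in>verts ?G. c v *\<^sub>C (creation \<Lambda> i o\<^sub>L vertex_proj \<Lambda> v))"
      by (simp add: vsum_def compose_sum_right compose_scaleC_right creation_bounded)
    then show ?thesis using csubspace_sum[OF csubspace_cspan step] by simp
  qed
  then have "cspan {creation \<Lambda> i o\<^sub>L a | i a. i \<in> {1..d} \<and> a \<in> coefficient_algebra \<Lambda>} \<subseteq> E"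
    unfolding cspan_def by (intro hull_minimal csubspace_cspan[unfolded cspan_def]) (auto simp: cspan_def)
  then show "shift_module d \<Lambda> \<subseteq> E"
    unfolding shift_module_def by (rule closure_minimal[OF _ closed_E])
  have "edge_op \<Lambda> ` arcs ?G \<subseteq> {creation \<Lambda> i o\<^sub>L a | i a. i \<in> {1..d} \<and> a \<in> coefficient_algebra \<Lambda>}"
  proof clarify
    fix u i v assume arc: "(u, i, v) \<in> arcs ?G"
    then obtain \<mu> where "u = follower_set \<Lambda> \<mu>" "i # \<mu> \<in> language \<Lambda>" "\<mu> \<in> language \<Lambda>"
      by (rule arc_cases) simp
    then have "u \<in> verts ?G" "i \<in> {1..d}"
      using letter_bounds[OF \<Lambda>(1)] by (auto simp: follower_graph_def)
    then show "\<exists>j a. edge_op \<Lambda> (u, i, v) = creation \<Lambda> j o\<^sub>L a \<and> j \<in> {1..d} \<and> a \<in> coefficient_algebra \<Lambda>"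
      unfolding coefficient_algebra_eq[OF \<Lambda>]
      by (intro exI[of _ i] exI[of _ "vertex_proj \<Lambda> u"]) (auto simp: edge_op_def Q_in_A)
  qed
  then have "E \<subseteq> cspan {creation \<Lambda> i o\<^sub>L a | i a. i \<in> {1..d} \<and> a \<in> coefficient_algebra \<Lambda>}"
    unfolding cspan_def by (rule hull_mono)
  then show "E \<subseteq> shift_module d \<Lambda>"
    unfolding shift_module_def using closure_subset by blast
qed

theorem proposition10p2:
  fixes d :: nat and \<Lambda> :: "(int \<Rightarrow> nat) set"
  assumes "subshift d \<Lambda>"
    and "sofic \<Lambda>"
    and "\<forall>i\<in>{1..d}. [i] \<in> language \<Lambda>"
  shows "star_isomorphic
    (cuntz_pimsner (coefficient_algebra \<Lambda>) (shift_module d \<Lambda>)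
      :: ((nat list op + nat list op \<Rightarrow> 'h::infinite op) \<times> 'h) op set)
    (graph_cstar (follower_graph \<Lambda>)
      :: ((nat list set + nat list set \<times> nat \<times> nat list set \<Rightarrow> 'h op) \<times> 'h) op set)"
  unfolding coefficient_algebra_eq[OF assms(1,2)] shift_module_eq[OF assms(1,2)]
  by (rule graph_correspondence.cuntz_pimsner_isomorphic_graph_cstar[
        OF graph_correspondence_follower_graph[OF assms(1,2)]])

end
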